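(* Let $\mathfrak g=\mathfrak{gl}(m|1)$ with the distinguished Borel subalgebra and let $\lambda\in\mathfrak h^*$ be an atypical weight. Let $p\le m$ be such that $(\lambda+\rho,\varepsilon_p-\delta_1)=0$ and $(\lambda+\rho,\varepsilon_j-\delta_1)\neq 0$ for all $j>p$. Then $\{\varepsilon_i-\delta_1\}\in\mathcal S(\lambda)$ if and only if $i\le p$ and $(\lambda+\rho,\varepsilon_i-\delta_1)\in\mathbb Z_{\ge 0}$.
   Context: Work over $\mathbb C$. For $\mathfrak g=\mathfrak{gl}(m|n)$ (here $n=1$), $\mathfrak h$ is the diagonal Cartan subalgebra, $\mathfrak h^*$ has the standard basis $\varepsilon_1,\dots,\varepsilon_m,\delta_1,\dots,\delta_n$ and the form $(\varepsilon_i,\varepsilon_i)=1$, $(\delta_j,\delta_j)=-1$, all other pairings of basis vectors being $0$. The distinguished Borel subalgebra $\mathfrak b$ has positive roots $\varepsilon_i-\varepsilon_j$ ($i<j$), $\delta_i-\delta_j$ ($i<j$) (even) and $\varepsilon_i-\delta_j$ (all $i,j$; odd). $\rho$ is half the sum of the positive even roots minus half the sum of the positive odd roots. A weight $\lambda$ is atypical if $(\lambda+\rho,\gamma)=0$ for some odd root $\gamma$. $M(\lambda)$ is the Verma module $U(\mathfrak g)\otimes_{U(\mathfrak b)}\mathbb C_\lambda$. Let $X=\{x\in\mathfrak g_{\bar 1}\mid [x,x]=0\}$, and for a $\mathfrak g$-module $M$ let $X_M=\{x\in X\mid xM\neq\ker(x|_M)\}$. Let $\mathcal S$ be the set of all subsets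 $S$ (including $\emptyset$) of mutually orthogonal, linearly independent odd isotropic roots; for $S=\{\alpha_1,\dots,\alpha_k\}\in\mathcal S$ let $x_S=x_1+\dots+x_k$ with $0\neq x_i\in\mathfrak g_{\alpha_i}$, whose orbit $\Phi(S)=B_{\bar 0}x_S$ under the Borel subgroup $B_{\bar 0}$ (with Lie algebra $\mathfrak b_{\bar 0}=\mathfrak b\cap \mathfrak g_{\bar 0}$) is independent of choices. Then $\mathcal S(\lambda)=\{S\in\mathcal S\mid \Phi(S)\subset X_{M(\lambda)}\}$. *)

theory Defs
  imports
    "HOL-Analysis.Analysis"
    "HOL-Algebra.QuotRing"
    "HOL-Algebra.Free_Abelian_Groups"
begin

text \<open>
  The general linear Lie superalgebra over the complex numbers is the space of square matrices whose
  rows and columns are indexed by \<open>'m + 'n\<close>: the indices \<open>Inl i\<close> are even, the indices \<open>Inr j\<close> are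
  odd.  The index types are finite and linearly ordered, so that \<open>'m\<close> plays the role of
  \<open>{1, ..., m}\<close> with \<open>m = CARD('m)\<close>, and likewise for \<open>'n\<close>.
\<close>

type_synonym ('m, 'n) gl = "complex ^ ('m + 'n) ^ ('m + 'n)"

text \<open>Coordinates with respect to the basis \<open>\<epsilon>\<^sub>1, ..., \<epsilon>\<^sub>m, \<delta>\<^sub>1, ..., \<delta>\<^sub>n\<close> of the dual Cartan algebra.\<close>

type_synonym ('m, 'n) weight = "complex ^ ('m + 'n)"


section \<open>The Lie superalgebra\<close>

definition scale_mat :: "complex \<Rightarrow> ('m::finite, 'n::finite) gl \<Rightarrow> ('m, 'n) gl" where
  "scale_mat c A = (\<chi> k l. c * A $ k $ l)"

text \<open>The homogeneous components; the odd one is \<open>gl_part True\<close>.\<close>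

definition gl_part :: "bool \<Rightarrow> ('m::finite, 'n::finite) gl set" where
  "gl_part a = {A. \<forall>k l. A $ k $ l \<noteq> 0 \<longrightarrow> (isl k \<noteq> isl l) = a}"

definition gl_proj :: "bool \<Rightarrow> ('m::finite, 'n::finite) gl \<Rightarrow> ('m, 'n) gl" where
  "gl_proj a A = (\<chi> k l. if (isl k \<noteq> isl l) = a then A $ k $ l else 0)"

text \<open>The bilinear map that is \<open>A B - (-1)^(|A| |B|) B A\<close> on homogeneous \<open>A\<close>, \<open>B\<close>.\<close>

definition sbracket :: "('m::finite, 'n::finite) gl \<Rightarrow> ('m, 'n) gl \<Rightarrow> ('m, 'n) gl" where
  "sbracket A B =
     A ** B - B ** gl_proj False A - gl_proj False B ** gl_proj True A
       + gl_proj True B ** gl_proj True A"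

definition cartan :: "('m::finite, 'n::finite) gl set" where
  "cartan = {A. \<forall>k l. k \<noteq> l \<longrightarrow> A $ k $ l = 0}"

text \<open>
  \<open>weight_at \<alpha> h\<close> is the value of \<open>\<alpha>\<close> at \<open>h\<close> in the Cartan algebra.  On an arbitrary matrix it
  only sees the diagonal.
\<close>

definition weight_at :: "('m::finite, 'n::finite) weight \<Rightarrow> ('m, 'n) gl \<Rightarrow> complex" where
  "weight_at \<alpha> A = (\<Sum>k\<in>UNIV. \<alpha> $ k * A $ k $ k)"

definition eps :: "'m \<Rightarrow> ('m::finite, 'n::finite) weight" where
  "eps i = axis (Inl i) 1"

definition del :: "'n \<Rightarrow> ('m::finite, 'n::finite) weight" where
  "del j = axis (Inr j) 1"

definition weight_form :: "('m::finite, 'n::finite) weight \<Rightarrow> ('m, 'n) weight \<Rightarrow> complex" where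
  "weight_form \<alpha> \<beta> =
     (\<Sum>i\<in>UNIV. \<alpha> $ Inl i * \<beta> $ Inl i) - (\<Sum>j\<in>UNIV. \<alpha> $ Inr j * \<beta> $ Inr j)"

definition even_pos_roots :: "('m::{finite,linorder}, 'n::{finite,linorder}) weight set" where
  "even_pos_roots = {eps i - eps j | i j. i < j} \<union> {del i - del j | i j. i < j}"

definition odd_pos_roots :: "('m::finite, 'n::finite) weight set" where
  "odd_pos_roots = {eps i - del j | i j. True}"

definition odd_roots :: "('m::finite, 'n::finite) weight set" where
  "odd_roots = odd_pos_roots \<union> uminus ` odd_pos_roots"

definition rho :: "('m::{finite,linorder}, 'n::{finite,linorder}) weight" where
  "rho = (1/2) *s (\<Sum>\<alpha>\<in>even_pos_roots. \<alpha>) - (1/2) *s (\<Sum>\<alpha>\<in>odd_pos_roots. \<alpha>)"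

definition atypical :: "('m::{finite,linorder}, 'n::{finite,linorder}) weight \<Rightarrow> bool" where
  "atypical lam \<longleftrightarrow> (\<exists>\<gamma>\<in>odd_roots. weight_form (lam + rho) \<gamma> = 0)"

definition root_space :: "('m::finite, 'n::finite) weight \<Rightarrow> ('m, 'n) gl set" where
  "root_space \<alpha> = {x. \<forall>h\<in>cartan. sbracket h x = scale_mat (weight_at \<alpha> h) x}"

definition borel_sub :: "('m::{finite,linorder}, 'n::{finite,linorder}) gl set" where
  "borel_sub =
     {h + (\<Sum>\<alpha>\<in>even_pos_roots \<union> odd_pos_roots. x \<alpha>) | h x.
        h \<in> cartan \<and> (\<forall>\<alpha>\<in>even_pos_roots \<union> odd_pos_roots. x \<alpha> \<in> root_space \<alpha>)}"


section \<open>Enveloping algebras\<close>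

text \<open>
  Words form a monoid under concatenation; the finitely supported functions on words with the
  convolution product of \<open>Poly_Mapping\<close> are then the free associative algebra.
\<close>

instantiation list :: (type) monoid_add
begin

definition zero_list :: "'a list" where "zero_list = []"

definition plus_list :: "'a list \<Rightarrow> 'a list \<Rightarrow> 'a list" where "plus_list = (@)"

instance
  by standard (simp_all add: zero_list_def plus_list_def)

end

definition gen :: "'a \<Rightarrow> 'a list \<Rightarrow>\<^sub>0 complex" where
  "gen x = Poly_Mapping.single [x] 1"

definition free_scalar :: "complex \<Rightarrow> 'a list \<Rightarrow>\<^sub>0 complex" where
  "free_scalar c = Poly_Mapping.single [] c"

definition free_algebra :: "'a set \<Rightarrow> ('a list \<Rightarrow>\<^sub>0 complex) ring" where
  "free_algebra L =
     \<lparr>carrier = {f. \<forall>w\<in>Poly_Mapping.keys f. set w \<subseteq> L}, monoid.mult = (*), one = 1,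
      ring.zero = 0, ring.add = (+)\<rparr>"

text \<open>
  For a subsuperalgebra \<open>L\<close>, the quotient of the free algebra on the set \<open>L\<close> by the first two families
  of relations is the tensor algebra of \<open>L\<close>; the third family then yields the enveloping algebra.
\<close>

definition env_rels :: "('m::finite, 'n::finite) gl set \<Rightarrow> (('m, 'n) gl list \<Rightarrow>\<^sub>0 complex) set" where
  "env_rels L =
     {gen (x + y) - gen x - gen y | x y. x \<in> L \<and> y \<in> L}
   \<union> {gen (scale_mat c x) - free_scalar c * gen x | c x. x \<in> L}
   \<union> {gen x * gen y - (if a \<and> b then - 1 else 1) * (gen y * gen x) - gen (sbracket x y) | a b x y.
        x \<in> L \<inter> gl_part a \<and> y \<in> L \<inter> gl_part b}"

definition env_ideal :: "('m::finite, 'n::finite) gl set \<Rightarrow> (('m, 'n) gl list \<Rightarrow>\<^sub>0 complex) set" where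
  "env_ideal L = Idl\<^bsub>free_algebra L\<^esub> (env_rels L)"

definition env_alg :: "('m::finite, 'n::finite) gl set \<Rightarrow> (('m, 'n) gl list \<Rightarrow>\<^sub>0 complex) set ring" where
  "env_alg L = free_algebra L Quot env_ideal L"

abbreviation Ug :: "(('m::finite, 'n::finite) gl list \<Rightarrow>\<^sub>0 complex) set ring" where
  "Ug \<equiv> env_alg UNIV"

abbreviation Ub ::
  "(('m::{finite,linorder}, 'n::{finite,linorder}) gl list \<Rightarrow>\<^sub>0 complex) set ring" where
  "Ub \<equiv> env_alg borel_sub"

definition env_gen :: "('m::finite, 'n::finite) gl \<Rightarrow> (('m, 'n) gl list \<Rightarrow>\<^sub>0 complex) set" where
  "env_gen x = env_ideal UNIV +>\<^bsub>free_algebra UNIV\<^esub> gen x"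

text \<open>
  Maps on a quotient are given on a coset \<open>C\<close> as \<open>the_elem (h ` C)\<close>, where \<open>h\<close> is the map on
  representatives, as in the homomorphism theorems of the library.
\<close>

definition env_incl ::
  "(('m::{finite,linorder}, 'n::{finite,linorder}) gl list \<Rightarrow>\<^sub>0 complex) set
    \<Rightarrow> (('m, 'n) gl list \<Rightarrow>\<^sub>0 complex) set" where
  "env_incl C = the_elem ((\<lambda>f. env_ideal UNIV +>\<^bsub>free_algebra UNIV\<^esub> f) ` C)"

text \<open>
  The action of \<open>U(\<bb>)\<close> on the one-dimensional module of weight \<open>lam\<close>, that is \<open>lam\<close> on the
  Cartan algebra and zero on positive root vectors (their diagonal vanishes).
\<close>

definition borel_char ::
  "('m::{finite,linorder}, 'n::{finite,linorder}) weight
    \<Rightarrow> (('m, 'n) gl list \<Rightarrow>\<^sub>0 complex) set \<Rightarrow> complex" where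
  "borel_char lam C =
     the_elem ((\<lambda>f. \<Sum>w\<in>Poly_Mapping.keys f.
                   Poly_Mapping.lookup f w * prod_list (map (weight_at lam) w)) ` C)"


section \<open>Verma modules\<close>

text \<open>
  The tensor product of the right \<open>U(\<bb>)\<close>-module \<open>U(\<gg>)\<close> with the left \<open>U(\<bb>)\<close>-module of weight \<open>lam\<close>,
  as a quotient of the free abelian group on pairs.  Groups are written multiplicatively, so
  \<open>\<one>\<^bsub>verma lam\<^esub>\<close> is the zero vector.
\<close>

definition verma_free ::
  "(((('m::finite, 'n::finite) gl list \<Rightarrow>\<^sub>0 complex) set \<times> complex) \<Rightarrow>\<^sub>0 int) monoid" where
  "verma_free = free_Abelian_group (carrier Ug \<times> UNIV)"

definition verma_rels ::
  "('m::{finite,linorder}, 'n::{finite,linorder}) weight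
    \<Rightarrow> (((('m, 'n) gl list \<Rightarrow>\<^sub>0 complex) set \<times> complex) \<Rightarrow>\<^sub>0 int) set" where
  "verma_rels lam =
     {frag_of (u \<oplus>\<^bsub>Ug\<^esub> v, z) - frag_of (u, z) - frag_of (v, z) | u v z.
        u \<in> carrier Ug \<and> v \<in> carrier Ug}
   \<union> {frag_of (u, z + z') - frag_of (u, z) - frag_of (u, z') | u z z'. u \<in> carrier Ug}
   \<union> {frag_of (u \<otimes>\<^bsub>Ug\<^esub> env_incl r, z) - frag_of (u, borel_char lam r * z) | u r z.
        u \<in> carrier Ug \<and> r \<in> carrier Ub}"

definition verma_sub ::
  "('m::{finite,linorder}, 'n::{finite,linorder}) weight
    \<Rightarrow> (((('m, 'n) gl list \<Rightarrow>\<^sub>0 complex) set \<times> complex) \<Rightarrow>\<^sub>0 int) set" where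
  "verma_sub lam = generate verma_free (verma_rels lam)"

definition verma ::
  "('m::{finite,linorder}, 'n::{finite,linorder}) weight
    \<Rightarrow> (((('m, 'n) gl list \<Rightarrow>\<^sub>0 complex) set \<times> complex) \<Rightarrow>\<^sub>0 int) set monoid" where
  "verma lam = verma_free Mod verma_sub lam"

text \<open>The action \<open>u (v \<otimes> z) = (u v) \<otimes> z\<close> of \<open>U(\<gg>)\<close>, and its restriction to the Lie superalgebra.\<close>

definition verma_Ug_act ::
  "('m::{finite,linorder}, 'n::{finite,linorder}) weight
    \<Rightarrow> (('m, 'n) gl list \<Rightarrow>\<^sub>0 complex) set
    \<Rightarrow> (((('m, 'n) gl list \<Rightarrow>\<^sub>0 complex) set \<times> complex) \<Rightarrow>\<^sub>0 int) set
    \<Rightarrow> (((('m, 'n) gl list \<Rightarrow>\<^sub>0 complex) set \<times> complex) \<Rightarrow>\<^sub>0 int) set" where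
  "verma_Ug_act lam u C =
     the_elem ((\<lambda>f. verma_sub lam #>\<^bsub>verma_free\<^esub>
                      frag_extend (\<lambda>(v, z). frag_of (u \<otimes>\<^bsub>Ug\<^esub> v, z)) f) ` C)"

definition verma_act ::
  "('m::{finite,linorder}, 'n::{finite,linorder}) weight \<Rightarrow> ('m, 'n) gl
    \<Rightarrow> (((('m, 'n) gl list \<Rightarrow>\<^sub>0 complex) set \<times> complex) \<Rightarrow>\<^sub>0 int) set
    \<Rightarrow> (((('m, 'n) gl list \<Rightarrow>\<^sub>0 complex) set \<times> complex) \<Rightarrow>\<^sub>0 int) set" where
  "verma_act lam x = verma_Ug_act lam (env_gen x)"


section \<open>Associated varieties\<close>

definition self_commuting :: "('m::finite, 'n::finite) gl set" where
  "self_commuting = {x \<in> gl_part True. sbracket x x = 0}"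

text \<open>\<open>M\<close> is the underlying abelian group of a module, on which \<open>x\<close> acts by \<open>act x\<close>.\<close>

definition assoc_variety ::
  "('v, 'z) monoid_scheme \<Rightarrow> (('m::finite, 'n::finite) gl \<Rightarrow> 'v \<Rightarrow> 'v) \<Rightarrow> ('m, 'n) gl set" where
  "assoc_variety M act =
     {x \<in> self_commuting. act x ` carrier M \<noteq> {v \<in> carrier M. act x v = \<one>\<^bsub>M\<^esub>}}"

definition iso_sets :: "('m::finite, 'n::finite) weight set set" where
  "iso_sets =
     {S. S \<subseteq> {\<alpha> \<in> odd_roots. weight_form \<alpha> \<alpha> = 0}
         \<and> pairwise (\<lambda>\<alpha> \<beta>. weight_form \<alpha> \<beta> = 0) S \<and> vec.independent S}"

text \<open>A choice of nonzero root vectors; the orbits below do not depend on it.\<close>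

definition root_vector :: "('m::finite, 'n::finite) weight \<Rightarrow> ('m, 'n) gl" where
  "root_vector \<alpha> = (SOME x. x \<in> root_space \<alpha> \<and> x \<noteq> 0)"

text \<open>
  The Borel subgroup of \<open>GL(m) \<times> GL(n)\<close> (block diagonal invertible matrices) with Lie algebra
  \<open>\<bb>\<^sub>0\<close> consists of the invertible elements of \<open>\<bb>\<^sub>0\<close>, i.e. of pairs of invertible upper triangular
  matrices.  It acts by conjugation.
\<close>

definition borel_group :: "('m::{finite,linorder}, 'n::{finite,linorder}) gl set" where
  "borel_group = {g \<in> borel_sub \<inter> gl_part False. invertible g}"

definition adj_orbit :: "('m::{finite,linorder}, 'n::{finite,linorder}) weight set \<Rightarrow> ('m, 'n) gl set" where
  "adj_orbit S = {g ** (\<Sum>\<alpha>\<in>S. root_vector \<alpha>) ** matrix_inv g | g. g \<in> borel_group}"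

definition verma_iso_sets ::
  "('m::{finite,linorder}, 'n::{finite,linorder}) weight \<Rightarrow> ('m, 'n) weight set set" where
  "verma_iso_sets lam = {S \<in> iso_sets. adj_orbit S \<subseteq> assoc_variety (verma lam) (verma_act lam)}"

end

theory Submission
  imports Defs "HOL-Library.Function_Algebras"
begin

text \<open>
  Put \<open>x_i = E_(i, \<delta>)\<close> and \<open>a_i = (\<lambda> + \<rho>, \<epsilon>_i - \<delta>)\<close>.  The Verma module is realised on a Fock space with
  a bosonic mode for every \<open>E_(c, a)\<close>, \<open>a < c\<close>, and a fermionic mode for every \<open>E_(\<delta>, a)\<close>.  Adjoining the
  indices from the largest to the smallest gives explicit formulas; when \<open>a\<close> is adjoined to \<open>S\<close>,
  \<open>x_a = (\<lambda>_a - \<Sum>\<^bsub>c\<^esub> z_c \<partial>_c + h) w - \<Sum>\<^bsub>c\<^esub> \<partial>_c x_c\<close>, and \<open>x_c\<close> becomes \<open>x_c + z_c w\<close> for \<open>c \<in> S\<close>.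

  If \<open>a_i\<close> is not a natural number, the diagonal operator multiplying \<open>w\<close> in \<open>x_i\<close> is invertible; if
  \<open>a_p \<noteq> 0\<close> for all \<open>p \<ge> i\<close>, an operator \<open>g_i\<close> with \<open>x_i g_i + g_i x_i = 1\<close> is constructed along the same
  recursion.  Either way the kernel of \<open>x_i\<close> is its image.  If \<open>a_i = n\<close> is a natural number and \<open>a_p = 0\<close> for
  some \<open>p \<ge> i\<close>, there is an explicit vector of degree \<open>n\<close> in the modes of \<open>i\<close> that \<open>x_i\<close> kills and on whose
  configurations every element of the image of \<open>x_i\<close> vanishes.  Conjugation by the even Borel group preserves
  the annihilator of the highest weight vector, so the whole orbit of the root vector behaves like \<open>x_i\<close>.
\<close>

section \<open>Adjoining an index\<close>

text \<open>The formulas are those of parabolic induction. For \<open>S\<close> above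
  \<open>a\<close>, the units E_(c,a) with c in \<open>S\<close> and E_(\<delta>,a) supercommute and
  are normalised by gl(S|1), so the Verma module for \<open>a\<close> and \<open>S\<close> together
  consists of polynomials in these modes over the Verma module for \<open>S\<close>. There
  E_(j,\<delta>) acts on the modes by the adjoint action, and E_(a,\<delta>) removes one mode. The
  even units get no formulas of their own, since brackets of odd units produce them. Exactness at
  x_i fails only when two things meet. A vector of degree a_i makes the diagonal coefficient vanish,
  so a_i has to be a natural number; and some p \<ge> i has a_p = 0, the number by which the
  recursion for the contraction would have to divide. The comparison with the Verma module has two
  halves: commuting letters shows that ordered monomials span modulo the annihilator of the highest
  weight vector, and the Fock representation sends them to nonzero multiples of distinct basis
  vectors.\<close>

text \<open>
  The relations of \<open>x j = E_(j, \<delta>)\<close>, \<open>y j = E_(\<delta>, j)\<close> and \<open>h = E_(\<delta>, \<delta>)\<close>, where the even units have been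
  eliminated through \<open>E_(j, k) = x j * y k + y k * x j - (if j = k then h else 0)\<close>.
\<close>

definition triple_rels :: "'i set \<Rightarrow> ('i \<Rightarrow> 'r::ring_1) \<Rightarrow> ('i \<Rightarrow> 'r) \<Rightarrow> 'r \<Rightarrow> bool" where
  "triple_rels S x y h \<longleftrightarrow>
     (\<forall>j\<in>S. \<forall>k\<in>S. x j * x k = - (x k * x j)) \<and>
     (\<forall>j\<in>S. \<forall>k\<in>S. y j * y k = - (y k * y j)) \<and>
     (\<forall>j\<in>S. h * x j = x j * h - x j) \<and>
     (\<forall>j\<in>S. h * y j = y j * h + y j) \<and>
     (\<forall>j\<in>S. \<forall>k\<in>S. \<forall>l\<in>S. (x j * y k + y k * x j) * x l =
        x l * (x j * y k + y k * x j) + (if k = l then x j else 0) - (if j = k then x l else 0)) \<and>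
     (\<forall>j\<in>S. \<forall>k\<in>S. \<forall>l\<in>S. (x j * y k + y k * x j) * y l =
        y l * (x j * y k + y k * x j) - (if j = l then y k else 0) + (if j = k then y l else 0))"

lemma mult_eq_left: "p * q = r \<Longrightarrow> p * (q * t) = r * (t::'r::semigroup_mult)"
  by (metis mult.assoc)

lemma mult_if: "(a::'r::mult_zero) * (if P then b else 0) = (if P then a * b else 0)"
  and if_mult: "(if P then b else 0) * a = (if P then b * a else 0)"
  by auto

lemma comm_left: "p * q = q * p \<Longrightarrow> p * (q * t) = q * (p * (t::'r::semigroup_mult))"
  by (metis mult.assoc)

text \<open>\<open>z\<close>, \<open>d\<close> are bosonic and \<open>u\<close>, \<open>w\<close>
  fermionic creators and annihilators. \<open>two\<close> excludes 2-torsion: the square of an odd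
  operator is first found to be its own negative.\<close>

locale extension_modes =
  fixes S :: "'i set" and z d :: "'i \<Rightarrow> 'r::ring_1" and u w :: 'r
  assumes two: "p = - p \<Longrightarrow> p = (0::'r)" and fin: "finite S"
    and zz: "z j * z k = z k * z j"
    and dd: "d j * d k = d k * d j"
    and dz: "d j * z k = z k * d j + (if j = k then 1 else 0)"
    and uu: "u * u = 0" and ww: "w * w = 0" and wu: "w * u = 1 - u * w"
    and uz: "u * z j = z j * u" and ud: "u * d j = d j * u"
    and wz: "w * z j = z j * w" and wd: "w * d j = d j * w"

locale extension_step = extension_modes S z d u w
  for S :: "'i set" and z d :: "'i \<Rightarrow> 'r::ring_1" and u w :: 'r +
  fixes x y :: "'i \<Rightarrow> 'r" and h c :: 'r
  assumes rels: "triple_rels S x y h"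
    and xz: "j \<in> S \<Longrightarrow> x j * z k = z k * x j" and xd: "j \<in> S \<Longrightarrow> x j * d k = d k * x j"
    and xu: "j \<in> S \<Longrightarrow> x j * u = - (u * x j)" and xw: "j \<in> S \<Longrightarrow> x j * w = - (w * x j)"
    and yz: "j \<in> S \<Longrightarrow> y j * z k = z k * y j" and yd: "j \<in> S \<Longrightarrow> y j * d k = d k * y j"
    and yu: "j \<in> S \<Longrightarrow> y j * u = - (u * y j)" and yw: "j \<in> S \<Longrightarrow> y j * w = - (w * y j)"
    and hz: "h * z k = z k * h" and hd: "h * d k = d k * h" and hu: "h * u = u * h" and hw: "h * w = w * h"
    and c_central: "c * t = t * c"
begin

lemma cx: "c * x j = x j * c" and cy: "c * y j = y j * c" and ch: "c * h = h * c"
  and cz: "c * z k = z k * c" and cd: "c * d k = d k * c" and cu: "c * u = u * c" and cw: "c * w = w * c"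
  by (rule c_central)+

text \<open>\<open>A\<close> is going to be the operator of E_(a,a) + E_(\<delta>,\<delta>), the
  bracket of E_(a,\<delta>) and E_(\<delta>,a). \<open>D\<close> collects what arises when
  E_(a,\<delta>) passes the modes E_(j,a). \<open>F k\<close> is the anticommutator of
  \<open>D\<close> and \<open>y k\<close>, and \<open>- F k\<close> is the part of E_(a,k) in which
  a unit of \<open>S\<close> acts.\<close>

definition eu where "eu = (\<Sum>j\<in>S. z j * d j)"
definition A where "A = c - eu + h"
definition D where "D = (\<Sum>j\<in>S. d j * x j)"
definition e where "e j k = x j * y k + y k * x j"
definition F where "F k = (\<Sum>j\<in>S. d j * e j k)"

lemma
  assumes "j \<in> S"
  shows xx: "k \<in> S \<Longrightarrow> x j * x k = - (x k * x j)"
    and yy: "k \<in> S \<Longrightarrow> y j * y k = - (y k * y j)"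
    and hx: "h * x j = x j * h - x j" and hy: "h * y j = y j * h + y j"
    and ex: "k \<in> S \<Longrightarrow> l \<in> S \<Longrightarrow> e j k * x l = x l * e j k + (if k = l then x j else 0) - (if j = k then x l else 0)"
    and ey: "k \<in> S \<Longrightarrow> l \<in> S \<Longrightarrow> e j k * y l = y l * e j k - (if j = l then y k else 0) + (if j = k then y l else 0)"
    and xy: "x j * y k = e j k - y k * x j"
  using rels assms unfolding triple_rels_def e_def by (blast, blast, blast, blast, blast, blast, simp)

lemma
  assumes "j \<in> S" "k \<in> S"
  shows ez: "e j k * z l = z l * e j k" and ed: "e j k * d l = d l * e j k"
    and eu': "e j k * u = u * e j k" and ew: "e j k * w = w * e j k"
    and eh: "h * e j k = e j k * h" and ec: "c * e j k = e j k * c"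
  unfolding e_def
  using assms by (simp_all add: algebra_simps xz yz xd yd xu yu xw yw hx hy cx cy
     mult_eq_left[OF xz] mult_eq_left[OF yz] mult_eq_left[OF xd] mult_eq_left[OF yd]
     mult_eq_left[OF xu] mult_eq_left[OF yu] mult_eq_left[OF xw] mult_eq_left[OF yw]
     mult_eq_left[OF hx] mult_eq_left[OF hy] mult_eq_left[OF cx] mult_eq_left[OF cy])

lemma eu_z: "k \<in> S \<Longrightarrow> eu * z k = z k * eu + z k"
  unfolding eu_def sum_distrib_right sum_distrib_left
  by (simp add: mult.assoc dz distrib_left mult_if sum.distrib fin zz comm_left[OF zz])

lemma eu_d: "k \<in> S \<Longrightarrow> eu * d k = d k * eu - d k"
  unfolding eu_def sum_distrib_right sum_distrib_left
  by (simp add: mult_eq_left[OF dz] distrib_right if_mult sum.distrib fin dd mult.assoc comm_left[OF dd])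

lemma eu_u: "eu * u = u * eu" and eu_w: "eu * w = w * eu" and eu_h: "eu * h = h * eu" and eu_c: "c * eu = eu * c"
  unfolding eu_def sum_distrib_right sum_distrib_left
  by (rule sum.cong, rule refl, simp add: mult.assoc uz ud wz wd hz hd cz cd mult_eq_left[OF uz] mult_eq_left[OF wz]
    mult_eq_left[OF hz] mult_eq_left[OF cz])+

lemma eu_x: "j \<in> S \<Longrightarrow> eu * x j = x j * eu" and eu_y: "j \<in> S \<Longrightarrow> eu * y j = y j * eu"
  unfolding eu_def sum_distrib_right sum_distrib_left
  by (rule sum.cong, rule refl, simp add: mult.assoc xz xd yz yd mult_eq_left[OF xz] mult_eq_left[OF yz])+

lemma A_z: "k \<in> S \<Longrightarrow> A * z k = z k * A - z k" and A_d: "k \<in> S \<Longrightarrow> A * d k = d k * A + d k"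
  and A_u: "A * u = u * A" and A_w: "A * w = w * A"
  and A_x: "k \<in> S \<Longrightarrow> A * x k = x k * A - x k" and A_y: "k \<in> S \<Longrightarrow> A * y k = y k * A + y k"
  unfolding A_def
  by (simp_all add: algebra_simps eu_z eu_d eu_u eu_w eu_x eu_y hz hd hu hw hx hy cz cd cu cw cx cy)

lemma A_e: "j \<in> S \<Longrightarrow> k \<in> S \<Longrightarrow> A * e j k = e j k * A"
  unfolding e_def by (simp add: algebra_simps A_x A_y mult_eq_left[OF A_x] mult_eq_left[OF A_y])

lemma D_z: "k \<in> S \<Longrightarrow> D * z k = z k * D + x k"
  unfolding D_def sum_distrib_right sum_distrib_left
  by (simp add: mult.assoc dz xz mult_eq_left[OF dz] distrib_right if_mult sum.distrib fin)

lemma D_d: "k \<in> S \<Longrightarrow> D * d k = d k * D" and D_u: "D * u = - (u * D)" and D_w: "D * w = - (w * D)"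
  and A_D: "A * D = D * A"
  unfolding D_def sum_distrib_right sum_distrib_left sum_negf[symmetric]
  by (rule sum.cong, rule refl, simp add: algebra_simps xd xu xw mult_eq_left[OF xd] mult_eq_left[OF ud] mult_eq_left[OF wd] comm_left[OF dd] 
    mult_eq_left[OF A_d] A_x mult_eq_left[OF A_x] dd)+

lemma D_x: "k \<in> S \<Longrightarrow> D * x k = - (x k * D)"
  unfolding D_def sum_distrib_right sum_distrib_left sum_negf[symmetric]
  by (rule sum.cong, rule refl, simp add: mult.assoc xx[of _ k] mult_eq_left[OF xd])

lemma D_y: "k \<in> S \<Longrightarrow> D * y k = F k - y k * D"
  unfolding D_def F_def sum_distrib_right sum_distrib_left sum_subtractf[symmetric]
  by (rule sum.cong) (auto simp add: algebra_simps xy yd mult_eq_left[OF yd])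

text \<open>Passing \<open>D\<close> through a summand \<open>d j * x j\<close> costs exactly one
  sign, from the odd factor.\<close>

lemma D_D: "D * D = 0"
proof -
  have "D * D = (\<Sum>j\<in>S. d j * (x j * D))" by (subst (1) D_def) (simp add: sum_distrib_right mult.assoc)
  also have "\<dots> = (\<Sum>j\<in>S. - (D * (d j * x j)))"
    by (rule sum.cong) (auto simp: D_x mult_eq_left[OF D_d] mult.assoc)
  also have "\<dots> = - (D * D)" by (simp add: sum_negf sum_distrib_left[symmetric]) (simp add: D_def)
  finally show ?thesis by (rule two)
qed

lemma e_D: "j \<in> S \<Longrightarrow> k \<in> S \<Longrightarrow> e j k * D = D * e j k + d k * x j - (if j = k then D else 0)"
  unfolding D_def sum_distrib_right sum_distrib_left
  by (simp add: mult_eq_left[OF ed] ex mult.assoc distrib_left right_diff_distrib mult_if sum.distrib sum_subtractf fin)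

lemma F_z: "j \<in> S \<Longrightarrow> k \<in> S \<Longrightarrow> F k * z j = z j * F k + e j k"
  unfolding F_def sum_distrib_right sum_distrib_left
  by (simp add: mult_eq_left[OF dz] dz ez mult.assoc distrib_right if_mult sum.distrib fin)

lemma F_d: "j \<in> S \<Longrightarrow> k \<in> S \<Longrightarrow> F k * d j = d j * F k"
  and F_u: "k \<in> S \<Longrightarrow> F k * u = u * F k" and F_w: "k \<in> S \<Longrightarrow> F k * w = w * F k"
  and A_F: "k \<in> S \<Longrightarrow> A * F k = F k * A + F k"
  unfolding F_def sum_distrib_right sum_distrib_left sum.distrib[symmetric]
  by (rule sum.cong, rule refl, simp add: algebra_simps ed eu' ew dd comm_left[OF dd] mult_eq_left[OF ud] mult_eq_left[OF wd] mult_eq_left[OF A_d] A_e)+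

lemma F_x: "j \<in> S \<Longrightarrow> k \<in> S \<Longrightarrow> F k * x j = x j * F k + (if k = j then D else 0) - d k * x j"
  unfolding F_def D_def sum_distrib_right sum_distrib_left
  by (simp add: mult.assoc ex distrib_left right_diff_distrib mult_if sum.distrib sum_subtractf fin mult_eq_left[OF xd])

lemma F_y: "j \<in> S \<Longrightarrow> k \<in> S \<Longrightarrow> F k * y j = y j * F k - d j * y k + d k * y j"
  unfolding F_def sum_distrib_right sum_distrib_left
  by (simp add: mult.assoc ey distrib_left right_diff_distrib mult_if sum.distrib sum_subtractf fin mult_eq_left[OF yd])

lemma F_D: "k \<in> S \<Longrightarrow> F k * D = D * F k"
proof -
  assume k: "k \<in> S"
  have "F k * D = (\<Sum>j\<in>S. F k * (d j * x j))" by (subst D_def) (simp add: sum_distrib_left)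
  also have "\<dots> = (\<Sum>j\<in>S. d j * x j * F k + d j * (if k = j then D else 0) - d j * (d k * x j))"
    by (rule sum.cong) (auto simp: k mult_eq_left[OF F_d] F_x algebra_simps)
  also have "\<dots> = D * F k + d k * D - (\<Sum>j\<in>S. d k * (d j * x j))"
    by (simp add: sum_subtractf sum.distrib mult_if fin k D_def[symmetric] sum_distrib_right[symmetric] comm_left[OF dd])
  also have "\<dots> = D * F k"
    by (simp add: sum_distrib_left[symmetric] D_def[symmetric])
  finally show ?thesis .
qed

lemma D_h: "h * D = D * h - D"
  unfolding D_def sum_distrib_right sum_distrib_left sum_subtractf[symmetric]
  by (rule sum.cong) (auto simp: mult_eq_left[OF hd] hx algebra_simps)

lemma h_A: "h * A = A * h"
  by (simp add: A_def algebra_simps eu_h ch)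

text \<open>
  The operators for \<open>insert a S\<close>, where \<open>a\<close> precedes \<open>S\<close> and has weight \<open>c\<close>: \<open>z j\<close> creates \<open>E_(j, a)\<close>, \<open>u\<close> creates
  \<open>E_(\<delta>, a)\<close>, and \<open>d\<close>, \<open>w\<close> are the corresponding annihilators.
\<close>

definition x' where "x' a j = (if j = a then A * w - D else x j + z j * w)"
definition y' where "y' a j = (if j = a then u else y j + u * d j)"
definition h' where "h' = h + u * w"

text \<open>All rules are oriented towards the normal order z, d, u, w, y, x, D, then e and F, then
  A, h. The second list repeats them with a further factor on the right, so that right-associated
  products are normalised as well.\<close>

lemmas order_rules = dz uu ww wu uz ud wz wd xz xd xu xw yz yd yu yw hz hd hu hw hx hy ex ey xy
  ez ed eu' ew A_z A_d A_u A_w A_x A_y A_e D_z D_d D_u D_w D_x A_D D_y D_D e_D F_z F_d F_u F_w A_F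
  F_x F_y F_D D_h h_A eh
lemmas order_rules2 = order_rules[THEN mult_eq_left] zz dd comm_left[OF zz] comm_left[OF dd]

lemma triple_rels_extend:
  assumes a: "a \<notin> S"
  shows "triple_rels (insert a S) (x' a) (y' a) h'"
proof -
  have na: "j \<in> S \<Longrightarrow> j \<noteq> a" "j \<in> S \<Longrightarrow> a \<noteq> j" for j using a by auto
  note R = order_rules order_rules2 x'_def y'_def h'_def algebra_simps na
  let ?S = "insert a S"
  \<comment> \<open>Anticommutation of the \<open>x\<close> with one another has no preferred
    direction and would loop, so only the single instance at hand is supplied; the same holds for
    the \<open>y\<close>.\<close>
  have f1: "x' a j * x' a k = - (x' a k * x' a j)" if "j \<in> ?S" "k \<in> ?S" for j k
    using that by (elim insertE; simp add: R xx[of j k])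
  have f2: "y' a j * y' a k = - (y' a k * y' a j)" if "j \<in> ?S" "k \<in> ?S" for j k
    using that by (elim insertE; simp add: R yy[of j k])
  have f3: "h' * x' a j = x' a j * h' - x' a j" "h' * y' a j = y' a j * h' + y' a j" if "j \<in> ?S" for j
    using that by (elim insertE; simp add: R)+
  have f4: "(x' a j * y' a k + y' a k * x' a j) * x' a l = x' a l * (x' a j * y' a k + y' a k * x' a j)
      + (if k = l then x' a j else 0) - (if j = k then x' a l else 0)"
    if "j \<in> ?S" "k \<in> ?S" "l \<in> ?S" for j k l
    using that by (elim insertE; simp add: R xx[of l j])
  have f5: "(x' a j * y' a k + y' a k * x' a j) * y' a l = y' a l * (x' a j * y' a k + y' a k * x' a j)
      - (if j = l then y' a k else 0) + (if j = k then y' a l else 0)"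
    if "j \<in> ?S" "k \<in> ?S" "l \<in> ?S" for j k l
    using that by (elim insertE; simp add: R yy[of l k])
  show ?thesis unfolding triple_rels_def by (intro conjI ballI; rule f1 f2 f3 f4 f5; assumption)
qed

end

section \<open>Contracting homotopies\<close>

text \<open>
  Because of the last relation, \<open>c + n\<close> is the constant by which one has to divide when the next index, of
  weight \<open>c\<close>, is adjoined.
\<close>

definition contraction_rels :: "'i set \<Rightarrow> ('i \<Rightarrow> 'r::ring_1) \<Rightarrow> 'r \<Rightarrow> 'r \<Rightarrow> ('i \<Rightarrow> 'r) \<Rightarrow> bool" where
  "contraction_rels S x h n g \<longleftrightarrow>
     (\<forall>j\<in>S. \<forall>k\<in>S. x j * g k = (if j = k then 1 else 0) - g k * x j) \<and>
     (\<forall>k\<in>S. h * g k = g k * h + g k) \<and>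
     (\<Sum>j\<in>S. x j * g j) = n - h"

locale contraction_step = extension_step S z d u w x y h c
  for S :: "'i set" and z d :: "'i \<Rightarrow> 'r::ring_1" and u w :: 'r and x y :: "'i \<Rightarrow> 'r" and h c :: 'r +
  fixes g :: "'i \<Rightarrow> 'r" and n b :: 'r
  assumes grels: "contraction_rels S x h n g"
    and gz: "j \<in> S \<Longrightarrow> g j * z k = z k * g j" and gd: "j \<in> S \<Longrightarrow> g j * d k = d k * g j"
    and gu: "j \<in> S \<Longrightarrow> g j * u = - (u * g j)" and gw: "j \<in> S \<Longrightarrow> g j * w = - (w * g j)"
    and n_central: "n * t = t * n" and b_central: "b * t = t * b"
    and bn: "(c + n) * b = 1"
begin

definition m where "m = c + n"

lemma cg: "c * g j = g j * c" by (rule c_central)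

lemma xg: "j \<in> S \<Longrightarrow> k \<in> S \<Longrightarrow> x j * g k = (if j = k then 1 else 0) - g k * x j"
  and hg: "k \<in> S \<Longrightarrow> h * g k = g k * h + g k"
  and sum_xg: "(\<Sum>j\<in>S. x j * g j) = n - h"
  using grels unfolding contraction_rels_def by blast+

definition s where "s = (\<Sum>j\<in>S. z j * g j)"

lemma eu_g: "j \<in> S \<Longrightarrow> eu * g j = g j * eu"
  unfolding eu_def sum_distrib_right sum_distrib_left
  by (rule sum.cong, rule refl, simp add: mult.assoc gz gd mult_eq_left[OF gz])

lemma A_g: "j \<in> S \<Longrightarrow> A * g j = g j * A + g j"
  unfolding A_def by (simp add: algebra_simps eu_g cg hg)

lemma s_z: "s * z k = z k * s" and s_u: "s * u = - (u * s)" and s_w: "s * w = - (w * s)"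
  and A_s: "A * s = s * A"
  unfolding s_def sum_distrib_right sum_distrib_left sum_negf[symmetric]
  by (rule sum.cong, rule refl, simp add: algebra_simps gz gu gw mult_eq_left[OF uz] mult_eq_left[OF wz] comm_left[OF zz]
      mult_eq_left[OF A_z] A_g mult_eq_left[OF A_g] zz)+

lemma s_d: "k \<in> S \<Longrightarrow> s * d k = d k * s - g k"
  unfolding s_def sum_distrib_right sum_distrib_left
  by (simp add: mult.assoc gd mult_eq_left[OF dz] distrib_right if_mult sum.distrib fin)

lemma x_s: "k \<in> S \<Longrightarrow> x k * s = z k - s * x k"
  unfolding s_def sum_distrib_right sum_distrib_left
  by (simp add: mult.assoc mult_eq_left[OF xz] xg right_diff_distrib mult_if sum_subtractf fin)

lemma D_g: "k \<in> S \<Longrightarrow> D * g k = d k - g k * D"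
  unfolding D_def sum_distrib_right sum_distrib_left
  by (simp add: mult.assoc mult_eq_left[OF gd] xg right_diff_distrib mult_if sum_subtractf fin)

text \<open>Here the third relation of \<open>contraction_rels\<close> does its work: it evaluates
  the sum of the \<open>x j * g j\<close>, and together with the Euler operator this gives exactly
  \<open>m - A\<close>.\<close>

lemma D_s: "D * s = m - A - s * D"
proof -
  have "D * s = (\<Sum>j\<in>S. (z j * D + x j) * g j)" unfolding s_def by (simp add: sum_distrib_left mult_eq_left[OF D_z] mult.assoc)
  also have "\<dots> = (\<Sum>j\<in>S. z j * d j) - (\<Sum>j\<in>S. z j * g j * D) + (\<Sum>j\<in>S. x j * g j)"
    by (simp add: distrib_right sum.distrib mult.assoc D_g right_diff_distrib sum_subtractf)
  also have "\<dots> = m - A - s * D"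
    by (simp add: sum_xg sum_distrib_right[symmetric] s_def[symmetric] eu_def[symmetric] A_def m_def)
  finally show ?thesis .
qed

text \<open>The anticommutator of \<open>x' a a\<close> with \<open>u - s\<close> is the central
  element \<open>m\<close>: \<open>u\<close> contributes \<open>A\<close> and \<open>- s\<close>
  contributes \<open>m - A\<close>. For k in \<open>S\<close>, \<open>x' a k\<close> anticommutes
  with \<open>u - s\<close>, because \<open>u\<close> and \<open>s\<close> both contribute
  \<open>z k\<close>. The remaining \<open>g' a j\<close> are \<open>g j\<close> minus
  \<open>g' a a\<close> times the anticommutator of \<open>x' a a\<close> and \<open>g j\<close>; as
  \<open>x' a a\<close> squares to zero, this correction makes them anticommute with it.\<close>

definition g' where "g' a j = (if j = a then b * (u - s) else g j + b * (u - s) * (g j * w + d j))"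

lemma h_s: "h * s = s * h + s"
  unfolding s_def sum_distrib_right sum_distrib_left sum.distrib[symmetric]
  by (rule sum.cong, rule refl, simp add: algebra_simps mult_eq_left[OF hz] hg)

lemma mb: "m * b = 1" by (simp add: m_def bn)

lemma m_central: "m * t = t * m"
  by (simp add: m_def algebra_simps c_central[of t] n_central[of t])

lemmas b_right = b_central[of "x j" for j] b_central[of "g j" for j] b_central[of "z j" for j] b_central[of "d j" for j]
  b_central[of u] b_central[of w] b_central[of s] b_central[of A] b_central[of D] b_central[of h]
lemmas m_right = m_central[of "x j" for j] m_central[of "g j" for j] m_central[of "z j" for j] m_central[of "d j" for j]
  m_central[of u] m_central[of w] m_central[of s] m_central[of A] m_central[of D] m_central[of h]
lemmas order_rules3 = order_rules xg hg gz gd gu gw A_g s_z s_u s_w A_s s_d x_s D_g D_s h_s b_right m_right mb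
lemmas order_rules4 = order_rules3[THEN mult_eq_left] zz dd comm_left[OF zz] comm_left[OF dd]

lemma contraction_rels_extend:
  assumes a: "a \<notin> S"
  shows "contraction_rels (insert a S) (x' a) h' (n + 1) (g' a)"
proof -
  have na: "j \<in> S \<Longrightarrow> j \<noteq> a" "j \<in> S \<Longrightarrow> a \<noteq> j" for j using a by auto
  note R = order_rules3 order_rules4 x'_def g'_def h'_def algebra_simps na
  have f1: "x' a a * g' a a = 1 - g' a a * x' a a"
    by (simp add: R)
  have f2: "x' a j * g' a a = - (g' a a * x' a j)" if "j \<in> S" for j
    using that by (simp add: R)
  have f3: "x' a a * g' a k = - (g' a k * x' a a)" if "k \<in> S" for k
    using that by (simp add: R)
  have f4: "x' a j * g' a k = (if j = k then 1 else 0) - g' a k * x' a j" if "j \<in> S" "k \<in> S" for j k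
    using that by (simp add: R)
  have f5: "h' * g' a k = g' a k * h' + g' a k" if "k \<in> S" for k
    using that by (simp add: R)
  have f6: "h' * g' a a = g' a a * h' + g' a a"
    by (simp add: R)
  have f7: "(\<Sum>j\<in>insert a S. x' a j * g' a j) = n + 1 - h'"
  proof -
    let ?G = "g' a a" and ?r = "\<lambda>j. g j * w + d j"
    have "x' a j * g' a j = x j * g j - z j * g j * w - ?G * (x j * g j * w + d j * x j + z j * d j * w)" if "j \<in> S" for j
    proof -
      have "x' a j * g' a j = x' a j * g j + x' a j * ?G * ?r j"
        using that na by (simp add: g'_def algebra_simps)
      also have "\<dots> = x' a j * g j - ?G * (x' a j * ?r j)"
        using f2[OF that] by (simp add: mult.assoc)
      also have "x' a j * g j = x j * g j - z j * g j * w"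
        using that by (simp add: R)
      also have "x' a j * ?r j = x j * g j * w + d j * x j + z j * d j * w"
        using that by (simp add: x'_def na algebra_simps gw mult_eq_left[OF gw] ww wd xd mult_eq_left[OF xd])
          (simp add: ww mult.assoc[symmetric])
      finally show ?thesis .
    qed
    then have "(\<Sum>j\<in>S. x' a j * g' a j) = (\<Sum>j\<in>S. x j * g j - z j * g j * w - ?G * (x j * g j * w + d j * x j + z j * d j * w))"
      by simp
    also have "\<dots> = n - h - s * w - ?G * ((n - h) * w + D + eu * w)"
      by (simp add: sum_subtractf sum.distrib sum_distrib_left[symmetric] sum_distrib_right[symmetric] sum_xg
          s_def[symmetric] eu_def[symmetric] D_def[symmetric])
    \<comment> \<open>Written through \<open>x' a a\<close>, so that together with the summand for
      \<open>a\<close> it completes the anticommutator of \<open>x' a a\<close> and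
      \<open>?G\<close>. This anticommutator is the \<open>1\<close> in
      \<open>n + 1\<close>.\<close>
    also have "(n - h) * w + D + eu * w = m * w - x' a a"
      by (simp add: m_def A_def x'_def algebra_simps)
    finally have "(\<Sum>j\<in>insert a S. x' a j * g' a j) = n - h - s * w - ?G * (m * w) + (?G * x' a a + x' a a * ?G)"
      using a fin by (simp add: algebra_simps)
    also have "?G * x' a a + x' a a * ?G = 1" using f1 by simp
    also have "?G * (m * w) = u * w - s * w"
      using mb by (simp add: R b_central[of m])
    finally show ?thesis by (simp add: h'_def)
  qed
  show ?thesis
    unfolding contraction_rels_def ball_simps(7)
    using f1 f2 f3 f4 f5 f6 f7 na by simp
qed

end

section \<open>Operators on Fock space\<close>

text \<open>Operators on all functions, without conditions on the support, form a type of class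
  \<open>ring_1\<close>, so the locales above apply to them directly. Finite support is imposed
  afterwards, by restricting to an invariant subspace.\<close>

typedef 'c op = "{T :: ('c \<Rightarrow> complex) \<Rightarrow> 'c \<Rightarrow> complex.
    (\<forall>f g. T (f + g) = T f + T g) \<and> (\<forall>c f. T (\<lambda>e. c * f e) = (\<lambda>e. c * T f e))}"
  morphisms ap Op
  by (rule exI[of _ "\<lambda>f. f"]) simp

setup_lifting type_definition_op

instantiation op :: (type) ring_1
begin

lift_definition zero_op :: "'a op" is "\<lambda>f. 0" by (simp add: fun_eq_iff)
lift_definition one_op :: "'a op" is "\<lambda>f. f" by simp
lift_definition plus_op :: "'a op \<Rightarrow> 'a op \<Rightarrow> 'a op" is "\<lambda>S T f. S f + T f"
  by (simp add: fun_eq_iff algebra_simps)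
lift_definition minus_op :: "'a op \<Rightarrow> 'a op \<Rightarrow> 'a op" is "\<lambda>S T f. S f - T f"
  by (simp add: fun_eq_iff algebra_simps)
lift_definition uminus_op :: "'a op \<Rightarrow> 'a op" is "\<lambda>S f. - S f"
  by (simp add: fun_eq_iff)
lift_definition times_op :: "'a op \<Rightarrow> 'a op \<Rightarrow> 'a op" is "\<lambda>S T f. S (T f)"
  by simp

instance
proof
  show "(0::'a op) \<noteq> 1"
  proof
    assume "(0::'a op) = 1"
    then have "ap 0 (\<lambda>_::'a. 1) = ap 1 (\<lambda>_. 1)" by simp
    then show False by (simp add: zero_op.rep_eq one_op.rep_eq fun_eq_iff)
  qed
qed (transfer; simp add: fun_eq_iff algebra_simps)+

end

lemma ap_add: "ap (S + T) f = ap S f + ap T f" and ap_diff: "ap (S - T) f = ap S f - ap T f"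
  and ap_mult: "ap (S * T) f = ap S (ap T f)" and ap_uminus: "ap (- S) f = - ap S f"
  and ap_0: "ap 0 f = 0" and ap_1: "ap 1 f = f"
  by (simp_all add: plus_op.rep_eq minus_op.rep_eq times_op.rep_eq uminus_op.rep_eq zero_op.rep_eq one_op.rep_eq)

lemmas ap_simps = ap_add ap_diff ap_mult ap_uminus ap_0 ap_1

lemma op_eqI: "(\<And>f. ap S f = ap T f) \<Longrightarrow> S = T"
  by (metis ap_inject ext)

lemma ap_plus: "ap T (f + g) = ap T f + ap T g" and ap_scale: "ap T (\<lambda>e. c * f e) = (\<lambda>e. c * ap T f e)"
  using ap[of T] by auto

lemma ap_zero: "ap T 0 = 0"
  using ap_scale[of T 0 0] by (simp add: zero_fun_def)

lemma ap_sum: "ap (sum S A) f = (\<Sum>a\<in>A. ap (S a) f)"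
  by (induction A rule: infinite_finite_induct) (simp_all add: ap_simps)

lemma ap_sum_right: "ap T (sum f A) = (\<Sum>a\<in>A. ap T (f a))"
  by (induction A rule: infinite_finite_induct) (simp_all only: sum.infinite sum.empty sum.insert ap_zero ap_plus not_False_eq_True)

lemma op_two: "p = - p \<Longrightarrow> p = (0::'c op)"
proof (rule op_eqI)
  fix f assume "p = - p"
  then have "ap p f = - ap p f" by (metis ap_uminus)
  then show "ap p f = ap 0 f" by (simp add: ap_0 fun_eq_iff)
qed

lift_definition dg :: "('c \<Rightarrow> complex) \<Rightarrow> 'c op" is "\<lambda>k f e. k e * f e"
  by (simp add: fun_eq_iff algebra_simps)

definition cst :: "complex \<Rightarrow> 'c op" where "cst c = dg (\<lambda>_. c)"

lemma ap_dg: "ap (dg k) f = (\<lambda>e. k e * f e)" by (simp add: dg.rep_eq)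
lemma ap_cst: "ap (cst c) f = (\<lambda>e. c * f e)" by (simp add: cst_def ap_dg)

lemma cst_central: "cst c * T = T * cst c"
  by (rule op_eqI) (simp add: ap_simps ap_cst ap_scale)

lemma cst_add: "cst (a + b) = cst a + cst b" and cst_mult: "cst (a * b) = cst a * cst b"
  and cst_diff: "cst (a - b) = cst a - cst b"
  and cst_0: "cst 0 = 0" and cst_1: "cst 1 = 1" and cst_minus: "cst (- a) = - cst a"
  by (rule op_eqI, simp add: ap_simps ap_cst fun_eq_iff algebra_simps)+

lemma dg_add: "dg (\<lambda>e. k e + l e) = dg k + dg l" and dg_diff: "dg (\<lambda>e. k e - l e) = dg k - dg l"
  and dg_mult: "dg k * dg l = dg (\<lambda>e. k e * l e)"
  by (rule op_eqI, simp add: ap_simps ap_dg fun_eq_iff algebra_simps)+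

lemma dg_1: "dg (\<lambda>_. 1) = 1"
  by (rule op_eqI) (simp add: ap_simps ap_dg)

section \<open>Bosonic and fermionic modes\<close>

type_synonym 'm conf = "('m \<times> 'm \<Rightarrow> nat) \<times> 'm set"

text \<open>The Jordan-Wigner sign, which makes the fermionic modes of different indices
  anticommute.\<close>

definition sg :: "'m::{finite,linorder} \<Rightarrow> 'm set \<Rightarrow> complex" where
  "sg a J = (- 1) ^ card {b\<in>J. b < a}"

lemma sg_sq: "sg a J * sg a J = 1" "sg a J * (sg a J * t) = t"
  by (simp_all add: sg_def power_mult_distrib[symmetric] mult.assoc[symmetric])

lemma sg_self: "sg a (insert a J) = sg a J" "sg a (J - {a}) = sg a J"
  unfolding sg_def by (rule arg_cong[of _ _ "\<lambda>t. (-1) ^ card t"], auto)+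

lemma sg_insert: "b \<notin> J \<Longrightarrow> sg a (insert b J) = (if b < a then - sg a J else sg a J)"
proof (cases "b < a")
  case True
  assume "b \<notin> J"
  moreover have "{c \<in> insert b J. c < a} = insert b {c\<in>J. c < a}" using True by auto
  ultimately show ?thesis using True by (simp add: sg_def)
next
  case False
  then have "{c \<in> insert b J. c < a} = {c\<in>J. c < a}" by auto
  then show ?thesis using False by (simp add: sg_def)
qed

lemma sg_remove: "b \<in> J \<Longrightarrow> sg a (J - {b}) = (if b < a then - sg a J else sg a J)"
  using sg_insert[of b "J - {b}" a] by (simp add: insert_absorb split: if_splits)

text \<open>
  A configuration \<open>(e, J)\<close> stands for the monomial with \<open>e (b, a)\<close> factors \<open>E_(b, a)\<close> and one factor
  \<open>E_(\<delta>, a)\<close> for each \<open>a \<in> J\<close>.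
\<close>

lift_definition zop :: "'m \<times> 'm \<Rightarrow> 'm conf op" is
  "\<lambda>p f (e, J). if e p = 0 then 0 else f (e(p := e p - 1), J)"
  by (auto simp: fun_eq_iff)
lift_definition dop :: "'m \<times> 'm \<Rightarrow> 'm conf op" is
  "\<lambda>p f (e, J). of_nat (e p + 1) * f (e(p := e p + 1), J)"
  by (auto simp: fun_eq_iff algebra_simps)
lift_definition uop :: "'m::{finite,linorder} \<Rightarrow> 'm conf op" is
  "\<lambda>a f (e, J). if a \<in> J then sg a J * f (e, J - {a}) else 0"
  by (auto simp: fun_eq_iff algebra_simps)
lift_definition wop :: "'m::{finite,linorder} \<Rightarrow> 'm conf op" is
  "\<lambda>a f (e, J). if a \<in> J then 0 else sg a J * f (e, insert a J)"
  by (auto simp: fun_eq_iff algebra_simps)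

lemma ap_zop: "ap (zop p) f (e, J) = (if e p = 0 then 0 else f (e(p := e p - 1), J))"
  and ap_dop: "ap (dop p) f (e, J) = of_nat (e p + 1) * f (e(p := e p + 1), J)"
  by (simp_all add: zop.rep_eq dop.rep_eq)

lemma ap_uop: "ap (uop a) f (e, J) = (if a \<in> J then sg a J * f (e, J - {a}) else 0)"
  and ap_wop: "ap (wop a) f (e, J) = (if a \<in> J then 0 else sg a J * f (e, insert a J))"
  by (simp_all add: uop.rep_eq wop.rep_eq)

lemmas ap_modes = ap_zop ap_dop ap_uop ap_wop

lemma mode_eqI: "(\<And>f e J. ap S f (e, J) = ap T f (e, J)) \<Longrightarrow> S = T"
  by (rule op_eqI) (auto simp: fun_eq_iff)

lemma zop_zop: "zop p * zop q = zop q * zop p"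
  by (rule mode_eqI) (auto simp: ap_simps ap_modes fun_upd_twist)

lemma dop_dop: "dop p * dop q = dop q * dop p"
  by (rule mode_eqI) (cases "p = q", auto simp: ap_simps ap_modes fun_upd_twist)

lemma dop_zop: "dop p * zop q = zop q * dop p + (if p = q then 1 else 0)"
  by (rule mode_eqI) (cases "p = q", auto simp: ap_simps ap_modes fun_upd_twist algebra_simps of_nat_diff)

lemma uop_uop: "uop a * uop b = - (uop b * uop a)"
proof (rule mode_eqI)
  fix f and e :: "'a \<times> 'a \<Rightarrow> nat" and J
  have "J - {a} - {b} = J - {b} - {a}" by auto
  then show "ap (uop a * uop b) f (e, J) = ap (- (uop b * uop a)) f (e, J)"
    by (cases a b rule: linorder_cases; simp add: ap_simps ap_modes sg_remove) (metis less_asym)+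
qed

lemma wop_wop: "wop a * wop b = - (wop b * wop a)"
proof (rule mode_eqI)
  fix f and e :: "'a \<times> 'a \<Rightarrow> nat" and J
  have "insert a (insert b J) = insert b (insert a J)" by auto
  then show "ap (wop a * wop b) f (e, J) = ap (- (wop b * wop a)) f (e, J)"
    by (cases a b rule: linorder_cases; simp add: ap_simps ap_modes sg_insert) (metis less_asym)+
qed

lemma uop_sq: "uop a * uop a = 0" and wop_sq: "wop a * wop a = 0"
  by (rule op_two, rule uop_uop, rule op_two, rule wop_wop)

lemma wop_uop: "wop a * uop b = (if a = b then 1 else 0) - uop b * wop a"
proof (cases "a = b")
  case True
  then show ?thesis
    by (intro mode_eqI) (auto simp: ap_simps ap_modes sg_self sg_sq insert_absorb)
next
  case False
  have "ap (wop a * uop b) f (e, J) = - ap (uop b * wop a) f (e, J)" for f and e :: "'a \<times> 'a \<Rightarrow> nat" and J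
  proof (cases "a \<in> J \<or> b \<notin> J")
    case True
    with False show ?thesis by (auto simp: ap_simps ap_modes)
  next
    case nJ: False
    have "insert a J - {b} = insert a (J - {b})" using False by auto
    then show ?thesis
      using False nJ by (cases a b rule: linorder_cases) (simp_all add: ap_mult ap_modes sg_insert sg_remove del: insert_Diff_single Diff_insert0)
  qed
  then show ?thesis using False by (intro mode_eqI) (simp add: ap_simps)
qed

lemma uop_zop: "uop a * zop p = zop p * uop a" and uop_dop: "uop a * dop p = dop p * uop a"
  and wop_zop: "wop a * zop p = zop p * wop a" and wop_dop: "wop a * dop p = dop p * wop a"
  by (rule mode_eqI, auto simp: ap_simps ap_modes)+

section \<open>Commutation and anticommutation of composite operators\<close>

definition comm :: "'r::ring_1 \<Rightarrow> 'r \<Rightarrow> bool" where "comm p q \<longleftrightarrow> p * q = q * p"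
definition anti :: "'r::ring_1 \<Rightarrow> 'r \<Rightarrow> bool" where "anti p q \<longleftrightarrow> p * q = - (q * p)"

lemma comm_add: "comm p r \<Longrightarrow> comm q r \<Longrightarrow> comm (p + q) r"
  and comm_diff: "comm p r \<Longrightarrow> comm q r \<Longrightarrow> comm (p - q) r"
  and anti_add: "anti p r \<Longrightarrow> anti q r \<Longrightarrow> anti (p + q) r"
  and anti_diff: "anti p r \<Longrightarrow> anti q r \<Longrightarrow> anti (p - q) r"
  and comm_0: "comm 0 r" and anti_0: "anti 0 r" and comm_1: "comm 1 r"
  by (simp_all add: comm_def anti_def algebra_simps)

lemma comm_comm: "comm p r \<Longrightarrow> comm q r \<Longrightarrow> comm (p * q) r"
  and anti_anti: "anti p r \<Longrightarrow> anti q r \<Longrightarrow> comm (p * q) r"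
  and comm_anti: "comm p r \<Longrightarrow> anti q r \<Longrightarrow> anti (p * q) r"
  and anti_comm: "anti p r \<Longrightarrow> comm q r \<Longrightarrow> anti (p * q) r"
  unfolding comm_def anti_def by (metis mult.assoc, (metis mult.assoc mult_minus_left mult_minus_right minus_minus)+)

lemma comm_sum: "(\<And>k. k \<in> A \<Longrightarrow> comm (f k) r) \<Longrightarrow> comm (sum f A) r"
  by (induction A rule: infinite_finite_induct) (auto intro: comm_0 comm_add)
lemma anti_sum: "(\<And>k. k \<in> A \<Longrightarrow> anti (f k) r) \<Longrightarrow> anti (sum f A) r"
  by (induction A rule: infinite_finite_induct) (auto intro: anti_0 anti_add)

lemma comm_modes:
  "comm (cst c) r" "comm (zop p) (zop q)" "comm (dop p) (dop q)"
  "p \<noteq> q \<Longrightarrow> comm (zop p) (dop q)" "p \<noteq> q \<Longrightarrow> comm (dop p) (zop q)"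
  by (auto simp: comm_def cst_central zop_zop dop_dop dop_zop)

lemma comm_odd_even_modes:
  "comm (uop a) (zop p)" "comm (uop a) (dop p)" "comm (wop a) (zop p)" "comm (wop a) (dop p)"
  "comm (zop p) (uop a)" "comm (dop p) (uop a)" "comm (zop p) (wop a)" "comm (dop p) (wop a)"
  by (auto simp: comm_def uop_zop uop_dop wop_zop wop_dop)

lemma anti_modes:
  "anti (uop a) (uop b)" "anti (wop a) (wop b)"
  "a \<noteq> b \<Longrightarrow> anti (uop a) (wop b)" "a \<noteq> b \<Longrightarrow> anti (wop a) (uop b)"
  unfolding anti_def by (rule uop_uop, rule wop_wop, simp_all add: wop_uop)

text \<open>
  Here \<open>le i\<close> and \<open>ld\<close> are the weights of \<open>E_(i, i)\<close> and \<open>E_(\<delta>, \<delta>)\<close>; a list is the set of indices adjoined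
  so far, the smallest one first.
\<close>

locale gl_weight =
  fixes le :: "'m::{finite,linorder} \<Rightarrow> complex" and ld :: complex
begin

primrec hop :: "'m list \<Rightarrow> 'm conf op" where
  "hop [] = cst ld"
| "hop (a # S) = hop S + uop a * wop a"

primrec xop :: "'m list \<Rightarrow> 'm \<Rightarrow> 'm conf op" where
  "xop [] = (\<lambda>j. 0)"
| "xop (a # S) = (\<lambda>j. if j = a
     then (cst (le a) - (\<Sum>k\<in>set S. zop (k, a) * dop (k, a)) + hop S) * wop a - (\<Sum>k\<in>set S. dop (k, a) * xop S k)
     else xop S j + zop (j, a) * wop a)"

primrec yop :: "'m list \<Rightarrow> 'm \<Rightarrow> 'm conf op" where
  "yop [] = (\<lambda>j. 0)"
| "yop (a # S) = (\<lambda>j. if j = a then uop a else yop S j + uop a * dop (j, a))"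

text \<open>For an index outside \<open>S\<close>, only parity decides how its modes pass the
  operators of \<open>S\<close>. This lemma and its analogues for \<open>xop\<close>,
  \<open>yop\<close> and \<open>gop\<close> provide the commutation hypotheses of the
  locales.\<close>

lemma hop_comm: "a \<notin> set S \<Longrightarrow> comm (hop S) (zop (b, a)) \<and> comm (hop S) (dop (b, a)) \<and> comm (hop S) (uop a) \<and> comm (hop S) (wop a)"
  by (induction S) (auto intro!: comm_modes comm_odd_even_modes comm_add anti_anti[OF anti_modes(1,4)] anti_anti[OF anti_modes(3,2)]
      comm_comm[OF comm_odd_even_modes(1) comm_odd_even_modes(3)] comm_comm[OF comm_odd_even_modes(2) comm_odd_even_modes(4)])

lemma xop_comm: "a \<notin> set S \<Longrightarrow> comm (xop S j) (zop (b, a)) \<and> comm (xop S j) (dop (b, a)) \<and> anti (xop S j) (uop a) \<and> anti (xop S j) (wop a)"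
proof (induction S arbitrary: j)
  case Nil
  then show ?case by (simp add: comm_0 anti_0)
next
  case (Cons h S)
  then have a: "a \<noteq> h" "a \<notin> set S" by auto
  note IH = Cons.IH[OF a(2)] and H = hop_comm[OF a(2)]
  have even: "comm (cst (le h) - (\<Sum>k\<in>set S. zop (k, h) * dop (k, h)) + hop S) q"
    if "q \<in> {zop (b, a), dop (b, a), uop a, wop a}" for q
    using that a H
    by (elim insertE emptyE; hypsubst; intro comm_add comm_diff comm_sum comm_comm comm_modes comm_odd_even_modes) auto
  have 1: "comm (xop (h # S) j) q" if "q \<in> {zop (b, a), dop (b, a)}" for q
    using that even[of q] a IH H
    by (auto intro!: comm_add comm_diff comm_sum comm_comm comm_modes comm_odd_even_modes)
  have 2: "anti (xop (h # S) j) q" if "q \<in> {uop a, wop a}" for q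
    using that even[of q] a IH
    by (auto intro!: anti_add anti_diff anti_sum comm_anti comm_modes comm_odd_even_modes anti_modes)
  show ?case using 1 2 by blast
qed

lemma yop_comm: "a \<notin> set S \<Longrightarrow> comm (yop S j) (zop (b, a)) \<and> comm (yop S j) (dop (b, a)) \<and> anti (yop S j) (uop a) \<and> anti (yop S j) (wop a)"
  by (induction S) (auto simp: comm_0 anti_0 intro!: comm_add anti_add comm_comm anti_comm comm_modes comm_odd_even_modes anti_modes)

end

lemma extension_modes_Fock: "extension_modes (set S) (\<lambda>j. zop (j, a)) (\<lambda>j. dop (j, a)) (uop a) (wop a)"
  by unfold_locales (auto simp: op_two zop_zop dop_dop dop_zop uop_sq wop_sq wop_uop uop_zop uop_dop wop_zop wop_dop)

context gl_weight
begin

text \<open>The two claims feed each other: a step over \<open>S\<close> needs the relations for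
  \<open>S\<close> and yields those for \<open>a # S\<close>.\<close>

lemma step_and_rels:
  "distinct S \<Longrightarrow> triple_rels (set S) (xop S) (yop S) (hop S)"
  "distinct (a # S) \<Longrightarrow> extension_step (set S) (\<lambda>j. zop (j, a)) (\<lambda>j. dop (j, a)) (uop a) (wop a) (xop S) (yop S) (hop S) (cst (le a))"
proof -
  have step: "extension_step (set S) (\<lambda>j. zop (j, a)) (\<lambda>j. dop (j, a)) (uop a) (wop a) (xop S) (yop S) (hop S) (cst (le a))"
    if "triple_rels (set S) (xop S) (yop S) (hop S)" "a \<notin> set S" for a S
    using that hop_comm[of a S] xop_comm[of a S] yop_comm[of a S]
    by (auto intro!: extension_step.intro extension_modes_Fock extension_step_axioms.intro cst_central simp: comm_def anti_def)
  show *: "triple_rels (set S) (xop S) (yop S) (hop S)" if "distinct S" for S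
    using that
  proof (induction S)
    case Nil
    then show ?case by (simp add: triple_rels_def)
  next
    case (Cons a S)
    then interpret extension_step "set S" "\<lambda>j. zop (j, a)" "\<lambda>j. dop (j, a)" "uop a" "wop a" "xop S" "yop S" "hop S" "cst (le a)"
      by (intro step) auto
    have eq: "xop (a # S) = x' a" "yop (a # S) = y' a" "hop (a # S) = h'"
      by (auto simp: x'_def y'_def h'_def A_def D_def eu_def)
    show ?case unfolding eq list.set using Cons.prems by (intro triple_rels_extend) simp
  qed
  show "extension_step (set S) (\<lambda>j. zop (j, a)) (\<lambda>j. dop (j, a)) (uop a) (wop a) (xop S) (yop S) (hop S) (cst (le a))"
    if "distinct (a # S)" using that by (intro step *) auto
qed

text \<open>This unfolds \<open>g'\<close> along the list. The constant \<open>n\<close> of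
  \<open>contraction_rels\<close> is \<open>ld\<close> for the empty list and grows by one with each
  index, so the divisor is \<open>le a + ld + length S\<close>, the number called a_a in the
  overview. Where it vanishes the quotient is 0 by convention; the relations are claimed only for
  \<open>typical\<close> lists.\<close>

primrec gop :: "'m list \<Rightarrow> 'm \<Rightarrow> 'm conf op" where
  "gop [] = (\<lambda>j. 0)"
| "gop (a # S) = (\<lambda>j. let t = cst (1 / (le a + ld + of_nat (length S))) * (uop a - (\<Sum>k\<in>set S. zop (k, a) * gop S k))
     in if j = a then t else gop S j + t * (gop S j * wop a + dop (j, a)))"

lemma gop_comm: "a \<notin> set S \<Longrightarrow> comm (gop S j) (zop (b, a)) \<and> comm (gop S j) (dop (b, a)) \<and> anti (gop S j) (uop a) \<and> anti (gop S j) (wop a)"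
proof (induction S arbitrary: j)
  case Nil
  then show ?case by (simp add: comm_0 anti_0)
next
  case (Cons h S)
  then have a: "a \<noteq> h" "a \<notin> set S" by auto
  note IH = Cons.IH[OF a(2)]
  let ?t = "cst (1 / (le h + ld + of_nat (length S))) * (uop h - (\<Sum>k\<in>set S. zop (k, h) * gop S k))"
  have t1: "comm ?t q" if "q \<in> {zop (b, a), dop (b, a)}" for q
    using that a IH
    by (auto intro!: comm_add comm_diff comm_sum comm_comm comm_modes comm_odd_even_modes)
  have t2: "anti ?t q" if "q \<in> {uop a, wop a}" for q
    using that a IH
    by (auto intro!: anti_add anti_diff anti_sum comm_anti comm_modes comm_odd_even_modes anti_modes)
  have 1: "comm (gop (h # S) j) q" if "q \<in> {zop (b, a), dop (b, a)}" for q
    using that t1[OF that] a IH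
    by (auto simp: Let_def intro!: comm_add comm_diff comm_comm[of ?t] comm_comm[of "gop S j"] comm_modes comm_odd_even_modes)
  have 2: "anti (gop (h # S) j) q" if "q \<in> {uop a, wop a}" for q
    using that t2[OF that] a IH
    by (auto simp: Let_def intro!: anti_add comm_add anti_comm[of ?t] anti_anti[of "gop S j"] comm_modes comm_odd_even_modes anti_modes)
  show ?case using 1 2 by blast
qed

fun typical :: "'m list \<Rightarrow> bool" where
  "typical [] = True"
| "typical (a # S) = (le a + ld + of_nat (length S) \<noteq> 0 \<and> typical S)"

lemma gop_rels:
  "distinct S \<Longrightarrow> typical S \<Longrightarrow> contraction_rels (set S) (xop S) (hop S) (cst (ld + of_nat (length S))) (gop S)"
proof (induction S)
  case Nil
  then show ?case by (simp add: contraction_rels_def)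
next
  case (Cons a S)
  let ?b = "cst (1 / (le a + ld + of_nat (length S)))"
  interpret extension_step "set S" "\<lambda>j. zop (j, a)" "\<lambda>j. dop (j, a)" "uop a" "wop a" "xop S" "yop S" "hop S" "cst (le a)"
    using Cons.prems by (intro step_and_rels)
  interpret contraction_step "set S" "\<lambda>j. zop (j, a)" "\<lambda>j. dop (j, a)" "uop a" "wop a" "xop S" "yop S" "hop S" "cst (le a)"
    "gop S" "cst (ld + of_nat (length S))" ?b
  proof
    show "contraction_rels (set S) (xop S) (hop S) (cst (ld + of_nat (length S))) (gop S)"
      using Cons by simp
    show "(cst (le a) + cst (ld + of_nat (length S))) * ?b = 1"
      using Cons.prems by (simp add: cst_add[symmetric] cst_mult[symmetric] cst_1 add.assoc)
  qed (use Cons.prems gop_comm[of a S] in \<open>auto simp: comm_def anti_def cst_central\<close>)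
  have eq: "xop (a # S) = x' a" "hop (a # S) = h'" "gop (a # S) = g' a"
    by (auto simp: x'_def h'_def g'_def A_def D_def eu_def s_def Let_def)
  have n: "cst (ld + of_nat (length (a # S))) = cst (ld + of_nat (length S)) + 1"
    by (simp add: cst_add cst_1 algebra_simps)
  show ?case unfolding eq n list.set using Cons.prems by (intro contraction_rels_extend) simp
qed

end

section \<open>The contractible case\<close>

definition fock_space :: "('m::{finite,linorder} conf \<Rightarrow> complex) set" where
  "fock_space = {f. finite {c. f c \<noteq> 0} \<and> (\<forall>e J b a. f (e, J) \<noteq> 0 \<longrightarrow> e (b, a) \<noteq> 0 \<longrightarrow> a < b)}"

text \<open>A contraction produces a preimage among all functions; it counts only if the contraction
  stays inside \<open>fock_space\<close>.\<close>

definition pres :: "'m::{finite,linorder} conf op \<Rightarrow> bool" where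
  "pres T \<longleftrightarrow> (\<forall>f\<in>fock_space. ap T f \<in> fock_space)"

lemma fock_spaceI:
  assumes "finite X" "\<And>c. f c \<noteq> 0 \<Longrightarrow> c \<in> X" "\<And>e J b a. f (e, J) \<noteq> 0 \<Longrightarrow> e (b, a) \<noteq> 0 \<Longrightarrow> a < b"
  shows "f \<in> fock_space"
  unfolding fock_space_def using assms(2,3) by (auto intro: finite_subset[OF _ assms(1)])

lemma fock_space_finite: "f \<in> fock_space \<Longrightarrow> finite {c. f c \<noteq> 0}"
  and fock_space_lower: "f \<in> fock_space \<Longrightarrow> f (e, J) \<noteq> 0 \<Longrightarrow> e (b, a) \<noteq> 0 \<Longrightarrow> a < b"
  by (auto simp: fock_space_def)

lemma fock_space_add:
  assumes "f \<in> fock_space" "g \<in> fock_space"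
  shows "f + g \<in> fock_space"
proof (rule fock_spaceI[of "{c. f c \<noteq> 0} \<union> {c. g c \<noteq> 0}"])
  fix e J b a assume "(f + g) (e, J) \<noteq> 0" "e (b, a) \<noteq> 0"
  moreover from this have "f (e, J) \<noteq> 0 \<or> g (e, J) \<noteq> 0" by auto
  ultimately show "a < b" using assms fock_space_lower by blast
qed (use assms in \<open>auto simp: fock_space_finite\<close>)

lemma fock_space_mono:
  assumes "f \<in> fock_space" "\<And>c. f c = 0 \<Longrightarrow> g c = 0"
  shows "g \<in> fock_space"
proof (rule fock_spaceI[of "{c. f c \<noteq> 0}"])
  fix e J b a assume "g (e, J) \<noteq> 0" "e (b, a) \<noteq> 0"
  then show "a < b" using assms fock_space_lower by blast
qed (use assms in \<open>auto simp: fock_space_finite\<close>)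

lemma fock_space_0: "0 \<in> fock_space"
  by (rule fock_spaceI[of "{}"]) auto

lemma fock_space_neg: "f \<in> fock_space \<Longrightarrow> - f \<in> fock_space"
  by (erule fock_space_mono) simp

lemma fock_space_diff: "f \<in> fock_space \<Longrightarrow> g \<in> fock_space \<Longrightarrow> f - g \<in> fock_space"
  using fock_space_add[of f "- g"] fock_space_neg[of g] by simp

lemma pres_add: "pres S \<Longrightarrow> pres T \<Longrightarrow> pres (S + T)" and pres_diff: "pres S \<Longrightarrow> pres T \<Longrightarrow> pres (S - T)"
  and pres_mult: "pres S \<Longrightarrow> pres T \<Longrightarrow> pres (S * T)" and pres_0: "pres 0" and pres_1: "pres 1"
  by (simp_all add: pres_def ap_simps fock_space_add fock_space_diff fock_space_0)

lemma pres_sum: "(\<And>k. k \<in> A \<Longrightarrow> pres (f k)) \<Longrightarrow> pres (sum f A)"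
  by (induction A rule: infinite_finite_induct) (auto intro: pres_0 pres_add)

lemma pres_power: "pres T \<Longrightarrow> pres (T ^ n)"
  by (induction n) (auto intro: pres_1 pres_mult)

lemma pres_dg: "pres (dg k)" and pres_cst: "pres (cst c)"
  unfolding pres_def cst_def ap_dg by (auto elim!: fock_space_mono)

lemma pres_zop: "a < b \<Longrightarrow> pres (zop (b, a))"
  unfolding pres_def
proof (intro ballI)
  fix f :: "'a conf \<Rightarrow> complex" assume f: "f \<in> fock_space" and ab: "a < b"
  let ?p = "\<lambda>(e :: 'a \<times> 'a \<Rightarrow> nat, J :: 'a set). (e((b, a) := e (b, a) + 1), J)"
  show "ap (zop (b, a)) f \<in> fock_space"
  proof (rule fock_spaceI[of "?p ` {c. f c \<noteq> 0}"])
    fix c assume "ap (zop (b, a)) f c \<noteq> 0"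
    then show "c \<in> ?p ` {c. f c \<noteq> 0}"
      by (cases c) (force simp: ap_zop image_iff split: if_splits intro!: exI[of _ "(fst c)((b, a) := fst c (b, a) - 1)"] exI[of _ "snd c"])
  next
    fix e J b' a' assume "ap (zop (b, a)) f (e, J) \<noteq> 0" "e (b', a') \<noteq> 0"
    then show "a' < b'"
      using ab fock_space_lower[OF f, of "e((b, a) := e (b, a) - 1)" J b' a']
      by (cases "(b', a') = (b, a)") (auto simp: ap_zop split: if_splits)
  qed (use f fock_space_finite in auto)
qed

lemma pres_dop: "pres (dop p)"
  unfolding pres_def
proof (intro ballI)
  fix f :: "'a conf \<Rightarrow> complex" assume f: "f \<in> fock_space"
  let ?p = "\<lambda>(e :: 'a \<times> 'a \<Rightarrow> nat, J :: 'a set). (e(p := e p - 1), J)"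
  show "ap (dop p) f \<in> fock_space"
  proof (rule fock_spaceI[of "?p ` {c. f c \<noteq> 0}"])
    fix c assume "ap (dop p) f c \<noteq> 0"
    then show "c \<in> ?p ` {c. f c \<noteq> 0}"
      by (cases c) (force simp: ap_dop image_iff intro!: exI[of _ "(fst c)(p := fst c p + 1)"] exI[of _ "snd c"])
  next
    fix e J b' a' assume "ap (dop p) f (e, J) \<noteq> 0" "e (b', a') \<noteq> 0"
    then show "a' < b'"
      using fock_space_lower[OF f, of "e(p := e p + 1)" J b' a']
      by (cases "(b', a') = p") (auto simp: ap_dop)
  qed (use f fock_space_finite in auto)
qed

lemma pres_uop: "pres (uop a)" and pres_wop: "pres (wop a)"
proof -
  have "ap T f \<in> fock_space" if f: "f \<in> fock_space" and T: "\<And>e J. ap T f (e, J) \<noteq> 0 \<Longrightarrow> \<exists>J'. f (e, J') \<noteq> 0" for T and f :: "'a conf \<Rightarrow> complex"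
  proof (rule fock_spaceI[of "(fst ` {c. f c \<noteq> 0}) \<times> UNIV"])
    fix c assume "ap T f c \<noteq> 0"
    then show "c \<in> (fst ` {c. f c \<noteq> 0}) \<times> UNIV"
      using T[of "fst c" "snd c"] by (cases c) force
  next
    fix e J b' a' assume "ap T f (e, J) \<noteq> 0" "e (b', a') \<noteq> 0"
    then show "a' < b'" using T fock_space_lower[OF f] by blast
  qed (use fock_space_finite[OF f] in \<open>auto intro!: finite_cartesian_product\<close>)
  note * = this
  show "pres (uop a)" unfolding pres_def by (intro ballI, erule *) (auto simp: ap_modes split: if_splits)
  show "pres (wop a)" unfolding pres_def by (intro ballI, erule *) (auto simp: ap_modes split: if_splits)
qed

lemmas pres_intros = pres_add pres_diff pres_mult pres_sum pres_cst pres_dop pres_uop pres_wop pres_zop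

context gl_weight
begin

lemma pres_hop: "pres (hop S)"
  by (induction S) (auto intro!: pres_intros)

lemma pres_xop: "sorted_wrt (<) S \<Longrightarrow> j \<in> set S \<Longrightarrow> pres (xop S j)"
  by (induction S arbitrary: j) (auto intro!: pres_intros pres_hop)

lemma pres_yop: "sorted_wrt (<) S \<Longrightarrow> pres (yop S j)"
  by (induction S arbitrary: j) (auto intro!: pres_intros pres_0)

lemma pres_gop: "sorted_wrt (<) S \<Longrightarrow> pres (gop S j)"
  by (induction S arbitrary: j) (auto simp: Let_def intro!: pres_intros pres_0)

text \<open>Indices below \<open>i\<close> contribute only terms with a fermionic annihilator of
  their own. This reduces both directions to the case where \<open>i\<close> is the least index:
  such terms anticommute with the contraction and kill the singular vectors.\<close>

lemma xop_append: "distinct (R @ i # S) \<Longrightarrow>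
    xop (R @ i # S) i = xop (i # S) i + (\<Sum>a\<in>set R. zop (i, a) * wop a)"
  by (induction R) (auto simp: algebra_simps)

definition aop :: "'m \<Rightarrow> 'm list \<Rightarrow> 'm conf op" where
  "aop i S = cst (le i) - (\<Sum>k\<in>set S. zop (k, i) * dop (k, i)) + hop S"

lemma zop_dop_dg: "zop p * dop p = dg (\<lambda>c. of_nat (fst c p))"
  by (rule mode_eqI) (simp add: ap_simps ap_modes ap_dg)

lemma uop_wop_dg: "uop a * wop a = dg (\<lambda>c. if a \<in> snd c then 1 else 0)"
  by (rule mode_eqI) (simp add: ap_simps ap_modes ap_dg sg_self sg_sq insert_absorb)

lemma sum_dg: "finite A \<Longrightarrow> (\<Sum>k\<in>A. dg (f k)) = dg (\<lambda>e. \<Sum>k\<in>A. f k e)"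
  by (induction A rule: finite_induct) (simp_all add: dg_add flip: cst_def[of 0, unfolded cst_0])

lemma hop_dg: "distinct S \<Longrightarrow> hop S = dg (\<lambda>c. ld + of_nat (card (snd c \<inter> set S)))"
proof (induction S)
  case (Cons a S)
  have "card (J \<inter> set (a # S)) = card (J \<inter> set S) + (if a \<in> J then 1 else 0)" for J
    using Cons.prems by (auto simp: Int_insert_right)
  then show ?case
    using Cons
    by (simp add: uop_wop_dg dg_add[symmetric] del: set_simps) (rule arg_cong[of _ _ dg], auto simp: fun_eq_iff)
qed (simp add: cst_def)

lemma aop_dg: "distinct S \<Longrightarrow>
    aop i S = dg (\<lambda>c. le i - (\<Sum>k\<in>set S. of_nat (fst c (k, i))) + (ld + of_nat (card (snd c \<inter> set S))))"
  unfolding aop_def zop_dop_dg cst_def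
  by (simp add: hop_dg sum_dg dg_add[symmetric] dg_diff[symmetric])

lemma xop_head: "xop (i # S) i = aop i S * wop i - (\<Sum>k\<in>set S. dop (k, i) * xop S k)"
  by (simp add: aop_def)

lemma aop_comm:
  assumes "a \<notin> set (i # S)" "q \<in> {zop (b, a), dop (b, a), uop a, wop a}"
  shows "comm (aop i S) q"
  unfolding aop_def using assms hop_comm[of a S]
  by (elim insertE emptyE; hypsubst; intro comm_add comm_diff comm_sum comm_comm comm_modes comm_odd_even_modes) auto

text \<open>The contraction is \<open>uop i\<close> times the inverse \<open>B\<close> of the
  diagonal operator. \<open>B\<close> commutes with everything that commutes with \<open>A\<close>,
  in particular with \<open>D\<close>, while \<open>uop i\<close> anticommutes with
  \<open>D\<close>; so only the term \<open>A * wop i\<close> contributes to the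
  anticommutator.\<close>

lemma contraction_nonint:
  assumes sorted: "sorted_wrt (<) (i # S)" and nat: "le i + ld + of_nat (length S) \<notin> \<nat>"
  shows "\<exists>G. pres G \<and> xop (i # S) i * G + G * xop (i # S) i = 1 \<and>
    (\<forall>a b. a \<notin> set (i # S) \<longrightarrow> comm G (zop (b, a)) \<and> anti G (wop a))"
proof -
  have dist: "distinct (i # S)" using sorted by (metis strict_sorted_iff)
  interpret extension_step "set S" "\<lambda>j. zop (j, i)" "\<lambda>j. dop (j, i)" "uop i" "wop i" "xop S" "yop S" "hop S" "cst (le i)"
    using dist by (rule step_and_rels)
  have A: "A = aop i S" by (simp add: A_def eu_def aop_def)
  define k where "k = (\<lambda>c :: 'm conf. le i - (\<Sum>k\<in>set S. of_nat (fst c (k, i))) + (ld + of_nat (card (snd c \<inter> set S))))"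
  \<comment> \<open>A zero eigenvalue would exhibit \<open>le i + ld + length S\<close> as the
    number of bosons (k, i) plus the number of unoccupied fermions in \<open>S\<close>.\<close>
  have k: "k c \<noteq> 0" for c
  proof
    assume 0: "k c = 0"
    define e J where c: "e = fst c" "J = snd c"
    have "card (J \<inter> set S) \<le> length S"
      by (metis card_length card_mono finite_set inf.cobounded2 le_trans)
    then have "(of_nat (length S) :: complex) = of_nat (card (J \<inter> set S)) + of_nat (length S - card (J \<inter> set S))"
      by (simp add: of_nat_diff)
    then have "le i + ld + of_nat (length S) = of_nat ((\<Sum>k\<in>set S. e (k, i)) + (length S - card (J \<inter> set S)))"
      using 0 by (simp add: c k_def algebra_simps)
    then show False using nat by (metis of_nat_in_Nats)
  qed
  have Ak: "A = dg k" unfolding A using dist by (simp add: aop_dg k_def)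
  define B where "B = dg (\<lambda>c. 1 / k c)"
  have AB: "A * B = 1" "B * A = 1" unfolding Ak B_def dg_mult using k by (simp_all add: dg_1)
  have B: "B * q = q * B" if "A * q = q * A" for q
  proof -
    have "B * q = B * (q * A) * B" by (simp add: mult.assoc AB)
    also have "\<dots> = B * A * q * B" by (simp add: that[symmetric] mult.assoc)
    finally show ?thesis by (simp add: AB)
  qed
  have D: "D * B = B * D" using B[of D] A_D by simp
  have x: "xop (i # S) i = A * wop i - D" by (simp add: A xop_head D_def del: xop.simps)
  have "xop (i # S) i * (uop i * B) + (uop i * B) * xop (i # S) i
     = A * (wop i * uop i) * B + uop i * (B * A) * wop i - (D * uop i * B + uop i * (B * D))"
    unfolding x by (simp add: algebra_simps)
  also have "\<dots> = A * B - uop i * wop i * (A * B) + uop i * wop i"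
    by (simp add: wop_uop D_u AB D[symmetric] algebra_simps mult_eq_left[OF A_u] mult_eq_left[OF A_w])
  also have "\<dots> = 1" by (simp add: AB)
  finally have 1: "xop (i # S) i * (uop i * B) + (uop i * B) * xop (i # S) i = 1" .
  have 2: "comm (uop i * B) (zop (b, a))" "anti (uop i * B) (wop a)" if "a \<notin> set (i # S)" for a b
  proof -
    have "comm B (zop (b, a))" "comm B (wop a)"
      using that aop_comm[of a i S _ b] B unfolding A comm_def by auto
    then show "comm (uop i * B) (zop (b, a))" "anti (uop i * B) (wop a)"
      using that by (auto intro!: comm_comm anti_comm comm_odd_even_modes anti_modes)
  qed
  have "pres (uop i * B)" unfolding B_def by (intro pres_intros pres_dg)
  with 1 2 show ?thesis by blast
qed

lemma contraction_typical:
  assumes sorted: "sorted_wrt (<) (i # S)" and tpl: "typical (i # S)"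
  shows "\<exists>G. pres G \<and> xop (i # S) i * G + G * xop (i # S) i = 1 \<and>
    (\<forall>a b. a \<notin> set (i # S) \<longrightarrow> comm G (zop (b, a)) \<and> anti G (wop a))"
proof -
  have dist: "distinct (i # S)" using sorted by (metis strict_sorted_iff)
  have "xop (i # S) i * gop (i # S) i = 1 - gop (i # S) i * xop (i # S) i"
    using gop_rels[OF dist tpl] unfolding contraction_rels_def by auto
  then have "xop (i # S) i * gop (i # S) i + gop (i # S) i * xop (i # S) i = 1" by simp
  moreover note pres_gop[OF sorted] gop_comm[of _ "i # S" i]
  ultimately show ?thesis by blast
qed

text \<open>The contraction \<open>G\<close> for \<open>i # S\<close> also serves for
  \<open>R @ i # S\<close>: each added term is the product of a mode commuting with \<open>G\<close>
  and one anticommuting with it. A vector f in the kernel is then the image of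
  \<open>ap G f\<close>.\<close>

lemma xop_exact:
  assumes sorted: "sorted_wrt (<) (R @ i # S)"
    and "typical (i # S) \<or> le i + ld + of_nat (length S) \<notin> \<nat>"
    and f: "f \<in> fock_space" "ap (xop (R @ i # S) i) f = 0"
  shows "\<exists>g\<in>fock_space. f = ap (xop (R @ i # S) i) g"
proof -
  have s: "sorted_wrt (<) (i # S)" using sorted by (simp add: sorted_wrt_append)
  obtain G where G: "pres G" "xop (i # S) i * G + G * xop (i # S) i = 1"
    "\<And>a b. a \<notin> set (i # S) \<Longrightarrow> comm G (zop (b, a)) \<and> anti G (wop a)"
    using assms(2) contraction_typical[OF s] contraction_nonint[OF s] by metis
  have dist: "distinct (R @ i # S)" using sorted by (metis strict_sorted_iff)
  let ?T = "\<Sum>a\<in>set R. zop (i, a) * wop a"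
  have "?T * G = - (G * ?T)"
    unfolding sum_distrib_left sum_distrib_right sum_negf[symmetric]
  proof (rule sum.cong)
    fix a assume "a \<in> set R"
    then have "a \<notin> set (i # S)" using dist by auto
    then have c: "G * zop (i, a) = zop (i, a) * G" "G * wop a = - (wop a * G)"
      using G(3) by (auto simp: comm_def anti_def)
    have "G * (zop (i, a) * wop a) = zop (i, a) * G * wop a" by (simp only: c(1) mult.assoc[symmetric])
    also have "\<dots> = - (zop (i, a) * wop a * G)" by (simp add: c(2) mult.assoc)
    finally show "zop (i, a) * wop a * G = - (G * (zop (i, a) * wop a))"
      by simp
  qed simp
  then have "xop (R @ i # S) i * G + G * xop (R @ i # S) i = 1"
    using G(2) unfolding xop_append[OF dist] by (simp add: algebra_simps)
  then have "ap (xop (R @ i # S) i * G + G * xop (R @ i # S) i) f = f"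
    by (simp only: ap_1)
  then have "f = ap (xop (R @ i # S) i) (ap G f)"
    by (simp only: ap_add ap_mult f(2) ap_zero add_0_right)
  then show ?thesis using G(1) f(1) unfolding pres_def by blast
qed

end

section \<open>Singular vectors\<close>

definition scl :: "complex \<Rightarrow> ('c \<Rightarrow> complex) \<Rightarrow> 'c \<Rightarrow> complex" where "scl k f = (\<lambda>e. k * f e)"

lemma ap_scl: "ap T (scl k f) = scl k (ap T f)"
  and ap_cst_scl: "ap (cst k) f = scl k f"
  by (simp_all add: scl_def ap_scale ap_cst)

definition dlt :: "'c \<Rightarrow> 'c \<Rightarrow> complex" where "dlt c = (\<lambda>c'. if c' = c then 1 else 0)"

lemma scl_scl: "scl k (scl l f) = scl (k * l) f" and scl_add: "scl k f + scl l f = scl (k + l) f"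
  and scl_diff: "scl k f - scl l f = scl (k - l) f"
  and scl_0: "scl 0 f = 0" and scl_zero: "scl k 0 = 0" and scl_1: "scl 1 f = f" and scl_uminus: "- scl k f = scl (- k) f"
  and scl_plus: "scl k (f + g) = scl k f + scl k g"
  by (auto simp: scl_def fun_eq_iff algebra_simps)

lemma scl_sum: "scl k (sum f A) = (\<Sum>a\<in>A. scl k (f a))"
  by (induction A rule: infinite_finite_induct) (simp_all only: sum.infinite sum.empty sum.insert scl_zero scl_plus not_False_eq_True)

lemma of_nat_cst: "of_nat n = cst (of_nat n)"
  by (induction n) (simp_all add: cst_0 cst_1 cst_add)

lemma comm_power: "comm p q \<Longrightarrow> comm (p ^ n) q"
  by (induction n) (auto intro: comm_1 comm_comm)

lemma comm_sym: "comm p q \<Longrightarrow> comm q p" and anti_sym: "anti p q \<Longrightarrow> anti q p"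
  by (simp_all add: comm_def anti_def)

lemma dop_zop_power: "dop p * zop p ^ n = zop p ^ n * dop p + of_nat n * zop p ^ (n - 1)"
proof (induction n)
  case (Suc n)
  have "dop p * zop p ^ Suc n = dop p * zop p ^ n * zop p" by (simp add: power_commutes mult.assoc)
  also have "\<dots> = zop p ^ n * (dop p * zop p) + of_nat n * (zop p ^ (n - 1) * zop p)"
    by (simp add: Suc algebra_simps)
  also have "of_nat n * (zop p ^ (n - 1) * zop p) = of_nat n * zop p ^ n"
    by (cases n) (simp_all add: power_commutes)
  also have "zop p ^ n * (dop p * zop p) = zop p ^ Suc n * dop p + zop p ^ n"
    by (simp add: dop_zop power_commutes algebra_simps flip: mult.assoc)
  finally show ?case by (simp add: algebra_simps)
qed simp

context gl_weight
begin

definition dsum :: "'m \<Rightarrow> 'm list \<Rightarrow> 'm conf op" where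
  "dsum a S = (\<Sum>c\<in>set S. dop (c, a) * xop S c)"
definition euler :: "'m \<Rightarrow> 'm list \<Rightarrow> 'm conf op" where
  "euler a S = (\<Sum>c\<in>set S. zop (c, a) * dop (c, a))"
text \<open>Polarization, turning a boson (c, b) into a boson (c, a). The commutator of
  \<open>polar a b S\<close> and \<open>polar b a S\<close> is \<open>euler a S - euler b S\<close>,
  so the three form an sl2-triple.\<close>

definition polar :: "'m \<Rightarrow> 'm \<Rightarrow> 'm list \<Rightarrow> 'm conf op" where
  "polar a b S = (\<Sum>c\<in>set S. zop (c, a) * dop (c, b))"

text \<open>
  A singular vector \<open>F\<close> over the indices \<open>S > a\<close>, of degree \<open>n\<close> in the modes \<open>(c, a)\<close> and with all fermions
  of \<open>S\<close> occupied.  If \<open>le a + ld + length S = n\<close>, then the coefficient \<open>aop a S\<close> of \<open>wop a\<close> in \<open>xop (a # S) a\<close>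
  vanishes on \<open>F\<close>, and \<open>F\<close> lies in the kernel of \<open>xop (a # S) a\<close> but not in its image.
\<close>

definition singular :: "'m \<Rightarrow> 'm list \<Rightarrow> nat \<Rightarrow> ('m conf \<Rightarrow> complex) \<Rightarrow> bool" where
  "singular a S n F \<longleftrightarrow> F \<in> fock_space \<and> F \<noteq> 0 \<and> ap (dsum a S) F = 0 \<and> ap (euler a S) F = scl (of_nat n) F \<and>
     ap (hop S) F = scl (ld + of_nat (length S)) F \<and> (\<forall>c\<in>set S. ap (uop c) F = 0) \<and>
     (\<forall>c. c \<notin> set S \<longrightarrow> ap (wop c) F = 0) \<and> (\<forall>b c. b \<notin> insert a (set S) \<longrightarrow> ap (dop (c, b)) F = 0)"

text \<open>Filling the fermion \<open>b\<close> of a vector \<open>G\<close> without it. Moving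
  \<open>uop b\<close> to the left in \<open>dsum a (b # S) * uop b\<close> leaves a term without
  \<open>uop b\<close>, which hypothesis \<open>1\<close> kills, a term ending in
  \<open>wop b\<close>, and a term beginning with \<open>uop b\<close>, which hypothesis
  \<open>2\<close> kills.\<close>

lemma singular_cons:
  assumes dist: "distinct (b # S)" and a: "a \<notin> set (b # S)" "\<forall>c\<in>set (b # S). a < c"
    and w: "ap (wop b) G = 0"
    and 1: "ap (dop (b, a)) (ap (aop b S) G) + ap (polar b a S) G = 0"
    and 2: "ap (dop (b, a)) (ap (dsum b S) G) = ap (dsum a S) G"
    and G: "G \<in> fock_space" "G \<noteq> 0" "ap (zop (b, a) * dop (b, a) + euler a S) G = scl (of_nat n) G"
     "ap (hop S) G = scl (ld + of_nat (length S)) G" "\<forall>c\<in>set S. ap (uop c) G = 0"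
     "\<And>c. c \<notin> set S \<Longrightarrow> ap (wop c) G = 0" "\<And>b' c. b' \<notin> insert a (set (b # S)) \<Longrightarrow> ap (dop (c, b')) G = 0"
  shows "singular a (b # S) n (ap (uop b) G)"
proof -
  interpret extension_step "set S" "\<lambda>j. zop (j, b)" "\<lambda>j. dop (j, b)" "uop b" "wop b" "xop S" "yop S" "hop S" "cst (le b)"
    using dist by (rule step_and_rels)
  have A: "A = aop b S" by (simp add: A_def eu_def aop_def)
  have D: "D = dsum b S" by (simp add: D_def dsum_def)
  have bS: "b \<notin> set S" using dist by simp
  have ab: "a \<noteq> b" using a by auto
  have u0: "uop b * dop (c, d) = dop (c, d) * uop b" for c d by (rule uop_dop)
  have step: "dsum a (b # S) = dop (b, a) * (A * wop b - D) + dsum a S + polar b a S * wop b"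
  proof -
    have "(\<Sum>c\<in>set S. dop (c, a) * xop (b # S) c) = (\<Sum>c\<in>set S. dop (c, a) * xop S c + zop (c, b) * dop (c, a) * wop b)"
    proof (rule sum.cong)
      fix c assume "c \<in> set S"
      then have "c \<noteq> b" using bS by auto
      moreover have "dop (c, a) * zop (c, b) = zop (c, b) * dop (c, a)" using ab by (simp add: dop_zop)
      ultimately show "dop (c, a) * xop (b # S) c = dop (c, a) * xop S c + zop (c, b) * dop (c, a) * wop b"
        by (simp add: distrib_left flip: mult.assoc)
    qed simp
    then show ?thesis
      using bS by (simp add: dsum_def polar_def A D xop_head sum.distrib sum_distrib_right del: xop.simps)
  qed
  have dsu: "dsum a S * uop b = - (uop b * dsum a S)"
    using xop_comm[OF bS] unfolding dsum_def
    by (fold anti_def) (intro anti_sum comm_anti comm_odd_even_modes, auto)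
  have pu: "polar b a S * uop b = uop b * polar b a S"
    unfolding polar_def by (fold comm_def) (intro comm_sum comm_comm comm_odd_even_modes)
  have T: "dsum a (b # S) * uop b = (dop (b, a) * A + polar b a S) - (dop (b, a) * A + polar b a S) * uop b * wop b
      + uop b * (dop (b, a) * D - dsum a S)"
    unfolding step by (simp add: algebra_simps D_u wop_uop dsu mult_eq_left[OF u0])
  have "ap (dsum a (b # S)) (ap (uop b) G) = 0"
    unfolding ap_mult[symmetric] T using w 1 2 by (simp add: ap_simps A D ap_zero)
  moreover have "ap (uop b) G \<in> fock_space" using G(1) pres_uop unfolding pres_def by blast
  moreover have "ap (uop b) G \<noteq> 0"
  proof
    assume "ap (uop b) G = 0"
    then have "ap (wop b * uop b) G = 0" by (simp add: ap_mult ap_zero)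
    then show False using G(2) w by (simp add: wop_uop ap_simps ap_zero)
  qed
  moreover have "ap (euler a (b # S)) (ap (uop b) G) = scl (of_nat n) (ap (uop b) G)"
  proof -
    have "euler a (b # S) = zop (b, a) * dop (b, a) + euler a S" using bS by (simp add: euler_def)
    moreover have "comm (zop (b, a) * dop (b, a) + euler a S) (uop b)"
      unfolding euler_def by (intro comm_add comm_sum comm_comm comm_odd_even_modes)
    ultimately show ?thesis using G(3) by (simp add: comm_def ap_scl flip: ap_mult) (simp add: ap_mult ap_scl)
  qed
  moreover have "ap (hop (b # S)) (ap (uop b) G) = scl (ld + of_nat (length (b # S))) (ap (uop b) G)"
  proof -
    have "hop (b # S) * uop b = uop b * hop S + uop b - uop b * uop b * wop b"
      using hop_comm[OF bS] by (simp add: comm_def algebra_simps wop_uop)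
    then show ?thesis using G(4) unfolding ap_mult[symmetric]
      by (simp add: ap_simps ap_scl uop_sq) (simp add: scl_def fun_eq_iff algebra_simps)
  qed
  moreover have "ap (uop c) (ap (uop b) G) = 0" if "c \<in> set (b # S)" for c
  proof -
    have "ap (uop c) (ap (uop b) G) = - ap (uop b) (ap (uop c) G)"
      by (simp add: uop_uop[of c b] ap_uminus flip: ap_mult)
    then show ?thesis using that G(5) by (auto simp: ap_zero uop_sq ap_0 simp flip: ap_mult) (simp add: ap_mult ap_zero)
  qed
  moreover have "ap (wop c) (ap (uop b) G) = 0" if "c \<notin> set (b # S)" for c
    using that G(6)[of c] by (simp add: wop_uop ap_uminus flip: ap_mult) (simp add: ap_mult ap_zero)
  moreover have "ap (dop (c, b')) (ap (uop b) G) = 0" if "b' \<notin> insert a (set (b # S))" for b' c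
    using G(7)[OF that, of c] by (simp flip: ap_mult uop_dop) (simp add: ap_mult ap_zero)
  ultimately show ?thesis unfolding singular_def by blast
qed

text \<open>The starting vector has n bosons in the single mode (p, a) and all fermions of
  \<open>S\<close>. No boson (c, p) is present, so \<open>aop p S\<close> acts by
  \<open>le p + ld + length S\<close>, which is zero: this is where a vanishing shifted weight
  enters.\<close>

lemma singular_base:
  assumes dist: "distinct (p # S)" and a: "\<forall>c\<in>set (p # S). a < c" and p: "le p + ld + of_nat (length S) = 0"
  shows "\<exists>F. singular a (p # S) n F"
proof -
  define e0 where "e0 = (\<lambda>_::'m \<times> 'm. 0::nat)((p, a) := n)"
  define G where "G = dlt (e0, set S)"
  have ap: "a \<noteq> p" "a \<notin> set (p # S)" using a by auto
  have dop0: "ap (dop q) G = 0" if "q \<noteq> (p, a)" for q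
  proof -
    have "e(q := Suc (e q)) \<noteq> e0" for e
    proof
      assume "e(q := Suc (e q)) = e0"
      then have "Suc (e q) = e0 q" by (metis fun_upd_same)
      then show False using that by (simp add: e0_def)
    qed
    then show ?thesis by (auto simp: G_def ap_dop dlt_def fun_eq_iff)
  qed
  have sumz: "ap (sum (\<lambda>c. f c * dop (c, b)) (set S)) G = 0" if "(\<And>c. c \<in> set S \<Longrightarrow> (c, b) \<noteq> (p, a))" for b f
    unfolding ap_sum by (rule sum.neutral) (use dop0[OF that] in \<open>simp add: ap_mult ap_zero\<close>)
  have pS: "p \<notin> set S" using dist by simp
  have xd: "dop (c, b) * xop S c = xop S c * dop (c, b)" if "b \<notin> set S" for c b
    using xop_comm[OF that] by (simp add: comm_def)
  have ds: "ap (dsum b S) G = 0" if "b \<in> {a, p}" for b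
  proof -
    have "b \<notin> set S" using that ap pS by auto
    then have "dsum b S = (\<Sum>c\<in>set S. xop S c * dop (c, b))"
      unfolding dsum_def by (intro sum.cong) (auto simp: xd)
    then show ?thesis using sumz[of b "xop S"] that pS by auto
  qed
  have hG: "ap (hop S) G = scl (ld + of_nat (length S)) G"
    using dist by (auto simp: hop_dg ap_dg G_def dlt_def scl_def fun_eq_iff distinct_card)
  have eq: "ap (euler p S) G = 0" unfolding euler_def using sumz[of p "\<lambda>c. zop (c, p)"] pS ap by auto
  have eqa: "ap (euler a S) G = 0" unfolding euler_def using sumz[of a "\<lambda>c. zop (c, a)"] pS ap by auto
  have Aq: "ap (aop p S) G = 0"
    unfolding aop_def using eq p hG by (simp add: euler_def ap_simps ap_cst_scl scl_add flip: euler_def)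
      (simp add: scl_0 add.assoc[symmetric])
  have "singular a (p # S) n (ap (uop p) G)"
  proof (rule singular_cons[OF dist ap(2) a])
    show "ap (wop c) G = 0" if "c \<notin> set S" for c
      by (rule ext) (use that in \<open>auto simp: G_def ap_wop dlt_def\<close>)
    then show "ap (wop p) G = 0" using pS by auto
    show "ap (dop (p, a)) (ap (aop p S) G) + ap (polar p a S) G = 0"
      using sumz[of a "\<lambda>c. zop (c, p)"] pS by (auto simp: Aq ap_zero polar_def)
    show "ap (dop (p, a)) (ap (dsum p S) G) = ap (dsum a S) G"
      by (simp add: ds ap_zero)
    show "G \<in> fock_space"
      by (rule fock_spaceI[of "{(e0, set S)}"]) (use a in \<open>auto simp: G_def dlt_def e0_def split: if_splits\<close>)
    show "G \<noteq> 0" by (auto simp: G_def dlt_def fun_eq_iff)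
    have "ap (zop (p, a) * dop (p, a)) G = scl (of_nat n) G"
      by (auto simp: zop_dop_dg ap_dg G_def dlt_def scl_def fun_eq_iff e0_def)
    then show "ap (zop (p, a) * dop (p, a) + euler a S) G = scl (of_nat n) G"
      by (simp add: ap_add eqa)
    show "\<forall>c\<in>set S. ap (uop c) G = 0"
      by (intro ballI ext) (auto simp: G_def ap_uop dlt_def)
    show "ap (dop (c, b')) G = 0" if "b' \<notin> insert a (set (p # S))" for b' c
      using that by (intro dop0) auto
  qed (rule hG)
  then show ?thesis by blast
qed

text \<open>A vector singular for the next index \<open>b\<close> is transported to
  \<open>a\<close>, until \<open>p\<close> is reached. \<open>Q\<close> turns bosons (c, b) into
  bosons (c, a), so \<open>V r\<close> has r of them converted and \<open>W j r\<close> has in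
  addition j bosons (b, a). In a combination of the \<open>W j (n - j)\<close>, the first condition
  of \<open>singular_cons\<close> becomes a two-term recursion for the coefficients. The second
  holds because \<open>dsum b S\<close> and \<open>dsum a S\<close> both kill every
  \<open>W j r\<close>.\<close>

lemma singular_exists:
  assumes "sorted_wrt (<) S" "\<forall>c\<in>set S. a < c" "S = S1 @ p # S2" "le p + ld + of_nat (length S2) = 0"
  shows "\<exists>F. singular a S n F"
  using assms
proof (induction S arbitrary: a S1)
  case Nil
  then show ?case by simp
next
  case (Cons b S)
  have dist: "distinct (b # S)" using Cons.prems(1) by (metis strict_sorted_iff)
  show ?case
  proof (cases S1)
    case Nil
    then show ?thesis using Cons.prems dist by (intro singular_base) auto
  next
    case (Cons b' S1')
    then have "S = S1' @ p # S2" using Cons.prems(3) by simp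
    from Cons.IH[OF _ _ this Cons.prems(4), of b] Cons.prems(1)
    obtain F where F: "singular b S n F" by auto
    have ab: "a < b" "a \<noteq> b" "a \<notin> set S" "b \<notin> set S" "a \<notin> set (b # S)" using Cons.prems(2) dist by auto
    define Q where "Q = polar a b S"
    define V where "V r = ap (Q ^ r) F" for r
    define W where "W j r = ap (zop (b, a) ^ j) (V r)" for j r
    \<comment> \<open>The shifted weight of \<open>b\<close>. It is arbitrary here, so
      \<open>al - of_nat l - 1\<close> may vanish and must not appear in a denominator.\<close>
    define al where "al = le b + ld + of_nat (length S)"
    note F' = F[unfolded singular_def]
    have VS: "V (Suc r) = ap Q (V r)" for r by (simp add: V_def ap_mult)
    have cQ: "comm T Q" if "\<And>c. c \<in> set S \<Longrightarrow> comm T (zop (c, a)) \<and> comm T (dop (c, b))" for T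
      unfolding Q_def polar_def by (intro comm_sym[OF comm_sum] comm_comm comm_sym[of T]) (use that in auto)
    have VT: "ap T (V r) = ap (Q ^ r) (ap T F)" if "comm T Q" for T r
      using comm_power[OF comm_sym[OF that], of r] by (simp add: V_def comm_def flip: ap_mult)
    have WT: "ap T (W j r) = ap (zop (b, a) ^ j) (ap T (V r))" if "comm T (zop (b, a))" for T j r
      using comm_power[OF comm_sym[OF that], of j] by (simp add: W_def comm_def flip: ap_mult)
    have x_comm: "comm (xop S c) (zop (d, b))" "comm (xop S c) (dop (d, b))" "comm (xop S c) (zop (d, a))" "comm (xop S c) (dop (d, a))" for c d
      using xop_comm ab by auto
    have F_da: "ap (dop (c, a)) F = 0" for c using F' ab by auto
    interpret ea: extension_step "set S" "\<lambda>j. zop (j, a)" "\<lambda>j. dop (j, a)" "uop a" "wop a" "xop S" "yop S" "hop S" "cst (le a)"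
      using dist ab by (intro step_and_rels) auto
    interpret eb: extension_step "set S" "\<lambda>j. zop (j, b)" "\<lambda>j. dop (j, b)" "uop b" "wop b" "xop S" "yop S" "hop S" "cst (le b)"
      using dist by (rule step_and_rels)
    have ea: "ea.D = dsum a S" "ea.eu = euler a S" and eb: "eb.eu = euler b S"
      by (simp_all add: ea.D_def ea.eu_def eb.eu_def dsum_def euler_def)
    have V_db: "ap (dsum b S) (V r) = 0" for r
      using F' ab unfolding dsum_def
      by (subst VT) (auto simp: ap_zero intro!: cQ comm_sum comm_comm comm_modes x_comm)
    have V_da: "ap (dsum a S) (V r) = 0" for r
    proof (induction r)
      case 0
      have "dop (c, a) * xop S c = xop S c * dop (c, a)" for c
        using x_comm(4) by (simp add: comm_def)
      then show ?case by (simp add: V_def ap_1 dsum_def ap_sum ap_mult F_da ap_zero)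
    next
      case (Suc r)
      have "dsum a S * dop (d, b) = dop (d, b) * dsum a S" for d
        unfolding dsum_def by (fold comm_def) (intro comm_sum comm_comm comm_modes x_comm)
      then have "dsum a S * Q = Q * dsum a S + dsum b S"
        using x_comm(2) unfolding Q_def polar_def dsum_def[of b] sum_distrib_left sum_distrib_right sum.distrib[symmetric]
        by (intro sum.cong) (auto simp: mult_eq_left[OF ea.D_z[unfolded ea]] distrib_right mult.assoc comm_def)
      then show ?case unfolding VS ap_mult[symmetric] by (simp only: ap_add ap_mult Suc V_db ap_zero add_0_right)
    qed
    have V_dba: "ap (dop (b, a)) (V r) = 0" for r
      using F_da ab by (subst VT) (auto simp: ap_zero intro!: cQ comm_modes)
    have V_eub: "r \<le> n \<Longrightarrow> ap (euler b S) (V r) = scl (of_nat n - of_nat r) (V r)" for r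
    proof (induction r)
      case 0
      then show ?case using F' by (simp add: V_def ap_1)
    next
      case (Suc r)
      have z: "euler b S * zop (d, a) = zop (d, a) * euler b S" for d
        unfolding euler_def using ab by (fold comm_def) (intro comm_sum comm_comm comm_modes, auto)
      have "euler b S * Q = Q * euler b S - Q"
        unfolding Q_def polar_def sum_distrib_left sum_distrib_right sum_subtractf[symmetric]
        by (intro sum.cong) (auto simp: eb.eu_d[unfolded eb] mult_eq_left[OF z] right_diff_distrib mult.assoc)
      then show ?case unfolding VS using Suc
        by (simp add: ap_diff flip: ap_mult) (simp add: ap_mult ap_scl, simp add: scl_def fun_eq_iff algebra_simps)
    qed
    have V_eua: "ap (euler a S) (V r) = scl (of_nat r) (V r)" for r
    proof (induction r)
      case 0
      then show ?case by (simp add: V_def ap_1 euler_def ap_sum ap_mult F_da ap_zero scl_0)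
    next
      case (Suc r)
      have "euler a S * dop (d, b) = dop (d, b) * euler a S" for d
        unfolding euler_def using ab by (fold comm_def) (intro comm_sum comm_comm comm_modes, auto)
      then have "euler a S * Q = Q * euler a S + Q"
        unfolding Q_def polar_def sum_distrib_left sum_distrib_right sum.distrib[symmetric]
        by (intro sum.cong) (auto simp: mult_eq_left[OF ea.eu_z[unfolded ea]] distrib_right mult.assoc)
      then show ?case unfolding VS using Suc
        by (simp add: ap_add flip: ap_mult) (simp add: ap_mult ap_scl, simp add: scl_def fun_eq_iff algebra_simps)
    qed
    have V_hop: "ap (hop S) (V r) = scl (ld + of_nat (length S)) (V r)" for r
      using F' ab hop_comm by (subst VT) (auto simp: ap_scl V_def intro!: cQ)
    have V_aop: "r \<le> n \<Longrightarrow> ap (aop b S) (V r) = scl (al - of_nat n + of_nat r) (V r)" for r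
      unfolding aop_def using V_eub[of r] V_hop[of r]
      by (simp add: ap_add ap_diff ap_cst_scl scl_add scl_diff al_def algebra_simps flip: euler_def)
    \<comment> \<open>The lowering coefficients of an sl2-string with n + 1 members. For r = 0 the
      truncated \<open>r - 1\<close> is harmless, as the coefficient is zero.\<close>
    have V_polar: "r \<le> n \<Longrightarrow> ap (polar b a S) (V r) = scl (of_nat r * (of_nat n - of_nat r + 1)) (V (r - 1))" for r
    proof (induction r)
      case 0
      then show ?case by (simp add: V_def ap_1 polar_def ap_sum ap_mult F_da ap_zero scl_0)
    next
      case (Suc r)
      have z: "polar b a S * zop (d, a) = zop (d, a) * polar b a S + zop (d, b)" if "d \<in> set S" for d
        unfolding polar_def sum_distrib_left sum_distrib_right using that
        by (simp add: mult.assoc dop_zop distrib_left mult_if sum.distrib comm_left[OF zop_zop])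
      have d: "polar b a S * dop (d, b) = dop (d, b) * polar b a S - dop (d, a)" if "d \<in> set S" for d
        unfolding polar_def sum_distrib_left sum_distrib_right using that
        by (simp add: mult_eq_left[OF dop_zop] distrib_right if_mult sum.distrib dop_dop mult.assoc comm_left[OF dop_dop])
      have "polar b a S * Q = Q * polar b a S - euler a S + euler b S"
        unfolding Q_def polar_def[of a] euler_def sum_distrib_left sum_distrib_right sum.distrib[symmetric] sum_subtractf[symmetric]
        by (intro sum.cong) (auto simp: mult_eq_left[OF z] d distrib_right right_diff_distrib mult.assoc)
      then have "ap (polar b a S) (V (Suc r)) = ap Q (ap (polar b a S) (V r)) - ap (euler a S) (V r) + ap (euler b S) (V r)"
        unfolding VS by (simp add: ap_simps flip: ap_mult)
      also have "ap Q (ap (polar b a S) (V r)) = scl (of_nat r * (of_nat n - of_nat r + 1)) (V r)"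
        by (subst Suc.IH, use Suc.prems in simp, unfold ap_scl, cases r, simp_all add: scl_0 VS)
      finally show ?case
        using Suc.prems by (simp add: V_eua V_eub) (simp add: scl_def fun_eq_iff algebra_simps)
    qed
    \<comment> \<open>\<open>co j\<close> solves the two-term recursion that makes the sum over \<open>j\<close> in \<open>F1\<close> telescope.\<close>
    define co where "co j = (\<Prod>l\<in>{j..<n}. - (al - of_nat l - 1) / (of_nat n - of_nat l))" for j
    have co: "co (Suc j) * (al - of_nat j - 1) = - (co j * (of_nat n - of_nat j))" if "j < n" for j
    proof -
      have "(of_nat n :: complex) - of_nat j \<noteq> 0" using that by simp
      then show ?thesis using that by (simp add: co_def prod.atLeast_Suc_lessThan field_simps)
    qed
    define G where "G = (\<Sum>j\<le>n. scl (co j) (W j (n - j)))"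
    have apG: "ap T G = (\<Sum>j\<le>n. scl (co j) (ap T (W j (n - j))))" for T
      by (simp add: G_def ap_sum_right ap_scl)
    have G0: "ap T G = 0" if "\<And>j r. ap T (W j r) = 0" for T
      unfolding apG that by (simp add: scl_zero)
    have Gscl: "ap T G = scl k G" if "\<And>j. j \<le> n \<Longrightarrow> ap T (W j (n - j)) = scl k (W j (n - j))" for T k
      unfolding apG unfolding G_def scl_sum by (rule sum.cong) (simp_all add: that scl_scl mult.commute)
    have polar_comm: "comm (polar b a S) (zop (b, a))"
      unfolding polar_def using ab by (intro comm_sum comm_comm comm_modes) auto
    have euler_comm: "comm (euler a S) (zop (b, a))"
      unfolding euler_def using ab by (intro comm_sum comm_comm comm_modes) auto
    have W_aop: "ap (aop b S) (W j (n - j)) = scl (al - of_nat j) (W j (n - j))" if "j \<le> n" for j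
      by (subst WT) (use aop_comm[OF ab(5), of _ b] that V_aop[of "n - j"] in \<open>simp_all add: ap_scl of_nat_diff W_def\<close>)
    have W_dop: "ap (dop (b, a)) (W j r) = scl (of_nat j) (W (j - 1) r)" for j r
      unfolding W_def ap_mult[symmetric] dop_zop_power
      by (simp only: ap_add ap_mult V_dba ap_zero of_nat_cst ap_cst_scl add_0_left)
    have W_polar: "ap (polar b a S) (W j (n - j)) = scl (of_nat (n - j) * (of_nat j + 1)) (W j (n - j - 1))" if "j \<le> n" for j
      by (subst WT[OF polar_comm]) (use that V_polar[of "n - j"] in \<open>simp add: ap_scl of_nat_diff W_def\<close>)
    have W_dsum: "ap (dsum b S) (W j r) = 0" "ap (dsum a S) (W j r) = 0" for j r
    proof -
      have "comm (dsum b S) (zop (b, a))" "comm (dsum a S) (zop (b, a))"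
        unfolding dsum_def using ab by (auto intro!: comm_sum comm_comm comm_modes x_comm)
      then show "ap (dsum b S) (W j r) = 0" "ap (dsum a S) (W j r) = 0"
        by (simp_all only: WT V_db V_da ap_zero)
    qed
    have W0: "ap T (W j r) = 0" if "ap T F = 0" "comm T (zop (b, a))"
      "\<And>d. d \<in> set S \<Longrightarrow> comm T (zop (d, a)) \<and> comm T (dop (d, b))" for T j r
      by (simp only: WT[OF that(2)] VT[OF cQ[OF that(3)]] that(1) ap_zero)
    have F1: "ap (dop (b, a)) (ap (aop b S) G) + ap (polar b a S) G = 0"
    proof -
      \<comment> \<open>Both \<open>T (Suc j)\<close> and \<open>U j\<close> are multiples of
        \<open>W j (n - j - 1)\<close>. The boundary terms \<open>T 0\<close> and \<open>U n\<close>
        vanish through their factors j and n - j.\<close>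
      define T where "T j = scl (co j * (al - of_nat j) * of_nat j) (W (j - 1) (n - j))" for j
      define U where "U j = scl (co j * (of_nat n - of_nat j) * (of_nat j + 1)) (W j (n - j - 1))" for j
      have "ap (dop (b, a)) (ap (aop b S) G) = (\<Sum>j\<le>n. T j)"
        unfolding apG ap_sum_right
        by (rule sum.cong) (auto simp: W_aop W_dop ap_scl scl_scl T_def mult.assoc)
      moreover have "ap (polar b a S) G = (\<Sum>j\<le>n. U j)"
        unfolding apG by (rule sum.cong) (auto simp: W_polar scl_scl U_def of_nat_diff mult.assoc)
      moreover have "(\<Sum>j\<le>n. T j) = T 0 + (\<Sum>j<n. T (Suc j))" by (rule sum.atMost_shift)
      moreover have "(\<Sum>j\<le>n. U j) = (\<Sum>j<n. U j) + U n"
        by (simp only: sum.lessThan_Suc lessThan_Suc_atMost[symmetric])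
      moreover have "T 0 = 0" "U n = 0" by (simp_all add: T_def U_def scl_0)
      moreover have "T (Suc j) = - U j" if "j < n" for j
      proof -
        have "co (Suc j) * (al - of_nat (Suc j)) * of_nat (Suc j) = - (co j * (of_nat n - of_nat j) * (of_nat j + 1))"
        proof -
          have "al - of_nat (Suc j) = al - of_nat j - 1" by simp
          then have "co (Suc j) * (al - of_nat (Suc j)) = - (co j * (of_nat n - of_nat j))"
            using co[OF that] by (simp only:)
          then show ?thesis by (simp add: add.commute)
        qed
        then show ?thesis unfolding T_def U_def scl_uminus by simp
      qed
      then have "(\<Sum>j<n. T (Suc j)) = - (\<Sum>j<n. U j)" by (simp add: sum_negf)
      ultimately show ?thesis by simp
    qed
    have D0: "ap (dop (b, a) ^ m) (W j r) = 0" if "j < m" for m j r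
      using that
    proof (induction m arbitrary: j)
      case (Suc m)
      have "ap (dop (b, a) ^ Suc m) (W j r) = scl (of_nat j) (ap (dop (b, a) ^ m) (W (j - 1) r))"
        by (simp add: power_Suc2 ap_mult W_dop ap_scl del: power_Suc)
      moreover have "scl (of_nat j) (ap (dop (b, a) ^ m) (W (j - 1) r)) = 0"
      proof (cases j)
        case (Suc k)
        then have "ap (dop (b, a) ^ m) (W (j - 1) r) = 0" using Suc.IH Suc.prems by (intro Suc.IH) simp
        then show ?thesis by (simp only: scl_zero)
      qed (simp only: of_nat_0 scl_0)
      ultimately show ?case by (simp only:)
    qed simp
    have Dn: "ap (dop (b, a) ^ m) (W m r) = scl (fact m) (V r)" for m r
    proof (induction m)
      case 0
      then show ?case by (simp add: W_def ap_1 scl_1)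
    next
      case (Suc m)
      then show ?case by (simp add: power_Suc2 ap_mult W_dop ap_scl scl_scl del: power_Suc)
    qed
    have Sa: "a < c" if "c \<in> set (b # S)" for c using that Cons.prems(2) by auto
    have presQ: "pres Q" unfolding Q_def polar_def using Sa by (intro pres_intros) auto
    have "singular a (b # S) n (ap (uop b) G)"
    proof (rule singular_cons[OF dist ab(5) Cons.prems(2)])
      show wc: "ap (wop c) G = 0" if "c \<notin> set S" for c
        using F' that by (intro G0 W0 comm_odd_even_modes conjI) auto
      then show "ap (wop b) G = 0" using ab by auto
      show "ap (dop (b, a)) (ap (aop b S) G) + ap (polar b a S) G = 0" by (rule F1)
      show "ap (dop (b, a)) (ap (dsum b S) G) = ap (dsum a S) G"
        using G0[OF W_dsum(1)] G0[OF W_dsum(2)] by (simp only: ap_zero)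
      have "pres (\<Sum>j\<le>n. cst (co j) * (zop (b, a) ^ j * Q ^ (n - j)))"
        using ab presQ by (intro pres_intros pres_power)
      moreover have "G = ap (\<Sum>j\<le>n. cst (co j) * (zop (b, a) ^ j * Q ^ (n - j))) F"
        by (simp add: G_def W_def V_def ap_sum ap_mult ap_cst_scl)
      ultimately show "G \<in> fock_space" using F' unfolding pres_def by blast
      \<comment> \<open>The product defining \<open>co\<close> runs upwards to n, so
        \<open>co n = 1\<close> for every value of \<open>al\<close>. Removing n bosons (b, a) kills
        all terms with j < n and leaves n! times \<open>F\<close>.\<close>
      show "G \<noteq> 0"
      proof
        assume "G = 0"
        then have "0 = ap (dop (b, a) ^ n) G" by (simp only: ap_zero)
        also have "\<dots> = (\<Sum>j\<le>n. if j = n then scl (fact n) F else 0)"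
          unfolding apG by (rule sum.cong) (auto simp: D0 Dn scl_zero co_def scl_1 V_def ap_1)
        finally have "scl (fact n) F = 0" by simp
        then show False using F' by (auto simp: scl_def fun_eq_iff)
      qed
      show "ap (zop (b, a) * dop (b, a) + euler a S) G = scl (of_nat n) G"
      proof (rule Gscl)
        fix j assume j: "j \<le> n"
        have "ap (zop (b, a) * dop (b, a)) (W j (n - j)) = scl (of_nat j) (W j (n - j))"
          unfolding ap_mult W_dop ap_scl by (cases j) (simp_all add: scl_0 W_def ap_mult)
        moreover have "ap (euler a S) (W j (n - j)) = scl (of_nat (n - j)) (W j (n - j))"
          unfolding WT[OF euler_comm] V_eua by (simp add: ap_scl W_def)
        ultimately show "ap (zop (b, a) * dop (b, a) + euler a S) (W j (n - j)) = scl (of_nat n) (W j (n - j))"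
          using j by (simp add: ap_add scl_add of_nat_diff)
      qed
      show "ap (hop S) G = scl (ld + of_nat (length S)) G"
      proof (rule Gscl)
        fix j show "ap (hop S) (W j (n - j)) = scl (ld + of_nat (length S)) (W j (n - j))"
          using hop_comm[OF ab(3), of b] by (subst WT) (auto simp: V_hop ap_scl W_def)
      qed
      show "\<forall>c\<in>set S. ap (uop c) G = 0"
        using F' by (intro ballI G0 W0 comm_odd_even_modes conjI) auto
      show "ap (dop (c, b')) G = 0" if "b' \<notin> insert a (set (b # S))" for b' c
        using F' that by (intro G0 W0 comm_modes conjI) auto
    qed
    then show ?thesis by blast
  qed
qed

end

lemma sum_fun_apply: "(\<Sum>c\<in>X. f c) e = (\<Sum>c\<in>X. f c e)" for f :: "'b \<Rightarrow> 'c \<Rightarrow> complex"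
  by (induction X rule: infinite_finite_induct) auto

context gl_weight
begin

text \<open>Covers the case p = i, where the degree is 0: no bosons, and all fermions of
  \<open>S\<close> occupied.\<close>

lemma singular_zero:
  assumes dist: "distinct (a # S)"
  shows "singular a S 0 (dlt (\<lambda>_. 0, set S))"
proof -
  let ?G = "dlt (\<lambda>_. 0, set S)"
  have d: "ap (dop q) ?G = 0" for q
    by (cases q) (auto simp: dlt_def ap_dop fun_eq_iff)
  have x: "dop (c, a) * xop S c = xop S c * dop (c, a)" for c
    using xop_comm[of a S c c] dist by (simp add: comm_def)
  have "?G \<in> fock_space" by (rule fock_spaceI[of "{(\<lambda>_. 0, set S)}"]) (auto simp: dlt_def split: if_splits)
  moreover have "?G \<noteq> 0" by (auto simp: dlt_def fun_eq_iff)
  moreover have "ap (dsum a S) ?G = 0" "ap (euler a S) ?G = scl (of_nat 0) ?G"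
    by (simp_all add: dsum_def euler_def x ap_sum ap_mult d ap_zero scl_0)
  moreover have "ap (hop S) ?G = scl (ld + of_nat (length S)) ?G"
    using dist by (auto simp: hop_dg ap_dg dlt_def scl_def fun_eq_iff distinct_card)
  moreover have "ap (uop c) ?G = 0" if "c \<in> set S" for c
    by (rule ext) (use that in \<open>auto simp: ap_uop dlt_def\<close>)
  moreover have "ap (wop c) ?G = 0" if "c \<notin> set S" for c
    by (rule ext) (use that in \<open>auto simp: ap_wop dlt_def\<close>)
  ultimately show ?thesis unfolding singular_def using d by blast
qed

text \<open>Every term of \<open>xop S k\<close> contains a \<open>wop c\<close> with c in
  \<open>S\<close>, whose output vanishes wherever c is occupied, and the factors to the left of it
  do not change the occupied set.\<close>

lemma xop_top: "distinct S \<Longrightarrow> k \<in> set S \<Longrightarrow> set S \<subseteq> J \<Longrightarrow> ap (xop S k) r (e, J) = 0"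
proof (induction S arbitrary: k r e)
  case (Cons a S)
  have w: "ap (wop a) r (e', J) = 0" for e' using Cons.prems by (simp add: ap_wop)
  show ?case
  proof (cases "k = a")
    case True
    have "ap (aop a S) (ap (wop a) r) (e, J) = 0"
      using Cons.prems(1) by (simp add: aop_dg ap_dg w)
    moreover have "ap (dop (c, a)) (ap (xop S c) r) (e, J) = 0" if "c \<in> set S" for c
      using Cons that by (simp add: ap_dop)
    ultimately show ?thesis
      unfolding True xop_head by (simp add: ap_simps ap_sum sum_fun_apply)
  next
    case False
    then show ?thesis using Cons by (simp add: ap_simps ap_zop w)
  qed
qed simp

text \<open>The image is tested at one configuration where \<open>F\<close> is nonzero. All fermions
  of \<open>S\<close> are occupied there, so the part \<open>dsum i S\<close> contributes nothing;
  the eigenvalue of \<open>aop i S\<close> is zero; and without bosons (i, a) for a in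
  \<open>R\<close> the remaining terms vanish too.\<close>

lemma xop_not_exact:
  assumes dist: "distinct (R @ i # S)" and n: "le i + ld + of_nat (length S) = of_nat n" and F: "singular i S n F"
  shows "ap (xop (R @ i # S) i) F = 0" "F \<noteq> ap (xop (R @ i # S) i) r"
proof -
  note F' = F[unfolded singular_def]
  have x: "xop (R @ i # S) i = aop i S * wop i - dsum i S + (\<Sum>a\<in>set R. zop (i, a) * wop a)"
    unfolding xop_append[OF dist] xop_head dsum_def ..
  have iR: "i \<notin> set S" "\<And>a. a \<in> set R \<Longrightarrow> a \<notin> insert i (set S)" using dist by auto
  show "ap (xop (R @ i # S) i) F = 0"
    unfolding x using F' iR by (simp add: ap_simps ap_sum ap_zero)
  have aF: "ap (aop i S) F = 0"
    unfolding aop_def using F' n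
    by (simp add: ap_simps ap_cst_scl scl_add scl_diff flip: euler_def) (simp add: scl_0 algebra_simps)
  obtain e J where FeJ: "F (e, J) \<noteq> 0" using F' by (auto simp: fun_eq_iff)
  have J: "set S \<subseteq> J"
  proof
    fix c assume "c \<in> set S"
    then have "ap (uop c) F (e, insert c J) = 0" using F' by simp
    then show "c \<in> J" using FeJ by (cases "c \<in> J") (auto simp: ap_uop sg_def)
  qed
  have e: "e (i, a) = 0" if "a \<in> set R" for a
  proof (rule ccontr)
    assume "e (i, a) \<noteq> 0"
    moreover have "ap (dop (i, a)) F (e((i, a) := e (i, a) - 1), J) = 0" using F' iR(2)[OF that] by simp
    ultimately show False using FeJ by (auto simp: ap_dop simp flip: of_nat_Suc)
  qed
  define k where "k c = le i - (\<Sum>k\<in>set S. of_nat (fst c (k, i))) + (ld + of_nat (card (snd c \<inter> set S)))" for c :: "'m conf"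
  have ak: "aop i S = dg k" using dist by (simp add: aop_dg k_def[abs_def])
  have k0: "k (e, J) = 0" using aF FeJ unfolding ak by (auto simp: ap_dg fun_eq_iff)
  have "ap (xop (R @ i # S) i) r (e, J) = 0"
    unfolding x using k0 e
    by (simp add: ap_simps ap_sum sum_fun_apply ak ap_dg dsum_def ap_dop ap_zop)
      (use dist J in \<open>simp add: xop_top\<close>)
  then show "F \<noteq> ap (xop (R @ i # S) i) r" using FeJ by auto
qed

lemma typical_iff: "typical S \<longleftrightarrow> (\<forall>S1 p S2. S = S1 @ p # S2 \<longrightarrow> le p + ld + of_nat (length S2) \<noteq> 0)"
proof (induction S)
  case (Cons a S)
  show ?case unfolding typical.simps Cons
    by (auto simp: Cons_eq_append_conv)
qed simp

lemma xop_exact_iff: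
  assumes sorted: "sorted_wrt (<) (R @ i # S)"
  shows "(\<forall>f\<in>fock_space. ap (xop (R @ i # S) i) f = 0 \<longrightarrow> (\<exists>g\<in>fock_space. f = ap (xop (R @ i # S) i) g)) \<longleftrightarrow>
    typical (i # S) \<or> le i + ld + of_nat (length S) \<notin> \<nat>"
proof
  assume ex: "\<forall>f\<in>fock_space. ap (xop (R @ i # S) i) f = 0 \<longrightarrow> (\<exists>g\<in>fock_space. f = ap (xop (R @ i # S) i) g)"
  show "typical (i # S) \<or> le i + ld + of_nat (length S) \<notin> \<nat>"
  proof (rule ccontr)
    assume "\<not> ?thesis"
    then have nt: "\<not> typical (i # S)" and "le i + ld + of_nat (length S) \<in> \<nat>" by auto
    then obtain n where n: "le i + ld + of_nat (length S) = of_nat n" by (auto elim: Nats_cases)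
    have dist: "distinct (R @ i # S)" using sorted by (metis strict_sorted_iff)
    have s: "sorted_wrt (<) S" "\<forall>c\<in>set S. i < c" using sorted by (auto simp: sorted_wrt_append)
    \<comment> \<open>If the failure of \<open>typical\<close> is at \<open>i\<close> itself, then n
      = 0; otherwise it is at an index of \<open>S\<close>, from which a vector is
      transported.\<close>
    have "\<exists>F. singular i S n F"
    proof (cases "le i + ld + of_nat (length S) = 0")
      case True
      then show ?thesis using n dist singular_zero[of i S] by auto
    next
      case False
      then obtain S1 p S2 where "S = S1 @ p # S2" "le p + ld + of_nat (length S2) = 0"
        using nt by (auto simp: typical_iff[of S])
      then show ?thesis using singular_exists s by blast
    qed
    then obtain F where "singular i S n F" by blast
    with xop_not_exact[OF dist n this] ex show False unfolding singular_def by blast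
  qed
qed (use xop_exact[OF sorted] in blast)

end

section \<open>Free and enveloping algebras\<close>

lemma poly_mapping_add_induct [case_names zero single add]:
  fixes f :: "'a \<Rightarrow>\<^sub>0 'b::comm_monoid_add"
  assumes "P 0" "\<And>w c. P (Poly_Mapping.single w c)" "\<And>f g. P f \<Longrightarrow> P g \<Longrightarrow> P (f + g)"
  shows "P f"
proof (induction f rule: update_induct)
  case (update f a b)
  have "Poly_Mapping.update a b f = Poly_Mapping.single a b + f"
    using update.hyps by (intro poly_mapping_eqI) (auto simp: lookup_update lookup_add lookup_single in_keys_iff when_def)
  then show ?case using assms(2,3) update by simp
qed (rule assms(1))

text \<open>Evaluation of noncommutative polynomials, with \<open>s\<close> mapping scalars into the
  centre. It serves three targets: the complex numbers for the character of the Borel subalgebra,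
  the operators for representations, and the free algebra itself for conjugation.\<close>

definition ev :: "(complex \<Rightarrow> 'r::ring_1) \<Rightarrow> ('x \<Rightarrow> 'r) \<Rightarrow> ('x list \<Rightarrow>\<^sub>0 complex) \<Rightarrow> 'r" where
  "ev s r f = (\<Sum>w\<in>Poly_Mapping.keys f. s (Poly_Mapping.lookup f w) * prod_list (map r w))"

locale central_hom =
  fixes s :: "complex \<Rightarrow> 'r::ring_1"
  assumes s_add: "s (a + b) = s a + s b" and s_mult: "s (a * b) = s a * s b" and s_1: "s 1 = 1"
    and s_central: "s a * t = t * s a"
begin

lemma s_0: "s 0 = 0" using s_add[of 0 0] by simp

lemma ev_add: "ev s r (f + g) = ev s r f + ev s r g"
  unfolding ev_def by (rule setsum_keys_plus_distrib) (simp_all add: s_0 s_add distrib_right)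

lemma ev_0: "ev s r 0 = 0" by (simp add: ev_def)

lemma ev_diff: "ev s r (f - g) = ev s r f - ev s r g"
  using ev_add[of r "f - g" g] by (simp add: algebra_simps)

lemma ev_neg: "ev s r (- g) = - ev s r g"
  using ev_diff[of r 0 g] by (simp add: ev_0)

lemma ev_single: "ev s r (Poly_Mapping.single w c) = s c * prod_list (map r w)"
  by (simp add: ev_def s_0)

lemma ev_mult: "ev s r (f * g) = ev s r f * ev s r g"
proof (induction f rule: poly_mapping_add_induct)
  case (single w c)
  show ?case
  proof (induction g rule: poly_mapping_add_induct)
    case (single w' c')
    have "s c * prod_list (map r w) * (s c' * prod_list (map r w')) = s c * s c' * (prod_list (map r w) * prod_list (map r w'))"
      by (metis mult.assoc s_central)
    then show ?case by (simp add: mult_single ev_single plus_list_def s_mult)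
  qed (simp_all add: ev_0 ev_add distrib_left)
qed (simp_all add: ev_0 ev_add distrib_right)

lemma ev_gen: "ev s r (gen x) = r x" and ev_scalar: "ev s r (free_scalar c) = s c"
  by (simp_all add: gen_def free_scalar_def ev_single s_1)

lemma ev_1: "ev s r 1 = 1"
  unfolding single_one[symmetric] by (simp add: ev_single zero_list_def s_1)

lemmas ev_simps = ev_add ev_diff ev_neg ev_mult ev_0 ev_1 ev_gen ev_scalar

end

lemma free_scalar_eq: "free_scalar 1 = 1" "free_scalar (c + d) = free_scalar c + free_scalar d"
  "free_scalar (c * d) = free_scalar c * free_scalar d" "free_scalar 0 = 0"
  by (simp_all add: free_scalar_def single_add mult_single plus_list_def, simp flip: zero_list_def)

lemma free_scalar_central: "free_scalar c * f = f * free_scalar c"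
proof (induction f rule: poly_mapping_add_induct)
  case (single w d)
  show ?case by (simp add: free_scalar_def mult_single plus_list_def mult.commute)
qed (simp_all add: algebra_simps)

section \<open>The free algebra as a ring, and its ideals\<close>

lemma carrier_free: "f \<in> carrier (free_algebra L) \<longleftrightarrow> (\<forall>w\<in>Poly_Mapping.keys f. set w \<subseteq> L)"
  and free_simps: "monoid.mult (free_algebra L) = (*)" "monoid.one (free_algebra L) = 1" "ring.zero (free_algebra L) = 0" "ring.add (free_algebra L) = (+)"
  by (simp_all add: free_algebra_def)

lemma carrier_free_neg: "f \<in> carrier (free_algebra L) \<Longrightarrow> - f \<in> carrier (free_algebra L)"
  unfolding carrier_free by (simp add: in_keys_iff)

lemma carrier_free_add: "f \<in> carrier (free_algebra L) \<Longrightarrow> g \<in> carrier (free_algebra L) \<Longrightarrow> f + g \<in> carrier (free_algebra L)"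
  using keys_add[of f g] unfolding carrier_free by blast

lemma carrier_free_diff: "f \<in> carrier (free_algebra L) \<Longrightarrow> g \<in> carrier (free_algebra L) \<Longrightarrow> f - g \<in> carrier (free_algebra L)"
  using carrier_free_add[of f L "- g"] carrier_free_neg[of g] by simp

lemma carrier_free_mult: "f \<in> carrier (free_algebra L) \<Longrightarrow> g \<in> carrier (free_algebra L) \<Longrightarrow> f * g \<in> carrier (free_algebra L)"
  using keys_mult[of f g] unfolding carrier_free plus_list_def by fastforce

lemmas carrier_free_closed = carrier_free_add carrier_free_diff carrier_free_neg carrier_free_mult

lemma carrier_free_gens: "x \<in> L \<Longrightarrow> gen x \<in> carrier (free_algebra L)" "free_scalar c \<in> carrier (free_algebra L)"
  "0 \<in> carrier (free_algebra L)" "1 \<in> carrier (free_algebra L)"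
  unfolding carrier_free by (simp_all add: gen_def free_scalar_def keys_one zero_list_def)

lemma carrier_free_UNIV: "carrier (free_algebra UNIV) = UNIV"
  by (auto simp: carrier_free)

lemma ring_free_algebra: "ring (free_algebra L)"
proof (rule ringI)
  show "abelian_group (free_algebra L)"
    by (rule abelian_groupI) (auto simp: free_simps carrier_free_closed carrier_free_gens add.assoc add.commute
        intro!: bexI[of _ "- x" for x])
  show "Group.monoid (free_algebra L)"
    by (rule monoidI) (auto simp: free_simps carrier_free_closed carrier_free_gens mult.assoc)
qed (simp_all add: free_simps algebra_simps)

lemma free_idealI:
  assumes "K \<subseteq> carrier (free_algebra L)" "0 \<in> K" "\<And>f g. f \<in> K \<Longrightarrow> g \<in> K \<Longrightarrow> f + g \<in> K" "\<And>f. f \<in> K \<Longrightarrow> - f \<in> K"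
    "\<And>f g. f \<in> K \<Longrightarrow> g \<in> carrier (free_algebra L) \<Longrightarrow> g * f \<in> K" "\<And>f g. f \<in> K \<Longrightarrow> g \<in> carrier (free_algebra L) \<Longrightarrow> f * g \<in> K"
  shows "ideal K (free_algebra L)"
proof (rule idealI[OF ring_free_algebra])
  interpret ring "free_algebra L" by (rule ring_free_algebra)
  have neg: "\<ominus>\<^bsub>free_algebra L\<^esub> f = - f" if "f \<in> carrier (free_algebra L)" for f
    using that by (intro minus_equality) (auto simp: free_simps carrier_free_closed)
  show "subgroup K (add_monoid (free_algebra L))"
    using assms(1-4) by (intro add.subgroupI) (auto simp: free_simps neg subset_iff simp flip: a_inv_def)
qed (simp_all add: free_simps assms)

lemma free_coset: "I +>\<^bsub>free_algebra L\<^esub> f = (\<lambda>h. h + f) ` I"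
  by (auto simp: a_r_coset_def' free_simps)

lemma free_ideal_props:
  assumes "ideal I (free_algebra L)"
  shows "0 \<in> I" "f \<in> I \<Longrightarrow> g \<in> I \<Longrightarrow> f + g \<in> I" "f \<in> I \<Longrightarrow> - f \<in> I" "f \<in> I \<Longrightarrow> g \<in> I \<Longrightarrow> f - g \<in> I"
    "f \<in> I \<Longrightarrow> g \<in> carrier (free_algebra L) \<Longrightarrow> g * f \<in> I" "f \<in> I \<Longrightarrow> g \<in> carrier (free_algebra L) \<Longrightarrow> f * g \<in> I"
    "I \<subseteq> carrier (free_algebra L)"
proof -
  interpret ideal I "free_algebra L" by fact
  show 0: "0 \<in> I" using additive_subgroup.zero_closed[OF is_additive_subgroup] by (simp add: free_simps)
  show I: "I \<subseteq> carrier (free_algebra L)" by (rule a_subset)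
  show add: "f + g \<in> I" if "f \<in> I" "g \<in> I" for f g using additive_subgroup.a_closed[OF is_additive_subgroup that] by (simp add: free_simps)
  show l: "g * f \<in> I" if "f \<in> I" "g \<in> carrier (free_algebra L)" for f g using I_l_closed[OF that] by (simp add: free_simps)
  show "f * g \<in> I" if "f \<in> I" "g \<in> carrier (free_algebra L)" for f g using I_r_closed[OF that] by (simp add: free_simps)
  show neg: "- f \<in> I" if "f \<in> I" for f using l[OF that carrier_free_neg[OF carrier_free_gens(4)]] by simp
  show "f - g \<in> I" if "f \<in> I" "g \<in> I" for f g using add[OF that(1) neg[OF that(2)]] by simp
qed

lemma env_ideal_ideal: "env_rels L \<subseteq> carrier (free_algebra L) \<Longrightarrow> ideal (env_ideal L) (free_algebra L)"
  unfolding env_ideal_def by (rule ring.genideal_ideal[OF ring_free_algebra])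

lemma env_rels_ideal: "env_rels L \<subseteq> env_ideal L"
  unfolding env_ideal_def genideal_def by auto

lemma env_ideal_minimal: "ideal K (free_algebra L) \<Longrightarrow> env_rels L \<subseteq> K \<Longrightarrow> env_ideal L \<subseteq> K"
  unfolding env_ideal_def by (rule ring.genideal_minimal[OF ring_free_algebra])

lemma (in central_hom) ev_env_ideal:
  assumes "env_rels L \<subseteq> carrier (free_algebra L)" "\<And>f. f \<in> env_rels L \<Longrightarrow> ev s r f = 0" "f \<in> env_ideal L"
  shows "ev s r f = 0"
proof -
  have "ideal {f \<in> carrier (free_algebra L). ev s r f = 0} (free_algebra L)"
    by (rule free_idealI) (auto simp: ev_simps carrier_free_closed carrier_free_gens)
  from env_ideal_minimal[OF this] assms show ?thesis by auto
qed

lemma env_UNIV: "ideal (env_ideal UNIV) (free_algebra UNIV)"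
  by (rule env_ideal_ideal) (simp add: carrier_free_UNIV)

lemmas env_UNIV_props = free_ideal_props[OF env_UNIV, unfolded carrier_free_UNIV, simplified]

section \<open>Representatives for the enveloping algebra\<close>

definition Ug_class :: "(('m::finite, 'n::finite) gl list \<Rightarrow>\<^sub>0 complex) \<Rightarrow> (('m, 'n) gl list \<Rightarrow>\<^sub>0 complex) set" where
  "Ug_class f = env_ideal UNIV +>\<^bsub>free_algebra UNIV\<^esub> f"

lemma Ug_class_eq: "Ug_class f = Ug_class g \<longleftrightarrow> f - g \<in> env_ideal UNIV"
proof
  assume "Ug_class f = Ug_class g"
  moreover have "f \<in> Ug_class f" unfolding Ug_class_def free_coset using env_UNIV_props(1) by force
  ultimately obtain h where "h \<in> env_ideal UNIV" "f = h + g" unfolding Ug_class_def free_coset by auto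
  then show "f - g \<in> env_ideal UNIV" by simp
next
  assume *: "f - g \<in> env_ideal UNIV"
  have "\<exists>h'\<in>env_ideal UNIV. h + f = h' + g" if "h \<in> env_ideal UNIV" for h
    using env_UNIV_props(2)[OF that *] by (intro bexI) auto
  moreover have "\<exists>h'\<in>env_ideal UNIV. h + g = h' + f" if "h \<in> env_ideal UNIV" for h
    using env_UNIV_props(4)[OF that *] by (intro bexI) auto
  ultimately show "Ug_class f = Ug_class g" unfolding Ug_class_def free_coset by (auto simp: image_iff)
qed

lemma carrier_Ug: "carrier Ug = range Ug_class"
  by (auto simp: env_alg_def FactRing_def A_RCOSETS_def' Ug_class_def carrier_free_UNIV)

lemma Ug_add: "Ug_class f \<oplus>\<^bsub>Ug\<^esub> Ug_class g = Ug_class (f + g)" and Ug_mult: "Ug_class f \<otimes>\<^bsub>Ug\<^esub> Ug_class g = Ug_class (f * g)"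
proof -
  interpret ideal "env_ideal UNIV" "free_algebra UNIV" by (rule env_UNIV)
  show "Ug_class f \<oplus>\<^bsub>Ug\<^esub> Ug_class g = Ug_class (f + g)" "Ug_class f \<otimes>\<^bsub>Ug\<^esub> Ug_class g = Ug_class (f * g)"
    unfolding Ug_class_def env_alg_def
    using ring_hom_add[OF rcos_ring_hom, of f g] ring_hom_mult[OF rcos_ring_hom, of f g]
    by (simp_all add: carrier_free_UNIV free_simps)
qed

section \<open>The Borel subalgebra\<close>

definition munit :: "'m + 'n \<Rightarrow> 'm + 'n \<Rightarrow> ('m::finite, 'n::finite) gl" where
  "munit I J = (\<chi> k l. if k = I \<and> l = J then 1 else 0)"

lemma munit_nth: "munit I J $ k $ l = (if k = I \<and> l = J then 1 else 0)"
  by (simp add: munit_def)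

lemma mat_sum: "(\<Sum>a\<in>A. f a) $ k $ l = (\<Sum>a\<in>A. f a $ k $ l)" for f :: "'x \<Rightarrow> ('m::finite, 'n::finite) gl"
  by (simp add: sum_component)

lemma mat_eqI: "(\<And>k l. A $ k $ l = B $ k $ l) \<Longrightarrow> A = B" for A B :: "('m::finite, 'n::finite) gl"
  by (simp add: vec_eq_iff)

lemma cartan_proj:
  assumes "h \<in> cartan"
  shows "gl_proj False h = h" "gl_proj True h = 0"
proof -
  have "h $ k $ l = 0" if "isl k \<noteq> isl l" for k l
  proof -
    have "k \<noteq> l" using that by auto
    then show ?thesis using assms by (simp add: cartan_def)
  qed
  then show "gl_proj False h = h" "gl_proj True h = 0"
    by (auto simp: gl_proj_def vec_eq_iff)
qed

lemma sbracket_cartan: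
  fixes h :: "('m::finite, 'n::finite) gl"
  assumes h: "h \<in> cartan"
  shows "sbracket h x $ k $ l = (h $ k $ k - h $ l $ l) * x $ k $ l"
proof -
  have 0: "h $ a $ b = (if a = b then h $ a $ a else 0)" for a b using h by (auto simp: cartan_def)
  have 1: "(h ** y) $ k $ l = h $ k $ k * y $ k $ l" for y
    unfolding matrix_matrix_mult_def by (subst 0) (simp add: if_mult)
  have 2: "(y ** h) $ k $ l = h $ l $ l * y $ k $ l" for y :: "('m, 'n) gl"
    unfolding matrix_matrix_mult_def by (subst 0) (simp add: mult_if mult.commute)
  have eq: "sbracket h x = h ** x - x ** h"
    by (simp add: sbracket_def cartan_proj[OF h])
  show ?thesis by (simp add: eq 1 2 left_diff_distrib)
qed

lemma weight_at_diff: "weight_at (axis I 1 - axis J 1) h = h $ I $ I - h $ J $ J"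
proof -
  have "weight_at (axis I 1 - axis J 1) h = (\<Sum>k\<in>UNIV. (if k = I then h $ k $ k else 0) - (if k = J then h $ k $ k else 0))"
    unfolding weight_at_def by (rule sum.cong) (auto simp: axis_def)
  then show ?thesis by (simp add: sum_subtractf)
qed

lemma root_space_axis:
  fixes I J :: "'m::finite + 'n::finite"
  assumes IJ: "I \<noteq> J"
  shows "root_space (axis I 1 - axis J 1) = {x. \<forall>k l. x $ k $ l \<noteq> 0 \<longrightarrow> k = I \<and> l = J}"
proof (rule Set.set_eqI, rule iffI)
  fix x :: "('m, 'n) gl" assume x: "x \<in> root_space (axis I 1 - axis J 1)"
  have "k = I \<and> l = J" if kl: "x $ k $ l \<noteq> 0" for k l
  proof -
    have *: "h $ k $ k - h $ l $ l = h $ I $ I - h $ J $ J" if h: "h \<in> cartan" for h :: "('m, 'n) gl"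
    proof -
      have "sbracket h x = scale_mat (h $ I $ I - h $ J $ J) x"
        using x h unfolding root_space_def weight_at_diff by blast
      then have "sbracket h x $ k $ l = (h $ I $ I - h $ J $ J) * x $ k $ l"
        by (simp add: scale_mat_def)
      then show ?thesis using kl by (simp add: sbracket_cartan[OF h])
    qed
    have u: "munit K K \<in> (cartan :: ('m, 'n) gl set)" for K by (auto simp: cartan_def munit_nth)
    \<comment> \<open>On E_(I,I) the root takes the value 1, and on E_(J,J) the value -1. These two
      values already determine the position (k, l).\<close>
    from *[OF u[of I]] *[OF u[of J]] IJ show ?thesis by (auto simp: munit_nth split: if_splits)
  qed
  then show "x \<in> {x. \<forall>k l. x $ k $ l \<noteq> 0 \<longrightarrow> k = I \<and> l = J}" by blast
next
  fix x :: "('m, 'n) gl" assume x: "x \<in> {x. \<forall>k l. x $ k $ l \<noteq> 0 \<longrightarrow> k = I \<and> l = J}"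
  have "sbracket h x = scale_mat (h $ I $ I - h $ J $ J) x" if "h \<in> cartan" for h
    by (rule mat_eqI) (use x in \<open>auto simp: sbracket_cartan[OF that] scale_mat_def\<close>)
  then show "x \<in> root_space (axis I 1 - axis J 1)"
    unfolding root_space_def weight_at_diff by blast
qed

fun upper :: "'m::linorder + 1 \<Rightarrow> 'm + 1 \<Rightarrow> bool" where
  "upper (Inl i) (Inl j) = (i \<le> j)"
| "upper (Inl i) (Inr j) = True"
| "upper (Inr i) (Inl j) = False"
| "upper (Inr i) (Inr j) = True"

lemma upper_refl: "upper k k" by (cases k) auto
lemma upper_trans: "upper k l \<Longrightarrow> upper l n \<Longrightarrow> upper k n" by (cases k; cases l; cases n) auto
lemma upper_antisym: "upper k l \<Longrightarrow> upper l k \<Longrightarrow> k = l"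
  by (cases k; cases l) (auto intro: trans[OF num1_eq1 num1_eq1[symmetric]])

lemma axis_diff_inj: "axis I (1::complex) - axis J 1 = axis K 1 - axis L 1 \<Longrightarrow> I \<noteq> J \<Longrightarrow> I = K \<and> J = L"
proof -
  assume eq: "axis I (1::complex) - axis J 1 = axis K 1 - axis L 1" and "I \<noteq> J"
  then show ?thesis
  proof -
    have "(if I = m then 1 else 0) - (if J = m then 1 else 0) = (if K = m then 1 else 0) - (if L = m then (1::complex) else 0)" for m
      using arg_cong[OF eq, of "\<lambda>v. v $ m"] by (simp add: axis_def eq_commute)
    from this[of I] this[of J] \<open>I \<noteq> J\<close> show ?thesis by (auto split: if_splits)
  qed
qed

lemma pos_roots_eq: "(even_pos_roots \<union> odd_pos_roots :: ('m::{finite,linorder}, 1) weight set)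
    = {axis k 1 - axis l 1 | k l. upper k l \<and> k \<noteq> l}"
proof (intro Set.set_eqI iffI)
  fix \<alpha> :: "('m, 1) weight" assume "\<alpha> \<in> even_pos_roots \<union> odd_pos_roots"
  then show "\<alpha> \<in> {axis k 1 - axis l 1 | k l. upper k l \<and> k \<noteq> l}"
    unfolding even_pos_roots_def odd_pos_roots_def eps_def del_def by fastforce
next
  fix \<alpha> :: "('m, 1) weight" assume "\<alpha> \<in> {axis k 1 - axis l 1 | k l. upper k l \<and> k \<noteq> l}"
  then obtain k l where "\<alpha> = axis k 1 - axis l 1" "upper k l" "k \<noteq> l" by blast
  moreover have "b = b'" for b b' :: 1 by (metis num1_eq1)
  ultimately consider i j where "\<alpha> = eps i - eps j" "i < j" | i b where "\<alpha> = eps i - del b"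
    unfolding eps_def del_def by (cases k; cases l) (auto simp: order.strict_iff_order)
  then show "\<alpha> \<in> even_pos_roots \<union> odd_pos_roots"
    unfolding even_pos_roots_def odd_pos_roots_def by cases blast+
qed

lemma borel_sub_eq: "(borel_sub :: ('m::{finite,linorder}, 1) gl set) = {A. \<forall>k l. A $ k $ l \<noteq> 0 \<longrightarrow> upper k l}"
proof (intro Set.set_eqI iffI)
  let ?P = "even_pos_roots \<union> odd_pos_roots :: ('m, 1) weight set"
  have fin: "finite ?P"
    unfolding pos_roots_eq by (rule finite_subset[of _ "(\<lambda>(k, l). axis k 1 - axis l 1) ` UNIV"]) auto
  {
    fix A :: "('m, 1) gl" assume "A \<in> borel_sub"
    then obtain h x where A: "A = h + (\<Sum>\<alpha>\<in>?P. x \<alpha>)" and h: "h \<in> cartan" and x: "\<And>\<alpha>. \<alpha> \<in> ?P \<Longrightarrow> x \<alpha> \<in> root_space \<alpha>"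
      unfolding borel_sub_def by blast
    have "upper k l" if "A $ k $ l \<noteq> 0" for k l
    proof (rule ccontr)
      assume nu: "\<not> upper k l"
      then have "k \<noteq> l" using upper_refl by auto
      then have "h $ k $ l = 0" using h by (auto simp: cartan_def)
      moreover have "x \<alpha> $ k $ l = 0" if \<alpha>: "\<alpha> \<in> ?P" for \<alpha>
      proof -
        obtain K L where "\<alpha> = axis K 1 - axis L 1" "upper K L" "K \<noteq> L" using \<alpha> unfolding pos_roots_eq by blast
        then show ?thesis using x[OF \<alpha>] nu root_space_axis[of K L] by auto
      qed
      ultimately show False using that unfolding A by (simp add: mat_sum del: UnE)
    qed
    then show "A \<in> {A. \<forall>k l. A $ k $ l \<noteq> 0 \<longrightarrow> upper k l}" by blast
  next
    fix A :: "('m, 1) gl" assume A: "A \<in> {A. \<forall>k l. A $ k $ l \<noteq> 0 \<longrightarrow> upper k l}"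
    define h :: "('m, 1) gl" where "h = (\<chi> k l. if k = l then A $ k $ l else 0)"
    \<comment> \<open>Each off-diagonal entry is assigned to its own root; by
      \<open>axis_diff_inj\<close> the root determines the position, so no entry is counted
      twice.\<close>
    define x :: "('m, 1) weight \<Rightarrow> ('m, 1) gl" where
      "x \<alpha> = (\<chi> k l. if k \<noteq> l \<and> \<alpha> = axis k 1 - axis l 1 then A $ k $ l else 0)" for \<alpha>
    have "h \<in> cartan" by (auto simp: h_def cartan_def)
    moreover have "x \<alpha> \<in> root_space \<alpha>" if \<alpha>: "\<alpha> \<in> ?P" for \<alpha>
    proof -
      obtain K L where KL: "\<alpha> = axis K 1 - axis L 1" "K \<noteq> L" using \<alpha> unfolding pos_roots_eq by blast
      show ?thesis
        unfolding KL(1) root_space_axis[OF KL(2)] using axis_diff_inj[of K L] KL(2)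
        by (auto simp: x_def split: if_splits)
    qed
    moreover have "A = h + (\<Sum>\<alpha>\<in>?P. x \<alpha>)"
    proof (rule mat_eqI)
      fix k l
      show "A $ k $ l = (h + (\<Sum>\<alpha>\<in>?P. x \<alpha>)) $ k $ l"
      proof (cases "k = l")
        case True
        then show ?thesis by (simp add: h_def mat_sum x_def)
      next
        case False
        have "(\<Sum>\<alpha>\<in>?P. x \<alpha>) $ k $ l = (\<Sum>\<alpha>\<in>?P. if \<alpha> = axis k 1 - axis l 1 then A $ k $ l else 0)"
          using False by (simp add: mat_sum x_def)
        also have "\<dots> = (if axis k 1 - axis l 1 \<in> ?P then A $ k $ l else 0)"
          using fin by (rule sum.delta)
        also have "\<dots> = A $ k $ l"
          using A False unfolding pos_roots_eq by auto
        finally show ?thesis using False by (simp add: h_def)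
      qed
    qed
    ultimately show "A \<in> borel_sub" unfolding borel_sub_def by blast
  }
qed

lemma root_vector_eq:
  fixes i :: "'m::{finite,linorder}"
  obtains c where "c \<noteq> 0" "root_vector (eps i - del 1 :: ('m, 1) weight) = scale_mat c (munit (Inl i) (Inr 1))"
proof -
  let ?\<alpha> = "eps i - del 1 :: ('m, 1) weight"
  have restrict_conf: "root_space ?\<alpha> = {x. \<forall>k l. x $ k $ l \<noteq> 0 \<longrightarrow> k = Inl i \<and> l = Inr 1}"
    unfolding eps_def del_def by (rule root_space_axis) simp
  have "munit (Inl i) (Inr 1) \<in> root_space ?\<alpha> \<and> munit (Inl i) (Inr 1) \<noteq> (0 :: ('m, 1) gl)"
    unfolding restrict_conf by (auto simp: munit_nth vec_eq_iff split: if_splits)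
  then have *: "root_vector ?\<alpha> \<in> root_space ?\<alpha> \<and> root_vector ?\<alpha> \<noteq> 0"
    unfolding root_vector_def by (rule someI)
  then have eq: "root_vector ?\<alpha> = scale_mat (root_vector ?\<alpha> $ Inl i $ Inr 1) (munit (Inl i) (Inr 1))"
    unfolding restrict_conf by (intro mat_eqI) (auto simp: scale_mat_def munit_nth)
  moreover have "root_vector ?\<alpha> $ Inl i $ Inr 1 \<noteq> 0"
  proof
    assume "root_vector ?\<alpha> $ Inl i $ Inr 1 = 0"
    then have "root_vector ?\<alpha> = 0" by (subst eq) (simp add: scale_mat_def vec_eq_iff)
    then show False using * by blast
  qed
  ultimately show ?thesis using that by blast
qed

lemma borel_add: "A \<in> borel_sub \<Longrightarrow> B \<in> borel_sub \<Longrightarrow> A + B \<in> (borel_sub :: ('m::{finite,linorder}, 1) gl set)"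
  and borel_diff: "A \<in> borel_sub \<Longrightarrow> B \<in> borel_sub \<Longrightarrow> A - B \<in> (borel_sub :: ('m::{finite,linorder}, 1) gl set)"
  unfolding borel_sub_eq by force+

lemma borel_mult: 
  fixes A B :: "('m::{finite,linorder}, 1) gl"
  assumes "A \<in> borel_sub" "B \<in> borel_sub"
  shows "A ** B \<in> borel_sub"
  unfolding borel_sub_eq
proof (intro CollectI allI impI)
  fix k l assume "(A ** B) $ k $ l \<noteq> 0"
  then obtain j where "A $ k $ j * B $ j $ l \<noteq> 0"
    unfolding matrix_matrix_mult_def by (auto elim: sum.not_neutral_contains_not_neutral)
  then show "upper k l" using assms unfolding borel_sub_eq by simp (blast intro: upper_trans)
qed

lemma borel_proj: "A \<in> borel_sub \<Longrightarrow> gl_proj a A \<in> (borel_sub :: ('m::{finite,linorder}, 1) gl set)"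
  and borel_scale: "A \<in> borel_sub \<Longrightarrow> scale_mat c A \<in> (borel_sub :: ('m::{finite,linorder}, 1) gl set)"
  unfolding borel_sub_eq by (auto simp: gl_proj_def scale_mat_def)

lemma borel_sbracket:
  "A \<in> borel_sub \<Longrightarrow> B \<in> borel_sub \<Longrightarrow> sbracket A B \<in> (borel_sub :: ('m::{finite,linorder}, 1) gl set)"
  unfolding sbracket_def by (intro borel_add borel_diff borel_mult borel_proj)

lemmas borel_closed = borel_add borel_diff borel_mult borel_proj borel_scale borel_sbracket

lemma borel_diag_mult:
  fixes A B :: "('m::{finite,linorder}, 1) gl"
  assumes "A \<in> borel_sub" "B \<in> borel_sub"
  shows "(A ** B) $ k $ k = A $ k $ k * B $ k $ k"
proof -
  have "A $ k $ j * B $ j $ k = (if j = k then A $ k $ k * B $ k $ k else 0)" for j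
    using assms upper_antisym[of k j] unfolding borel_sub_eq by auto
  then have "(A ** B) $ k $ k = (\<Sum>j\<in>UNIV. if j = k then A $ k $ k * B $ k $ k else 0)"
    unfolding matrix_matrix_mult_def vec_lambda_beta by (intro sum.cong) auto
  then show ?thesis by simp
qed

lemma sbracket_diag:
  fixes A B :: "('m::{finite,linorder}, 1) gl"
  assumes "A \<in> borel_sub" "B \<in> borel_sub"
  shows "sbracket A B $ k $ k = 0"
  using assms by (simp add: sbracket_def borel_diag_mult borel_closed) (simp add: gl_proj_def)

lemma weight_at_add: "weight_at \<alpha> (A + B) = weight_at \<alpha> A + weight_at \<alpha> B"
  and weight_at_scale: "weight_at \<alpha> (scale_mat c A) = c * weight_at \<alpha> A"
  by (simp_all add: weight_at_def scale_mat_def distrib_left sum.distrib sum_distrib_left mult.left_commute)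

lemma weight_at_odd: "A \<in> gl_part True \<Longrightarrow> weight_at \<alpha> A = 0"
  unfolding weight_at_def gl_part_def by (intro sum.neutral) auto

lemma borel_rels: "env_rels (borel_sub :: ('m::{finite,linorder}, 1) gl set) \<subseteq> carrier (free_algebra borel_sub)"
proof -
  have sign: "(if p then - 1 else 1) \<in> carrier (free_algebra (borel_sub :: ('m, 1) gl set))" for p
    using carrier_free_neg[OF carrier_free_gens(4)] carrier_free_gens(4) by (cases p) simp_all
  show ?thesis
    unfolding env_rels_def
    apply (intro Un_least subsetI; elim CollectE exE conjE IntE; hypsubst)
      apply (intro carrier_free_closed carrier_free_gens borel_closed sign, assumption+)+
    done
qed

section \<open>The character of the Borel subalgebra and the tensor relations\<close>

interpretation cid: central_hom "\<lambda>c. c" by unfold_locales (simp_all add: algebra_simps)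
interpretation ccst: central_hom cst by unfold_locales (rule cst_add cst_mult cst_1 cst_central)+

text \<open>Two facts make the weight a character: brackets of upper triangular matrices have zero
  diagonal, and odd matrices have no diagonal at all. The latter is needed for two odd elements,
  where the relation is an anticommutator.\<close>

lemma borel_char_rels:
  fixes lam :: "('m::{finite,linorder}, 1) weight"
  assumes "f \<in> env_rels borel_sub"
  shows "ev (\<lambda>c. c) (weight_at lam) f = 0"
proof -
  have 0: "weight_at lam (sbracket A B) = 0" if "A \<in> borel_sub" "B \<in> borel_sub" for A B
    using that unfolding weight_at_def by (simp add: sbracket_diag)
  show ?thesis
    using assms unfolding env_rels_def
    by (elim UnE CollectE exE conjE; hypsubst) (auto simp: cid.ev_simps weight_at_add weight_at_scale 0 weight_at_odd)
qed

lemma env_borel_ideal: "ideal (env_ideal (borel_sub :: ('m::{finite,linorder}, 1) gl set)) (free_algebra borel_sub)"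
  by (rule env_ideal_ideal[OF borel_rels])

lemma env_borel_subset: "env_ideal (borel_sub :: ('m::{finite,linorder}, 1) gl set) \<subseteq> env_ideal UNIV"
proof -
  have "ideal (env_ideal UNIV \<inter> carrier (free_algebra (borel_sub :: ('m, 1) gl set))) (free_algebra borel_sub)"
    by (rule free_idealI) (auto simp: env_UNIV_props carrier_free_closed carrier_free_gens)
  moreover have "env_rels borel_sub \<subseteq> env_ideal UNIV \<inter> carrier (free_algebra (borel_sub :: ('m, 1) gl set))"
  proof -
    have "env_rels borel_sub \<subseteq> env_rels (UNIV :: ('m, 1) gl set)" unfolding env_rels_def by blast
    then show ?thesis using env_rels_ideal borel_rels by blast
  qed
  ultimately show ?thesis using env_ideal_minimal by blast
qed

definition Ub_class :: "(('m::{finite,linorder}, 1) gl list \<Rightarrow>\<^sub>0 complex) \<Rightarrow> (('m, 1) gl list \<Rightarrow>\<^sub>0 complex) set" where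
  "Ub_class f = env_ideal borel_sub +>\<^bsub>free_algebra borel_sub\<^esub> f"

lemma carrier_Ub: "carrier Ub = Ub_class ` carrier (free_algebra borel_sub)"
  by (auto simp: env_alg_def FactRing_def A_RCOSETS_def' Ub_class_def)

text \<open>The relations of the Borel subalgebra hold in the whole enveloping algebra, so all
  representatives have the same image and \<open>the_elem\<close> is applied to a singleton. The
  same scheme serves \<open>borel_char_class\<close>.\<close>

lemma env_incl_class: "env_incl (Ub_class f) = Ug_class f"
proof -
  have "Ug_class (h + f) = Ug_class f" if "h \<in> env_ideal (borel_sub :: ('a, 1) gl set)" for h
    using that env_borel_subset unfolding Ug_class_eq by auto
  moreover have "0 \<in> env_ideal (borel_sub :: ('a, 1) gl set)" by (rule free_ideal_props(1)[OF env_borel_ideal])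
  ultimately have "(\<lambda>g. Ug_class g) ` Ub_class f = {Ug_class f}"
    unfolding Ub_class_def free_coset by force
  then show ?thesis by (simp add: env_incl_def Ug_class_def)
qed

lemma borel_char_class:
  fixes lam :: "('m::{finite,linorder}, 1) weight"
  shows "borel_char lam (Ub_class f) = ev (\<lambda>c. c) (weight_at lam) f"
proof -
  have "ev (\<lambda>c. c) (weight_at lam) (h + f) = ev (\<lambda>c. c) (weight_at lam) f"
    if "h \<in> env_ideal (borel_sub :: ('m, 1) gl set)" for h
    using cid.ev_env_ideal[OF borel_rels borel_char_rels that] by (simp add: cid.ev_simps)
  moreover have "0 \<in> env_ideal (borel_sub :: ('m, 1) gl set)" by (rule free_ideal_props(1)[OF env_borel_ideal])
  ultimately have "ev (\<lambda>c. c) (weight_at lam) ` Ub_class f = {ev (\<lambda>c. c) (weight_at lam) f}"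
    unfolding Ub_class_def free_coset by force
  then show ?thesis by (simp add: borel_char_def ev_def)
qed

lemma verma_rels_cases:
  fixes lam :: "('m::{finite,linorder}, 1) weight"
  assumes "r \<in> verma_rels lam"
  obtains f g z where "r = frag_of (Ug_class (f + g), z) - frag_of (Ug_class f, z) - frag_of (Ug_class g, z)"
    | f z z' where "r = frag_of (Ug_class f, z + z') - frag_of (Ug_class f, z) - frag_of (Ug_class f, z')"
    | f h z where "h \<in> carrier (free_algebra borel_sub)"
        "r = frag_of (Ug_class (f * h), z) - frag_of (Ug_class f, ev (\<lambda>c. c) (weight_at lam) h * z)"
  using assms unfolding verma_rels_def carrier_Ug carrier_Ub
  by (auto simp: Ug_add Ug_mult env_incl_class borel_char_class)

lemma verma_relsI:
  fixes lam :: "('m::{finite,linorder}, 1) weight"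
  shows "frag_of (Ug_class (f + g), z) - frag_of (Ug_class f, z) - frag_of (Ug_class g, z) \<in> verma_rels lam"
    "frag_of (Ug_class f, z + z') - frag_of (Ug_class f, z) - frag_of (Ug_class f, z') \<in> verma_rels lam"
    "h \<in> carrier (free_algebra borel_sub) \<Longrightarrow>
      frag_of (Ug_class (f * h), z) - frag_of (Ug_class f, ev (\<lambda>c. c) (weight_at lam) h * z) \<in> verma_rels lam"
  unfolding verma_rels_def
proof goal_cases
  case 1
  show ?case
    by (intro UnI1 CollectI exI[of _ "Ug_class f"] exI[of _ "Ug_class g"] exI[of _ z]) (simp add: Ug_add carrier_Ug)
next
  case 2
  show ?case
    by (rule UnI1, rule UnI2, rule CollectI, intro exI[of _ "Ug_class f"] exI[of _ z] exI[of _ z']) (simp add: carrier_Ug)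
next
  case 3
  then show ?case
    by (intro UnI2 CollectI exI[of _ "Ug_class f"] exI[of _ "Ub_class h"] exI[of _ z]) (auto simp: carrier_Ug carrier_Ub env_incl_class borel_char_class Ug_mult)
qed

lemma verma_rels_carrier:
  fixes lam :: "('m::{finite,linorder}, 1) weight"
  shows "verma_rels lam \<subseteq> carrier verma_free"
proof
  fix r assume r: "r \<in> verma_rels lam"
  have sub: "Poly_Mapping.keys (a - b) \<subseteq> S" if "Poly_Mapping.keys a \<subseteq> S" "Poly_Mapping.keys b \<subseteq> S"
    for a b :: "((('m, 1) gl list \<Rightarrow>\<^sub>0 complex) set \<times> complex) \<Rightarrow>\<^sub>0 int" and S
    using that keys_diff[of a b] by blast
  have one: "Poly_Mapping.keys (frag_of (Ug_class f, z)) \<subseteq> range Ug_class \<times> UNIV" for f :: "('m, 1) gl list \<Rightarrow>\<^sub>0 complex" and z :: complex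
    by (simp add: keys_frag_of)
  show "r \<in> carrier verma_free"
    unfolding verma_free_def carrier_free_Abelian_group_iff carrier_Ug
    using r by (cases rule: verma_rels_cases) (simp only:, intro sub one)+
qed

lemma verma_sub_props:
  fixes lam :: "('m::{finite,linorder}, 1) weight"
  shows "0 \<in> verma_sub lam" "c \<in> verma_sub lam \<Longrightarrow> d \<in> verma_sub lam \<Longrightarrow> c + d \<in> verma_sub lam"
    "c \<in> verma_sub lam \<Longrightarrow> - c \<in> verma_sub lam" "c \<in> verma_sub lam \<Longrightarrow> d \<in> verma_sub lam \<Longrightarrow> c - d \<in> verma_sub lam"
    "verma_sub lam \<subseteq> carrier verma_free" "verma_rels lam \<subseteq> verma_sub lam"
proof -
  interpret group "verma_free :: (((('m, 1) gl list \<Rightarrow>\<^sub>0 complex) set \<times> complex) \<Rightarrow>\<^sub>0 int) monoid"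
    by (simp add: verma_free_def)
  have sub: "subgroup (verma_sub lam) verma_free"
    unfolding verma_sub_def by (rule generate_is_subgroup[OF verma_rels_carrier])
  show c: "verma_sub lam \<subseteq> carrier verma_free" using subgroup.subset[OF sub] .
  show "0 \<in> verma_sub lam" using subgroup.one_closed[OF sub] by (simp add: verma_free_def)
  show add: "c + d \<in> verma_sub lam" if "c \<in> verma_sub lam" "d \<in> verma_sub lam" for c d
    using subgroup.m_closed[OF sub that] by (simp add: verma_free_def)
  show neg: "- c \<in> verma_sub lam" if "c \<in> verma_sub lam" for c
    using subgroup.m_inv_closed[OF sub that] c that by (simp add: verma_free_def subset_iff)
  show "c - d \<in> verma_sub lam" if "c \<in> verma_sub lam" "d \<in> verma_sub lam" for c d
    using add[OF that(1) neg[OF that(2)]] by simp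
  show "verma_rels lam \<subseteq> verma_sub lam"
    unfolding verma_sub_def by (auto intro: generate.incl)
qed

lemma verma_sub_induct [consumes 1, case_names zero rel diff]:
  fixes lam :: "('m::{finite,linorder}, 1) weight"
  assumes "c \<in> verma_sub lam" "P 0" "\<And>r. r \<in> verma_rels lam \<Longrightarrow> P r" "\<And>c d. P c \<Longrightarrow> P d \<Longrightarrow> P (c - d)"
  shows "P c"
proof -
  have add: "P (c + d)" if "P c" "P d" for c d
    using assms(4)[OF that(1) assms(4)[OF assms(2) that(2)]] by simp
  show ?thesis
    using assms(1) unfolding verma_sub_def
  proof (induction rule: generate.induct)
    case one
    then show ?case by (simp add: verma_free_def assms(2))
  next
    case (inv h)
    then have "h \<in> carrier verma_free" using verma_rels_carrier by blast
    then have "inv\<^bsub>verma_free\<^esub> h = - h" by (simp add: verma_free_def)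
    then show ?case using assms(4)[OF assms(2) assms(3)[OF inv]] by simp
  next
    case (eng h1 h2)
    then show ?case using add by (simp add: verma_free_def)
  qed (rule assms(3))
qed

section \<open>The annihilator of the highest weight vector\<close>

text \<open>
  The left ideal of elements of the free algebra that annihilate \<open>1 \<otimes> 1\<close>; the Verma module is the
  quotient of the free algebra by it.
\<close>

definition hw_annihilator :: "('m::{finite,linorder}, 1) weight \<Rightarrow> (('m, 1) gl list \<Rightarrow>\<^sub>0 complex) set" where
  "hw_annihilator lam = {f. frag_of (Ug_class f, 1) \<in> verma_sub lam}"

context
  fixes lam :: "('m::{finite,linorder}, 1) weight"
begin

abbreviation (input) "N \<equiv> verma_sub lam"

lemma N_rel1: "frag_of (Ug_class (f + g), z) - frag_of (Ug_class f, z) - frag_of (Ug_class g, z) \<in> N"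
  and N_rel3: "h \<in> carrier (free_algebra borel_sub) \<Longrightarrow>
      frag_of (Ug_class (f * h), z) - frag_of (Ug_class f, ev (\<lambda>c. c) (weight_at lam) h * z) \<in> N"
  by (rule subsetD[OF verma_sub_props(6) verma_relsI(1)], rule subsetD[OF verma_sub_props(6) verma_relsI(3)])

lemma annihilator_diff_iff: "frag_of (Ug_class f, 1) - frag_of (Ug_class g, 1) \<in> N \<longleftrightarrow> f - g \<in> hw_annihilator lam"
proof -
  have r: "frag_of (Ug_class f, 1) - frag_of (Ug_class (f - g), 1) - frag_of (Ug_class g, 1) \<in> N"
    using N_rel1[of "f - g" g 1] by simp
  show ?thesis
  proof
    assume "frag_of (Ug_class f, 1) - frag_of (Ug_class g, 1) \<in> N"
    from verma_sub_props(4)[OF this r] show "f - g \<in> hw_annihilator lam" by (simp add: hw_annihilator_def)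
  next
    assume "f - g \<in> hw_annihilator lam"
    then have "frag_of (Ug_class (f - g), 1) \<in> N" by (simp add: hw_annihilator_def)
    from verma_sub_props(2)[OF this r] show "frag_of (Ug_class f, 1) - frag_of (Ug_class g, 1) \<in> N" by simp
  qed
qed

lemma annihilator_0: "0 \<in> hw_annihilator lam"
  using annihilator_diff_iff[of 0 0] verma_sub_props(1)[of lam] by simp

lemma annihilator_diff: "f \<in> hw_annihilator lam \<Longrightarrow> g \<in> hw_annihilator lam \<Longrightarrow> f - g \<in> hw_annihilator lam"
  unfolding annihilator_diff_iff[symmetric] by (simp add: hw_annihilator_def verma_sub_props(4))

lemma annihilator_neg: "f \<in> hw_annihilator lam \<Longrightarrow> - f \<in> hw_annihilator lam"
  using annihilator_diff[OF annihilator_0, of f] by simp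

lemma annihilator_add: "f \<in> hw_annihilator lam \<Longrightarrow> g \<in> hw_annihilator lam \<Longrightarrow> f + g \<in> hw_annihilator lam"
  using annihilator_diff[OF _ annihilator_neg[of g], of f] by simp

text \<open>Scalars belong to the enveloping algebra of the Borel subalgebra, so the second
  component of a tensor moves into the first; every element of the module is thereby represented by
  a single f, with second component 1.\<close>

lemma N_scalar: "frag_of (Ug_class f, z) - frag_of (Ug_class (f * free_scalar z), 1) \<in> N"
  using verma_sub_props(3)[OF N_rel3[OF carrier_free_gens(2)[of z], of f 1]] by (simp add: cid.ev_simps)

lemma env_ideal_annihilator: "f \<in> env_ideal UNIV \<Longrightarrow> f \<in> hw_annihilator lam"
  using annihilator_0 Ug_class_eq[of f 0] by (simp add: hw_annihilator_def)

lemma N_left: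
  assumes "c \<in> N"
  shows "frag_extend (\<lambda>(v, z). frag_of (Ug_class g \<otimes>\<^bsub>Ug\<^esub> v, z)) c \<in> N"
  using assms
proof (induction rule: verma_sub_induct)
  case (rel r)
  then show ?case
  proof (cases rule: verma_rels_cases)
    case (1 f g' z)
    then show ?thesis using N_rel1[of "g * f" "g * g'" z]
      by (simp add: frag_extend_diff frag_extend_of Ug_mult distrib_left)
  next
    case (2 f z z')
    have "frag_of (Ug_class (g * f), z + z') - frag_of (Ug_class (g * f), z) - frag_of (Ug_class (g * f), z') \<in> N"
      by (rule subsetD[OF verma_sub_props(6) verma_relsI(2)])
    then show ?thesis by (simp add: 2 frag_extend_diff frag_extend_of Ug_mult)
  next
    case (3 f h z)
    then show ?thesis using N_rel3[of h "g * f" z]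
      by (simp add: frag_extend_diff frag_extend_of Ug_mult mult.assoc)
  qed
qed (simp_all add: verma_sub_props frag_extend_diff)

lemma annihilator_left: "f \<in> hw_annihilator lam \<Longrightarrow> g * f \<in> hw_annihilator lam"
  unfolding hw_annihilator_def using N_left[of "frag_of (Ug_class f, 1)" g] by (simp add: frag_extend_of Ug_mult)

lemma annihilator_rels: "r \<in> env_rels UNIV \<Longrightarrow> g * r * h \<in> hw_annihilator lam"
  using env_rels_ideal env_UNIV_props(5,6) by (intro env_ideal_annihilator) blast

lemma annihilator_borel: "b \<in> borel_sub \<Longrightarrow> gen b - free_scalar (weight_at lam b) \<in> hw_annihilator lam"
  unfolding annihilator_diff_iff[symmetric]
  using verma_sub_props(2)[OF N_rel3[OF carrier_free_gens(1)[of b borel_sub], of 1 1] N_scalar[of 1 "weight_at lam b"]]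
  by (simp add: cid.ev_simps)

definition verma_class :: "(('m, 1) gl list \<Rightarrow>\<^sub>0 complex) \<Rightarrow> (((('m, 1) gl list \<Rightarrow>\<^sub>0 complex) set \<times> complex) \<Rightarrow>\<^sub>0 int) set" where
  "verma_class f = N #>\<^bsub>verma_free\<^esub> frag_of (Ug_class f, 1)"

lemma N_coset: "N #>\<^bsub>verma_free\<^esub> c = (\<lambda>n. n + c) ` N"
  by (auto simp: r_coset_def verma_free_def)

lemma N_coset_eq: "N #>\<^bsub>verma_free\<^esub> c = N #>\<^bsub>verma_free\<^esub> d \<longleftrightarrow> c - d \<in> N"
proof
  assume "N #>\<^bsub>verma_free\<^esub> c = N #>\<^bsub>verma_free\<^esub> d"
  moreover have "c \<in> N #>\<^bsub>verma_free\<^esub> c" unfolding N_coset using verma_sub_props(1) by force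
  ultimately obtain n where "n \<in> N" "c = n + d" unfolding N_coset by auto
  then show "c - d \<in> N" by simp
next
  assume *: "c - d \<in> N"
  have "\<exists>h'\<in>N. h + c = h' + d" if "h \<in> N" for h
    using verma_sub_props(2)[OF that *] by (intro bexI) auto
  moreover have "\<exists>h'\<in>N. h + d = h' + c" if "h \<in> N" for h
    using verma_sub_props(4)[OF that *] by (intro bexI) auto
  ultimately show "N #>\<^bsub>verma_free\<^esub> c = N #>\<^bsub>verma_free\<^esub> d" unfolding N_coset by (auto simp: image_iff)
qed

lemma verma_class_eq: "verma_class f = verma_class g \<longleftrightarrow> f - g \<in> hw_annihilator lam"
  by (simp add: verma_class_def N_coset_eq annihilator_diff_iff)

lemma verma_class_one: "verma_class f = \<one>\<^bsub>verma lam\<^esub> \<longleftrightarrow> f \<in> hw_annihilator lam"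
proof -
  have "N = N #>\<^bsub>verma_free\<^esub> 0" by (simp add: N_coset)
  then show ?thesis using N_coset_eq[of "frag_of (Ug_class f, 1)" 0]
    by (simp add: verma_def verma_class_def hw_annihilator_def)
qed

lemma carrier_verma: "carrier (verma lam) = range verma_class"
proof -
  have *: "\<exists>f. c - frag_of (Ug_class f, 1) \<in> N" if "c \<in> carrier verma_free" for c
  proof -
    have "Poly_Mapping.keys c \<subseteq> range Ug_class \<times> UNIV"
      using that by (simp add: verma_free_def carrier_Ug)
    then show ?thesis
    proof (induction c rule: frag_induction)
      case zero
      show ?case using annihilator_0 by (intro exI[of _ 0]) (auto simp: hw_annihilator_def verma_sub_props)
    next
      case (one x)
      then show ?case using N_scalar by auto
    next
      case (diff a b)
      then obtain f g where fg: "a - frag_of (Ug_class f, 1) \<in> N" "b - frag_of (Ug_class g, 1) \<in> N" by auto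
      have "frag_of (Ug_class f, 1) - frag_of (Ug_class (f - g), 1) - frag_of (Ug_class g, 1) \<in> N"
        using N_rel1[of "f - g" g 1] by simp
      from verma_sub_props(2)[OF verma_sub_props(4)[OF fg] this]
      have "a - b - frag_of (Ug_class (f - g), 1) \<in> N" by (simp add: algebra_simps)
      then show ?case by blast
    qed
  qed
  have "frag_of (Ug_class f, 1) \<in> carrier verma_free" for f
    by (simp add: verma_free_def carrier_Ug keys_frag_of)
  then show ?thesis
    unfolding verma_def carrier_FactGroup using * N_coset_eq by (force simp: verma_class_def)
qed

lemma verma_act_class: "verma_act lam x (verma_class f) = verma_class (gen x * f)"
proof -
  let ?e = "frag_extend (\<lambda>(v, z). frag_of (env_gen x \<otimes>\<^bsub>Ug\<^esub> v, z))"
  have x: "env_gen x = Ug_class (gen x)" by (simp add: env_gen_def Ug_class_def)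
  have "N #>\<^bsub>verma_free\<^esub> ?e (n + frag_of (Ug_class f, 1)) = verma_class (gen x * f)" if "n \<in> N" for n
    using N_left[OF that, of "gen x"]
    by (simp add: verma_class_def N_coset_eq frag_extend_add frag_extend_of x Ug_mult)
  then have "(\<lambda>c. N #>\<^bsub>verma_free\<^esub> ?e c) ` verma_class f = {verma_class (gen x * f)}"
    unfolding verma_class_def[of f] N_coset using verma_sub_props(1)[of lam] by (auto simp: image_image)
  then show ?thesis
    by (simp add: verma_act_def verma_Ug_act_def)
qed

lemma assoc_variety_iff:
  "x \<in> assoc_variety (verma lam) (verma_act lam) \<longleftrightarrow>
    x \<in> self_commuting \<and> \<not> (\<forall>f. gen x * f \<in> hw_annihilator lam \<longleftrightarrow> (\<exists>g. f - gen x * g \<in> hw_annihilator lam))"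
proof -
  have "verma_act lam x ` carrier (verma lam) = {v \<in> carrier (verma lam). verma_act lam x v = \<one>\<^bsub>verma lam\<^esub>} \<longleftrightarrow>
    (\<forall>f. verma_class f \<in> verma_act lam x ` range verma_class \<longleftrightarrow> verma_act lam x (verma_class f) = \<one>\<^bsub>verma lam\<^esub>)"
  proof -
    have *: "A = {v \<in> range t. P v} \<longleftrightarrow> (\<forall>f. t f \<in> A \<longleftrightarrow> P (t f))" if "A \<subseteq> range t"
      for A :: "'x set" and t :: "'y \<Rightarrow> 'x" and P
      using that by auto
    show ?thesis unfolding carrier_verma by (rule *) (auto simp: verma_act_class)
  qed
  also have "\<dots> \<longleftrightarrow> (\<forall>f. gen x * f \<in> hw_annihilator lam \<longleftrightarrow> (\<exists>g. f - gen x * g \<in> hw_annihilator lam))"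
  proof -
    have "verma_class f \<in> verma_act lam x ` range verma_class \<longleftrightarrow> (\<exists>g. f - gen x * g \<in> hw_annihilator lam)" for f
      by (simp add: image_image verma_act_class image_iff verma_class_eq)
    then show ?thesis by (simp only: verma_act_class verma_class_one) blast
  qed
  finally show ?thesis unfolding assoc_variety_def by simp
qed

text \<open>The universal property of the induced module, for a highest weight vector
  \<open>v\<close>. \<open>X\<close> is the additive extension of (u, z) \<mapsto> z u v to formal
  sums; the choice of a representative of u does not matter because \<open>r\<close> respects the
  relations. \<open>X\<close> kills the three families of tensor relations, the last one by
  \<open>hw\<close>.\<close>

lemma annihilator_universal:
  fixes r :: "('m, 1) gl \<Rightarrow> 'c op"
  assumes rels: "\<And>f. f \<in> env_rels UNIV \<Longrightarrow> ev cst r f = 0"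
    and hw: "\<And>b. b \<in> borel_sub \<Longrightarrow> ap (r b) v = scl (weight_at lam b) v"
    and f: "f \<in> hw_annihilator lam"
  shows "ap (ev cst r f) v = 0"
proof -
  define X0 where "X0 = (\<lambda>(u, z). scl z (ap (ev cst r (SOME f. Ug_class f = u)) v))"
  define X where "X c = (\<Sum>k\<in>Poly_Mapping.keys c. scl (of_int (Poly_Mapping.lookup c k)) (X0 k))"
    for c :: "((('m, 1) gl list \<Rightarrow>\<^sub>0 complex) set \<times> complex) \<Rightarrow>\<^sub>0 int"
  have X0: "X0 (Ug_class f, z) = scl z (ap (ev cst r f) v)" for f z
  proof -
    have "Ug_class (SOME f'. Ug_class f' = Ug_class f) = Ug_class f" by (rule someI) simp
    then have "(SOME f'. Ug_class f' = Ug_class f) - f \<in> env_ideal UNIV" by (simp add: Ug_class_eq)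
    from ccst.ev_env_ideal[OF _ rels this] have "ev cst r (SOME f'. Ug_class f' = Ug_class f) = ev cst r f"
      by (simp add: carrier_free_UNIV ccst.ev_simps)
    then show ?thesis by (simp add: X0_def)
  qed
  have add: "X (c + d) = X c + X d" for c d
    unfolding X_def by (rule setsum_keys_plus_distrib) (simp_all add: scl_def fun_eq_iff algebra_simps)
  have diff: "X (c - d) = X c - X d" for c d
    using add[of "c - d" d] by (simp only: diff_add_cancel eq_diff_eq)
  have one: "X (frag_of k) = X0 k" for k by (simp add: X_def keys_frag_of scl_1)
  have hb: "ap (ev cst r h) v = scl (ev (\<lambda>c. c) (weight_at lam) h) v" if h: "h \<in> carrier (free_algebra borel_sub)" for h
  proof -
    have word: "ap (prod_list (map r w)) v = scl (prod_list (map (weight_at lam) w)) v" if "set w \<subseteq> borel_sub" for w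
      using that by (induction w) (simp_all add: ap_1 scl_1 ap_mult ap_scl hw scl_scl mult.commute)
    have "ap (ev cst r h) v = (\<Sum>w\<in>Poly_Mapping.keys h. scl (Poly_Mapping.lookup h w * prod_list (map (weight_at lam) w)) v)"
      unfolding ev_def ap_sum
      by (rule sum.cong) (use h in \<open>auto simp: carrier_free ap_mult word ap_cst_scl scl_scl\<close>)
    also have "\<dots> = scl (ev (\<lambda>c. c) (weight_at lam) h) v"
      unfolding ev_def scl_def by (rule ext) (simp add: sum_fun_apply sum_distrib_right)
    finally show ?thesis .
  qed
  have "X c = 0" if "c \<in> N" for c
    using that
  proof (induction rule: verma_sub_induct)
    case zero
    then show ?case by (simp add: X_def)
  next
    case (rel s)
    then show ?case
      by (cases rule: verma_rels_cases)
        (simp_all add: diff one X0 ccst.ev_simps ap_simps scl_plus hb ap_scl scl_scl scl_diff scl_0 mult.commute scl_add)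
  next
    case (diff c d)
    then show ?case by (simp only: \<open>\<And>c d. X (c - d) = X c - X d\<close> diff_self)
  qed
  then have "X (frag_of (Ug_class f, 1)) = 0" using f by (simp add: hw_annihilator_def)
  then show ?thesis by (simp only: one X0 scl_1)
qed

end

section \<open>The action on Fock space\<close>

definition unit_op :: "('i \<Rightarrow> 'r::ring_1) \<Rightarrow> ('i \<Rightarrow> 'r) \<Rightarrow> 'r \<Rightarrow> 'i + 1 \<Rightarrow> 'i + 1 \<Rightarrow> 'r" where
  "unit_op x y h I J = (case I of
      Inl j \<Rightarrow> (case J of Inl k \<Rightarrow> x j * y k + y k * x j - (if j = k then h else 0) | Inr _ \<Rightarrow> x j)
    | Inr _ \<Rightarrow> (case J of Inl k \<Rightarrow> y k | Inr _ \<Rightarrow> h))"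

definition unit_sign :: "'i + 1 \<Rightarrow> 'i + 1 \<Rightarrow> 'i + 1 \<Rightarrow> 'i + 1 \<Rightarrow> 'r::ring_1" where
  "unit_sign I J K M = (if isl I \<noteq> isl J \<and> isl K \<noteq> isl M then - 1 else 1)"

lemma num1_eq_True: "(b :: 1) = b' \<longleftrightarrow> True"
  by (metis num1_eq1)

text \<open>The passage from \<open>triple_rels\<close> to all relations of gl(m|1): as the even
  units are anticommutators of odd ones up to \<open>h\<close>, their brackets follow by the
  derivation rule from those with \<open>x\<close> and \<open>y\<close>.\<close>

lemma unit_rels:
  fixes x y :: "'i \<Rightarrow> 'r::ring_1"
  assumes rels: "triple_rels UNIV x y h"
  defines "E \<equiv> unit_op x y h"
  shows "E I J * E K M = unit_sign I J K M * (E K M * E I J) + (if J = K then E I M else 0)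
    - unit_sign I J K M * (if I = M then E K J else 0)"
proof -
  define e where "e j k = x j * y k + y k * x j" for j k
  have xx: "x j * x k = - (x k * x j)" and yy: "y j * y k = - (y k * y j)"
    and hx: "h * x j = x j * h - x j" and hy: "h * y j = y j * h + y j"
    and ex: "e j k * x l = x l * e j k + (if k = l then x j else 0) - (if j = k then x l else 0)"
    and ey: "e j k * y l = y l * e j k - (if j = l then y k else 0) + (if j = k then y l else 0)"
    and xy: "x j * y k = e j k - y k * x j" for j k l
    using rels unfolding triple_rels_def e_def by (blast, blast, blast, blast, blast, blast, simp)
  have he: "h * e j k = e j k * h" for j k
    unfolding e_def by (simp add: algebra_simps hx hy mult_eq_left[OF hx] mult_eq_left[OF hy])
  have ee: "e j k * e l m = e l m * e j k + (if k = l then e j m else 0) - (if j = m then e l k else 0)" for j k l m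
    unfolding e_def[of l m]
    by (simp add: algebra_simps ex ey mult_eq_left[OF ex] mult_eq_left[OF ey]) (simp add: e_def algebra_simps)
  have E: "E (Inl j) (Inl k) = e j k - (if j = k then h else 0)" "E (Inl j) (Inr b) = x j" "E (Inr b) (Inl k) = y k" "E (Inr b) (Inr b') = h"
    for j k b b' by (simp_all add: E_def unit_op_def e_def)
  have F1: "E (Inl j) (Inl k) * E (Inl l) (Inl m) = E (Inl l) (Inl m) * E (Inl j) (Inl k)
      + (if k = l then E (Inl j) (Inl m) else 0) - (if j = m then E (Inl l) (Inl k) else 0)" for j k l m
    by (simp add: E algebra_simps he ee[of j k l m])
  have F2: "E (Inl j) (Inl k) * E (Inl l) (Inr b) = E (Inl l) (Inr b) * E (Inl j) (Inl k) + (if k = l then E (Inl j) (Inr b) else 0)"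
    "E (Inl j) (Inl k) * E (Inr b) (Inl m) = E (Inr b) (Inl m) * E (Inl j) (Inl k) - (if j = m then E (Inr b) (Inl k) else 0)"
    "E (Inl j) (Inl k) * E (Inr b) (Inr b') = E (Inr b) (Inr b') * E (Inl j) (Inl k)"
    "E (Inl l) (Inr b) * E (Inl j) (Inl k) = E (Inl j) (Inl k) * E (Inl l) (Inr b) - (if k = l then E (Inl j) (Inr b) else 0)"
    "E (Inr b) (Inl m) * E (Inl j) (Inl k) = E (Inl j) (Inl k) * E (Inr b) (Inl m) + (if j = m then E (Inr b) (Inl k) else 0)"
    "E (Inr b) (Inr b') * E (Inl j) (Inl k) = E (Inl j) (Inl k) * E (Inr b) (Inr b')"
    for j k l m b b'
    by (simp_all add: E algebra_simps he ex ey hx hy)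
  have F3: "E (Inl j) (Inr b) * E (Inl k) (Inr b') = - (E (Inl k) (Inr b') * E (Inl j) (Inr b))"
    "E (Inr b) (Inl j) * E (Inr b') (Inl k) = - (E (Inr b') (Inl k) * E (Inr b) (Inl j))"
    "E (Inl j) (Inr b) * E (Inr b') (Inl k) = - (E (Inr b') (Inl k) * E (Inl j) (Inr b)) + E (Inl j) (Inl k) + (if j = k then E (Inr b') (Inr b) else 0)"
    "E (Inr b') (Inl k) * E (Inl j) (Inr b) = - (E (Inl j) (Inr b) * E (Inr b') (Inl k)) + E (Inl j) (Inl k) + (if j = k then E (Inr b') (Inr b) else 0)"
    "E (Inr b) (Inr b') * E (Inl j) (Inr b'') = E (Inl j) (Inr b'') * E (Inr b) (Inr b') - E (Inl j) (Inr b)"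
    "E (Inl j) (Inr b'') * E (Inr b) (Inr b') = E (Inr b) (Inr b') * E (Inl j) (Inr b'') + E (Inl j) (Inr b)"
    "E (Inr b) (Inr b') * E (Inr b'') (Inl j) = E (Inr b'') (Inl j) * E (Inr b) (Inr b') + E (Inr b) (Inl j)"
    "E (Inr b'') (Inl j) * E (Inr b) (Inr b') = E (Inr b) (Inr b') * E (Inr b'') (Inl j) - E (Inr b) (Inl j)"
    for j k b b' b''
    by (simp_all add: E hx hy xx[of j k] yy[of j k] xy algebra_simps)
  have F4: "E (Inr b) (Inr b') * E (Inr c) (Inr c') = E (Inr c) (Inr c') * E (Inr b) (Inr b')" for b b' c c'
    by (simp add: E)
  show ?thesis
    by (cases I; cases J; cases K; cases M; hypsubst; rule trans, rule F1 F2 F3 F4;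
        simp (no_asm) add: unit_sign_def num1_eq_True E)
qed

lemma gl_proj_homog:
  assumes "A \<in> gl_part a"
  shows "gl_proj b A = (if a = b then A else 0)"
proof -
  have "A $ k $ l = 0" if "(isl k \<noteq> isl l) \<noteq> a" for k l using assms that unfolding gl_part_def by blast
  then show ?thesis by (auto simp: gl_proj_def vec_eq_iff)
qed

lemma sbracket_homog:
  assumes "A \<in> gl_part a" "B \<in> gl_part b"
  shows "sbracket A B = A ** B - (if a \<and> b then - (B ** A) else B ** A)"
  by (cases a; cases b) (simp_all add: sbracket_def gl_proj_homog[OF assms(1)] gl_proj_homog[OF assms(2)])

definition mat_op :: "('m + 1 \<Rightarrow> 'm + 1 \<Rightarrow> 'c op) \<Rightarrow> ('m::finite, 1) gl \<Rightarrow> 'c op" where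
  "mat_op E A = (\<Sum>I\<in>UNIV. \<Sum>J\<in>UNIV. cst (A $ I $ J) * E I J)"

lemma mat_op_add: "mat_op E (A + B) = mat_op E A + mat_op E B"
  and mat_op_diff: "mat_op E (A - B) = mat_op E A - mat_op E B"
  and mat_op_neg: "mat_op E (- B) = - mat_op E B"
  by (simp_all add: mat_op_def cst_add cst_diff cst_minus distrib_right left_diff_distrib sum.distrib sum_subtractf sum_negf)

lemma mat_op_scale: "mat_op E (scale_mat c A) = cst c * mat_op E A"
  by (simp add: mat_op_def scale_mat_def cst_mult sum_distrib_left mult.assoc)

lemma mat_op_munit:
  fixes E :: "'m::finite + 1 \<Rightarrow> 'm + 1 \<Rightarrow> 'c op"
  shows "mat_op E (munit I J) = E I J"
proof -
  have "cst (munit I J $ K $ L) * E K L = (if K = I then if L = J then E K L else 0 else 0)" for K L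
    by (simp add: munit_nth cst_0 cst_1)
  moreover have "(\<Sum>L\<in>UNIV. if K = I then g L else 0) = (if K = I then \<Sum>L\<in>UNIV. g L else 0)" for K and g :: "'m + 1 \<Rightarrow> 'c op"
    by simp
  ultimately show ?thesis by (simp add: mat_op_def)
qed

text \<open>The sign depends on parities only, so it is the same at all nonzero entries of two
  homogeneous matrices; the relations of the units then extend bilinearly.\<close>

lemma mat_op_bracket:
  fixes E :: "'m::finite + 1 \<Rightarrow> 'm + 1 \<Rightarrow> 'c op"
  assumes E: "\<And>I J K M. E I J * E K M = unit_sign I J K M * (E K M * E I J) + (if J = K then E I M else 0)
    - unit_sign I J K M * (if I = M then E K J else 0)"
    and A: "A \<in> gl_part a" and B: "B \<in> gl_part b"
  shows "mat_op E A * mat_op E B - (if a \<and> b then - 1 else 1) * (mat_op E B * mat_op E A) = mat_op E (sbracket A B)"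
proof -
  let ?s = "if a \<and> b then - 1 else 1 :: 'c op"
  have left: "mat_op E A * U = (\<Sum>I\<in>UNIV. \<Sum>J\<in>UNIV. cst (A $ I $ J) * (E I J * U))" for A U
    by (simp add: mat_op_def sum_distrib_right mult.assoc)
  have right: "U * mat_op E A = (\<Sum>I\<in>UNIV. \<Sum>J\<in>UNIV. cst (A $ I $ J) * (U * E I J))" for A U
    unfolding mat_op_def sum_distrib_left
    by (intro sum.cong refl) (simp add: mult_eq_left[OF cst_central[of _ U, symmetric]] mult.assoc)
  have cst_sum: "cst (sum f X) = (\<Sum>k\<in>X. cst (f k) :: 'c op)" for f and X :: "('m + 1) set"
    by (induction X rule: infinite_finite_induct) (simp_all add: cst_0 cst_add)
  have prod: "mat_op E (A ** B) = (\<Sum>I\<in>UNIV. \<Sum>J\<in>UNIV. cst (A $ I $ J) * (\<Sum>M\<in>UNIV. cst (B $ J $ M) * E I M))" for A B :: "('m, 1) gl"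
  proof -
    have "mat_op E (A ** B) = (\<Sum>I\<in>UNIV. \<Sum>M\<in>UNIV. \<Sum>J\<in>UNIV. cst (A $ I $ J) * (cst (B $ J $ M) * E I M))"
      by (simp add: mat_op_def matrix_matrix_mult_def cst_sum cst_mult sum_distrib_right mult.assoc)
    also have "\<dots> = (\<Sum>I\<in>UNIV. \<Sum>J\<in>UNIV. \<Sum>M\<in>UNIV. cst (A $ I $ J) * (cst (B $ J $ M) * E I M))"
      by (intro sum.cong refl sum.swap)
    finally show ?thesis by (simp add: sum_distrib_left)
  qed
  have prod': "mat_op E (B ** A) = (\<Sum>I\<in>UNIV. \<Sum>J\<in>UNIV. cst (A $ I $ J) * (\<Sum>K\<in>UNIV. cst (B $ K $ I) * E K J))"
  proof -
    have "mat_op E (B ** A) = (\<Sum>K\<in>UNIV. \<Sum>I\<in>UNIV. \<Sum>J\<in>UNIV. cst (A $ I $ J) * (cst (B $ K $ I) * E K J))"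
      unfolding prod sum_distrib_left
      by (intro sum.cong refl comm_left[OF cst_central])
    also have "\<dots> = (\<Sum>I\<in>UNIV. \<Sum>K\<in>UNIV. \<Sum>J\<in>UNIV. cst (A $ I $ J) * (cst (B $ K $ I) * E K J))"
      by (rule sum.swap)
    also have "\<dots> = (\<Sum>I\<in>UNIV. \<Sum>J\<in>UNIV. \<Sum>K\<in>UNIV. cst (A $ I $ J) * (cst (B $ K $ I) * E K J))"
      by (intro sum.cong refl sum.swap)
    finally show ?thesis by (simp add: sum_distrib_left)
  qed
  have s: "?s * (cst k * T) = cst k * (?s * T)" for k T by simp
  have "mat_op E A * mat_op E B - ?s * (mat_op E B * mat_op E A) =
    (\<Sum>I\<in>UNIV. \<Sum>J\<in>UNIV. cst (A $ I $ J) * (\<Sum>K\<in>UNIV. \<Sum>M\<in>UNIV. cst (B $ K $ M) * (E I J * E K M - ?s * (E K M * E I J))))"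
    unfolding left[of A] right[of "mat_op E B" A] unfolding left[of B] right[of _ B] sum_distrib_left sum_subtractf[symmetric] right_diff_distrib s
    by (rule refl)
  also have "\<dots> = (\<Sum>I\<in>UNIV. \<Sum>J\<in>UNIV. cst (A $ I $ J) * (\<Sum>K\<in>UNIV. \<Sum>M\<in>UNIV. cst (B $ K $ M) *
      ((if J = K then E I M else 0) - ?s * (if I = M then E K J else 0))))"
  proof (intro sum.cong refl)
    fix I J
    show "cst (A $ I $ J) * (\<Sum>K\<in>UNIV. \<Sum>M\<in>UNIV. cst (B $ K $ M) * (E I J * E K M - ?s * (E K M * E I J))) =
      cst (A $ I $ J) * (\<Sum>K\<in>UNIV. \<Sum>M\<in>UNIV. cst (B $ K $ M) * ((if J = K then E I M else 0) - ?s * (if I = M then E K J else 0)))"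
    proof (cases "A $ I $ J = 0")
      case False
      then have a: "(isl I \<noteq> isl J) = a" using A by (auto simp: gl_part_def)
      have "cst (B $ K $ M) * (E I J * E K M - ?s * (E K M * E I J)) =
         cst (B $ K $ M) * ((if J = K then E I M else 0) - ?s * (if I = M then E K J else 0))" for K M
      proof (cases "B $ K $ M = 0")
        case False
        then have "(isl K \<noteq> isl M) = b" using B by (auto simp: gl_part_def)
        then have "unit_sign I J K M = ?s" using a by (simp add: unit_sign_def)
        then show ?thesis by (subst E) simp
      qed (simp add: cst_0)
      then show ?thesis by simp
    qed (simp add: cst_0)
  qed
  also have "\<dots> = mat_op E (A ** B) - ?s * mat_op E (B ** A)"
  proof -
    have 1: "(\<Sum>K\<in>UNIV. \<Sum>M\<in>UNIV. cst (B $ K $ M) * (if J = K then E I M else 0)) = (\<Sum>M\<in>UNIV. cst (B $ J $ M) * E I M)" for I J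
      by (subst sum.swap) (simp add: mult_if)
    have 2: "(\<Sum>K\<in>UNIV. \<Sum>M\<in>UNIV. cst (B $ K $ M) * (?s * (if I = M then E K J else 0))) = ?s * (\<Sum>K\<in>UNIV. cst (B $ K $ I) * E K J)" for I J
      by (simp add: mult_if sum_negf)
    show ?thesis
      unfolding prod' prod[of A B] right_diff_distrib sum_subtractf 1 2 by (simp only: s sum_distrib_left)
  qed
  also have "\<dots> = mat_op E (sbracket A B)"
    by (simp add: sbracket_homog[OF A B] mat_op_diff mat_op_neg mat_op_add)
  finally show ?thesis .
qed

section \<open>Anticommutators of the extended operators\<close>

context extension_step
begin

lemma xy_extend:
  assumes "j \<in> S" "k \<in> S"
  shows "(x j + z j * w) * (y k + u * d k) + (y k + u * d k) * (x j + z j * w) =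
    x j * y k + y k * x j + z j * d k + (if j = k then u * w else 0)"
  using assms by (simp add: order_rules order_rules2 algebra_simps)

lemma xu_extend: "j \<in> S \<Longrightarrow> (x j + z j * w) * u + u * (x j + z j * w) = z j"
  by (simp add: order_rules order_rules2 algebra_simps)

lemma au_extend: "(A * w - D) * u = A - u * (A * w - D)"
  by (simp add: order_rules order_rules2 algebra_simps)

lemma ay_extend: "k \<in> S \<Longrightarrow> (A * w - D) * y k = - (A * y k * w) - F k + y k * D"
  by (simp add: order_rules order_rules2 algebra_simps)

end

lemma env_rels_killed:
  assumes add: "\<And>A B. r (A + B) = r A + r B" and scale: "\<And>c A. r (scale_mat c A) = cst c * r A"
    and bracket: "\<And>a b A B. A \<in> gl_part a \<Longrightarrow> B \<in> gl_part b \<Longrightarrow>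
      r A * r B - (if a \<and> b then - 1 else 1) * (r B * r A) = r (sbracket A B)"
    and f: "f \<in> env_rels UNIV"
  shows "ev cst r f = (0 :: 'c op)"
  using f unfolding env_rels_def
proof (elim UnE CollectE exE conjE IntE)
  fix a b A B
  assume "f = gen A * gen B - (if a \<and> b then - 1 else 1) * (gen B * gen A) - gen (sbracket A B)"
    and "A \<in> gl_part a" "B \<in> gl_part b"
  then show ?thesis using bracket[of A a B b] by (cases "a \<and> b") (auto simp: ccst.ev_simps)
qed (simp_all add: ccst.ev_simps add scale)

section \<open>The vacuum as a highest weight vector\<close>

abbreviation vac :: "'m conf \<Rightarrow> complex" where "vac \<equiv> dlt (\<lambda>_. 0, {})"

lemma dop_dlt: "e p = 0 \<Longrightarrow> ap (dop p) (dlt (e, J)) = 0"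
proof -
  assume "e p = 0"
  then have "e'(p := Suc (e' p)) \<noteq> e" for e' by (metis fun_upd_same nat.distinct(1))
  then show ?thesis by (auto simp: ap_dop dlt_def fun_eq_iff)
qed

lemma wop_dlt: "a \<notin> J \<Longrightarrow> ap (wop a) (dlt (e, J)) = 0"
  by (rule ext) (auto simp: ap_wop dlt_def)

lemma zop_dlt: "ap (zop p) (dlt (e, J)) = dlt (e(p := Suc (e p)), J)"
proof
  fix c :: "'a conf"
  obtain e' J' where c: "c = (e', J')" by force
  have "e' p \<noteq> 0 \<and> e'(p := e' p - 1) = e \<longleftrightarrow> e' = e(p := Suc (e p))"
    by auto
  then show "ap (zop p) (dlt (e, J)) c = dlt (e(p := Suc (e p)), J) c"
    unfolding c ap_zop dlt_def prod.inject by (simp only: split: if_splits) blast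
qed

lemma uop_dlt: "a \<notin> J \<Longrightarrow> ap (uop a) (dlt (e, J)) = scl (sg a J) (dlt (e, insert a J))"
proof -
  assume a: "a \<notin> J"
  then have "a \<in> J' \<and> J' - {a} = J \<longleftrightarrow> J' = insert a J" for J' by auto
  then show ?thesis using sg_self(1)[of a J] a by (auto simp: ap_uop dlt_def scl_def fun_eq_iff)
qed

lemma sg_nonzero: "sg a J \<noteq> 0"
  by (simp add: sg_def)

context gl_weight
begin

definition fock_unit :: "'m list \<Rightarrow> 'm + 1 \<Rightarrow> 'm + 1 \<Rightarrow> 'm conf op" where
  "fock_unit L = unit_op (xop L) (yop L) (hop L)"

lemma fock_unit_rels:
  assumes "distinct L" "set L = UNIV" "f \<in> env_rels UNIV"
  shows "ev cst (mat_op (fock_unit L)) f = 0"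
proof (rule env_rels_killed[OF mat_op_add mat_op_scale _ assms(3)])
  show "mat_op (fock_unit L) A * mat_op (fock_unit L) B - (if a \<and> b then - 1 else 1) * (mat_op (fock_unit L) B * mat_op (fock_unit L) A)
      = mat_op (fock_unit L) (sbracket A B)" if "A \<in> gl_part a" "B \<in> gl_part b" for a b A B
    using step_and_rels(1)[OF assms(1)] that unfolding fock_unit_def assms(2)
    by (intro mat_op_bracket unit_rels)
qed

lemma xop_vac: "ap (xop S j) vac = 0"
  by (induction S arbitrary: j) (simp_all add: ap_simps ap_sum wop_dlt ap_zero)

lemma hop_vac: "ap (hop S) vac = scl ld vac"
  by (induction S) (simp_all add: ap_simps ap_cst_scl wop_dlt ap_zero)

lemma aop_vac: "ap (aop i S) vac = scl (le i + ld) vac"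
  by (simp add: aop_def ap_simps ap_sum ap_cst_scl hop_vac dop_dlt ap_zero scl_add)

text \<open>The anticommutator is E_(j,k) plus, for j = k, the operator E_(\<delta>,\<delta>); hence
  the eigenvalue \<open>le j + ld\<close> instead of \<open>le j\<close>.\<close>

lemma xy_vac:
  "sorted_wrt (<) S \<Longrightarrow> j \<in> set S \<Longrightarrow> k \<in> set S \<Longrightarrow> j \<le> k \<Longrightarrow>
    ap (xop S j * yop S k + yop S k * xop S j) vac = scl (if j = k then le j + ld else 0) vac"
proof (induction S)
  case (Cons a S)
  have dist: "distinct (a # S)" using Cons.prems(1) by (metis strict_sorted_iff)
  interpret extension_step "set S" "\<lambda>j. zop (j, a)" "\<lambda>j. dop (j, a)" "uop a" "wop a" "xop S" "yop S" "hop S" "cst (le a)"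
    using dist by (rule step_and_rels)
  have A: "A = aop a S" and D: "D = (\<Sum>k\<in>set S. dop (k, a) * xop S k)"
    by (simp_all add: A_def eu_def aop_def D_def)
  have x: "xop (a # S) a = A * wop a - D" unfolding A D xop_head ..
  have Dv: "ap D vac = 0" by (simp add: D ap_sum ap_mult xop_vac ap_zero)
  have sm: "a < c" if "c \<in> set S" for c using that Cons.prems(1) by simp
  show ?case
  proof (cases "j = a")
    case ja: True
    show ?thesis
    proof (cases "k = a")
      case True
      have "xop (a # S) a * uop a + uop a * xop (a # S) a = A"
        unfolding x au_extend by simp
      then show ?thesis using ja True aop_vac[of a S] by (simp add: A)
    next
      case False
      then have k: "k \<in> set S" using Cons.prems by simp
      have "F k = (\<Sum>j\<in>set S. e j k * dop (j, a))"
        unfolding F_def by (rule sum.cong) (simp_all add: ed k)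
      then have "ap (F k) vac = 0" by (simp add: ap_sum ap_mult dop_dlt ap_zero)
      then have "ap (xop (a # S) a * yop S k) vac = 0"
        unfolding x ay_extend[OF k] by (simp add: ap_simps Dv wop_dlt ap_zero)
      moreover have "ap (yop (a # S) k) vac = ap (yop S k) vac"
        using False by (simp add: ap_simps dop_dlt ap_zero)
      ultimately show ?thesis
        using ja False unfolding ap_add ap_mult xop_vac by (simp add: scl_0 ap_zero ap_mult)
    qed
  next
    case False
    then have j: "j \<in> set S" using Cons.prems by simp
    then have k: "k \<in> set S" "k \<noteq> a" using Cons.prems sm[of j] by auto
    have "xop (a # S) j * yop (a # S) k + yop (a # S) k * xop (a # S) j =
      xop S j * yop S k + yop S k * xop S j + zop (j, a) * dop (k, a) + (if j = k then uop a * wop a else 0)"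
      using False k xy_extend[OF j k(1)] by simp
    moreover have "ap (xop S j * yop S k + yop S k * xop S j) vac = scl (if j = k then le j + ld else 0) vac"
      using Cons j k by simp
    ultimately show ?thesis
      by (simp add: ap_add ap_mult dop_dlt wop_dlt ap_zero ap_0)
  qed
qed simp

lemma fock_unit_hw:
  assumes L: "sorted_wrt (<) L" "set L = UNIV" and b: "b \<in> borel_sub"
    and lam: "\<And>i. lam $ Inl i = le i" "lam $ Inr 1 = ld"
  shows "ap (mat_op (fock_unit L) b) vac = scl (weight_at lam b) vac"
proof -
  have 1: "ap (fock_unit L I J) vac = (if I = J then scl (lam $ I) vac else 0)" if "upper I J" for I J
  proof (cases I)
    case i: (Inl i)
    show ?thesis
    proof (cases J)
      case (Inl j)
      then show ?thesis using i that xy_vac[OF L(1), of i j] L(2) lam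
        by (auto simp: fock_unit_def unit_op_def ap_diff ap_0 hop_vac scl_diff scl_0)
    next
      case (Inr b)
      then show ?thesis using i by (simp add: fock_unit_def unit_op_def xop_vac)
    qed
  next
    case (Inr b)
    moreover have "lam $ Inr b' = ld" for b' using lam(2) by (metis num1_eq1)
    ultimately show ?thesis using that
      by (cases J) (simp_all add: fock_unit_def unit_op_def hop_vac num1_eq_True)
  qed
  have 2: "ap (cst (b $ I $ J) * fock_unit L I J) vac = (if J = I then scl (b $ I $ I * lam $ I) vac else 0)" for I J
  proof (cases "b $ I $ J = 0")
    case False
    then have "upper I J" using b unfolding borel_sub_eq by blast
    then show ?thesis by (auto simp: ap_mult 1 ap_cst_scl scl_scl scl_zero)
  qed (auto simp: cst_0 ap_mult ap_0 scl_0)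
  have "ap (mat_op (fock_unit L) b) vac = (\<Sum>I\<in>UNIV. scl (b $ I $ I * lam $ I) vac)"
    unfolding mat_op_def ap_sum 2 by simp
  also have "\<dots> = scl (weight_at lam b) vac"
    by (rule ext) (simp add: sum_fun_apply scl_def weight_at_def sum_distrib_right mult.commute sum_distrib_left)
  finally show ?thesis .
qed

text \<open>Each index r below \<open>a\<close> changes the operator only by
  \<open>zop (c, r) * dop (a, r)\<close>, which vanishes on \<open>f\<close>.\<close>

lemma fock_unit_suffix:
  assumes "distinct (R @ a # S)" "\<forall>b\<in>set R. ap (dop (a, b)) f = 0" "c \<in> set S"
  shows "ap (fock_unit (R @ a # S) (Inl c) (Inl a)) f = ap (zop (c, a)) f"
  using assms
proof (induction R)
  case Nil
  then interpret extension_step "set S" "\<lambda>j. zop (j, a)" "\<lambda>j. dop (j, a)" "uop a" "wop a" "xop S" "yop S" "hop S" "cst (le a)"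
    by (intro step_and_rels) auto
  have "c \<noteq> a" using Nil by auto
  then show ?case using xu_extend[OF Nil.prems(3)] by (simp add: fock_unit_def unit_op_def)
next
  case (Cons r R)
  then interpret extension_step "set (R @ a # S)" "\<lambda>j. zop (j, r)" "\<lambda>j. dop (j, r)" "uop r" "wop r" "xop (R @ a # S)" "yop (R @ a # S)" "hop (R @ a # S)" "cst (le r)"
    by (intro step_and_rels) auto
  have c: "c \<noteq> r" "c \<noteq> a" "a \<noteq> r" using Cons.prems by auto
  have "fock_unit ((r # R) @ a # S) (Inl c) (Inl a) = fock_unit (R @ a # S) (Inl c) (Inl a) + zop (c, r) * dop (a, r)"
    using xy_extend[of c a] c Cons.prems(3) by (simp add: fock_unit_def unit_op_def)
  moreover have "ap (fock_unit (R @ a # S) (Inl c) (Inl a)) f = ap (zop (c, a)) f"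
    using Cons.prems by (intro Cons.IH) auto
  moreover have "ap (dop (a, r)) f = 0" by (rule bspec[OF Cons.prems(2)]) simp
  ultimately show ?case by (simp only: ap_add ap_mult ap_zero add_0_right)
qed

lemma fock_unit_suffix_odd:
  assumes "distinct (R @ a # S)" "\<forall>b\<in>set R. ap (dop (a, b)) f = 0"
  shows "ap (fock_unit (R @ a # S) (Inr 1) (Inl a)) f = ap (uop a) f"
  using assms
proof (induction R)
  case Nil
  show ?case by (simp add: fock_unit_def unit_op_def)
next
  case (Cons r R)
  then have "fock_unit ((r # R) @ a # S) (Inr 1) (Inl a) = fock_unit (R @ a # S) (Inr 1) (Inl a) + uop r * dop (a, r)"
    by (auto simp: fock_unit_def unit_op_def)
  moreover have "ap (fock_unit (R @ a # S) (Inr 1) (Inl a)) f = ap (uop a) f"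
    using Cons.prems by (intro Cons.IH) auto
  moreover have "ap (dop (a, r)) f = 0" by (rule bspec[OF Cons.prems(2)]) simp
  ultimately show ?case by (simp only: ap_add ap_mult ap_zero add_0_right)
qed

text \<open>
  The ordered monomial of a configuration; the creation modes of \<open>a\<close> act as plain multiplications as long
  as no mode of a smaller index is occupied.
\<close>

primrec word :: "'m list \<Rightarrow> 'm conf \<Rightarrow> ('m, 1) gl list" where
  "word [] c = []"
| "word (a # S) c = concat (map (\<lambda>k. replicate (fst c (k, a)) (munit (Inl k) (Inl a))) S)
    @ (if a \<in> snd c then [munit (Inr 1) (Inl a)] else []) @ word S c"

lemma row_vec:
  assumes dist: "distinct (R @ a # S)" and T: "distinct T" "set T \<subseteq> set S" and e: "\<forall>b\<in>set R. \<forall>k. e (k, b) = 0"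
  shows "ap (prod_list (map (mat_op (fock_unit (R @ a # S))) (concat (map (\<lambda>k. replicate (n k) (munit (Inl k) (Inl a))) T)))) (dlt (e, J))
    = dlt (\<lambda>(k, b). if b = a \<and> k \<in> set T then e (k, b) + n k else e (k, b), J)"
  using T e
proof (induction T)
  case Nil
  then show ?case by (simp add: ap_1)
next
  case (Cons t T)
  have fock_rep: "ap (prod_list (map (mat_op (fock_unit (R @ a # S))) (replicate q (munit (Inl t) (Inl a))))) (dlt (e', J))
    = dlt (e'((t, a) := e' (t, a) + q), J)" if "\<forall>b\<in>set R. \<forall>k. e' (k, b) = 0" for q e'
  proof (induction q)
    case 0
    then show ?case by (simp add: ap_1)
  next
    case (Suc q)
    have aR: "a \<notin> set R" using dist by auto
    have "\<forall>b\<in>set R. ap (dop (a, b)) (dlt (e'((t, a) := e' (t, a) + q), J)) = 0"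
      using that aR by (intro ballI dop_dlt) auto
    then have s: "ap (fock_unit (R @ a # S) (Inl t) (Inl a)) (dlt (e'((t, a) := e' (t, a) + q), J)) =
        ap (zop (t, a)) (dlt (e'((t, a) := e' (t, a) + q), J))"
      by (rule fock_unit_suffix[OF dist]) (use Cons.prems in simp)
    show ?case
      by (simp only: replicate_Suc list.map prod_list.Cons ap_mult Suc mat_op_munit s zop_dlt fun_upd_same fun_upd_upd add_Suc_right)
  qed
  let ?e = "\<lambda>(k, b). if b = a \<and> k \<in> set T then e (k, b) + n k else e (k, b)"
  have "\<forall>b\<in>set R. \<forall>k. ?e (k, b) = 0" using Cons.prems(3) dist by auto
  moreover have "?e((t, a) := ?e (t, a) + n t) = (\<lambda>(k, b). if b = a \<and> k \<in> set (t # T) then e (k, b) + n k else e (k, b))"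
    using Cons.prems(1) by (auto simp: fun_eq_iff)
  ultimately show ?case
    using Cons fock_rep[of ?e "n t"] by (simp add: ap_mult)
qed

definition restrict_conf :: "'m list \<Rightarrow> 'm conf \<Rightarrow> 'm conf" where
  "restrict_conf S c = (\<lambda>(k, b). if b \<in> set S then fst c (k, b) else 0, snd c \<inter> set S)"

text \<open>Letters act from the right, so the letters of larger indices come first. When those of
  \<open>a\<close> are applied, no mode of a smaller index is occupied and each letter creates its
  own mode. The factor q is a product of Jordan-Wigner signs, of which only nonvanishing
  matters.\<close>

lemma word_vec:
  assumes "sorted_wrt (<) (R @ S)" "set (R @ S) = UNIV" "\<forall>k b. fst c (k, b) \<noteq> 0 \<longrightarrow> b < k"
  shows "\<exists>q. q \<noteq> 0 \<and> ap (prod_list (map (mat_op (fock_unit (R @ S))) (word S c))) vac = scl q (dlt (restrict_conf S c))"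
  using assms(1,2)
proof (induction S arbitrary: R)
  case Nil
  have "restrict_conf [] c = (\<lambda>_. 0, {})" by (auto simp: restrict_conf_def)
  then show ?case by (intro exI[of _ 1]) (simp add: ap_1 scl_1)
next
  case (Cons a S)
  have dist: "distinct (R @ a # S)" using Cons.prems(1) by (metis strict_sorted_iff)
  obtain q where q: "q \<noteq> 0" "ap (prod_list (map (mat_op (fock_unit (R @ a # S))) (word S c))) vac = scl q (dlt (restrict_conf S c))"
    using Cons.IH[of "R @ [a]"] Cons.prems by auto
  define c' where "c' = (fst (restrict_conf S c), snd c \<inter> set (a # S))"
  have R: "\<forall>b\<in>set R. \<forall>k. fst (restrict_conf S c) (k, b) = 0" using dist by (auto simp: restrict_conf_def)
  have "\<exists>q'. q' \<noteq> 0 \<and> ap (prod_list (map (mat_op (fock_unit (R @ a # S))) (if a \<in> snd c then [munit (Inr 1) (Inl a)] else []))) (dlt (restrict_conf S c)) = scl q' (dlt c')"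
  proof (cases "a \<in> snd c")
    case True
    have "\<forall>b\<in>set R. ap (dop (a, b)) (dlt (restrict_conf S c)) = 0"
      using R by (metis dop_dlt prod.collapse)
    from fock_unit_suffix_odd[OF dist this] True dist show ?thesis
      by (intro exI[of _ "sg a (snd c \<inter> set S)"])
        (simp add: mat_op_munit c'_def restrict_conf_def uop_dlt sg_nonzero)
  next
    case False
    then show ?thesis by (intro exI[of _ 1]) (simp add: ap_1 scl_1 c'_def restrict_conf_def)
  qed
  then obtain q' where q': "q' \<noteq> 0" "ap (prod_list (map (mat_op (fock_unit (R @ a # S))) (if a \<in> snd c then [munit (Inr 1) (Inl a)] else []))) (dlt (restrict_conf S c)) = scl q' (dlt c')"
    by blast
  have eq: "(\<lambda>(k, b). if b = a \<and> k \<in> set S then fst c' (k, b) + fst c (k, a) else fst c' (k, b), snd c') = restrict_conf (a # S) c"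
  proof -
    have "fst c (k, a) = 0" if "k \<notin> set S" for k
    proof (rule ccontr)
      assume "fst c (k, a) \<noteq> 0"
      then have "a < k" using assms(3) by blast
      moreover have "k \<in> set (R @ a # S)" using Cons.prems(2) by auto
      ultimately show False using that Cons.prems(1) by (auto simp: sorted_wrt_append dest: less_asym)
    qed
    then show ?thesis using dist by (auto simp: restrict_conf_def c'_def fun_eq_iff)
  qed
  have "ap (prod_list (map (mat_op (fock_unit (R @ a # S))) (concat (map (\<lambda>k. replicate (fst c (k, a)) (munit (Inl k) (Inl a))) S)))) (dlt c') = dlt (restrict_conf (a # S) c)"
    using row_vec[OF dist, of S "fst c'" "\<lambda>k. fst c (k, a)" "snd c'"] R dist eq by (simp add: c'_def)
  then show ?case
    using q q' by (intro exI[of _ "q * q'"]) (simp add: ap_mult ap_scl scl_scl)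
qed

end

section \<open>Isomorphism with the Fock space\<close>

lemma single_Cons: "Poly_Mapping.single (A # w) k = gen A * Poly_Mapping.single w k"
  and single_append: "Poly_Mapping.single (u @ w) k = Poly_Mapping.single u 1 * Poly_Mapping.single w k"
  and single_Nil: "Poly_Mapping.single [] k = free_scalar k"
  by (simp_all add: gen_def mult_single plus_list_def free_scalar_def)

lemma single_scalar: "Poly_Mapping.single w k = free_scalar k * Poly_Mapping.single w 1"
  by (simp add: free_scalar_def mult_single plus_list_def)

lemma munit_part: "munit I J \<in> gl_part (isl I \<noteq> isl J)"
  by (auto simp: gl_part_def munit_nth)

lemma munit_mult: "munit I J ** munit K M = (if J = K then munit I M else 0)"
proof -
  have "(\<Sum>j\<in>UNIV. munit I J $ k $ j * munit K M $ j $ l) = (if k = I \<and> J = K \<and> l = M then 1 else 0)" for k l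
  proof -
    have "(\<Sum>j\<in>UNIV. munit I J $ k $ j * munit K M $ j $ l) = (\<Sum>j\<in>UNIV. if j = J then (if k = I \<and> J = K \<and> l = M then 1 else 0) else 0)"
      by (rule sum.cong) (auto simp: munit_nth)
    then show ?thesis by simp
  qed
  then show ?thesis by (intro mat_eqI) (simp add: matrix_matrix_mult_def munit_nth)
qed

lemma weight_at_munit: "weight_at \<alpha> (munit I J) = (if I = J then \<alpha> $ I else 0)"
proof -
  have "weight_at \<alpha> (munit I J) = (\<Sum>k\<in>UNIV. if k = I then (if I = J then \<alpha> $ I else 0) else 0)"
    unfolding weight_at_def by (rule sum.cong) (auto simp: munit_nth)
  then show ?thesis by simp
qed

locale gl_verma =
  fixes lam :: "('m::{finite,linorder}, 1) weight"
begin

sublocale gl_weight "\<lambda>i. lam $ Inl i" "lam $ Inr 1" .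

abbreviation "Ann \<equiv> hw_annihilator lam"

text \<open>\<open>Ann\<close> is a left ideal, yet a right factor \<open>h\<close> is allowed here,
  since it contains the two-sided ideal generated by the relations.\<close>

lemma Ann_rel: "r \<in> env_rels UNIV \<Longrightarrow> r * h \<in> Ann"
  using annihilator_rels[of r 1 h lam] by simp

lemma Ann_gen_diff: "gen (A - B) * h - (gen A * h - gen B * h) \<in> Ann"
proof -
  have "gen ((A - B) + B) - gen (A - B) - gen B \<in> env_rels UNIV"
    unfolding env_rels_def by blast
  from annihilator_neg[OF Ann_rel[OF this, of h]] show ?thesis by (simp add: algebra_simps)
qed

lemma Ann_gen_0: "gen 0 * h \<in> Ann"
  using Ann_gen_diff[of 0 0 h] by simp

lemma Ann_gen_neg: "gen (- B) * h + gen B * h \<in> Ann"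
  using annihilator_diff[OF Ann_gen_diff[of 0 B h] annihilator_neg[OF Ann_gen_0[of h]]] by (simp add: algebra_simps)

lemma Ann_trans: "f - g \<in> Ann \<Longrightarrow> g - h \<in> Ann \<Longrightarrow> f - h \<in> Ann"
  using annihilator_add[of "f - g" lam "g - h"] by simp

lemma unit_swap:
  "gen (munit I J) * (gen (munit K M) * h) - (unit_sign I J K M * (gen (munit K M) * (gen (munit I J) * h))
      + (if J = K then gen (munit I M) * h else 0) - unit_sign I J K M * (if I = M then gen (munit K J) * h else 0)) \<in> Ann"
proof -
  let ?s = "unit_sign I J K M :: ('m, 1) gl list \<Rightarrow>\<^sub>0 complex"
  let ?a = "isl I \<noteq> isl J" and ?b = "isl K \<noteq> isl M"
  let ?P = "if J = K then munit I M else 0" and ?Q = "if M = I then munit K J else 0 :: ('m, 1) gl"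
  have br: "sbracket (munit I J) (munit K M) = ?P - (if ?a \<and> ?b then - ?Q else ?Q)"
    by (subst sbracket_homog[OF munit_part munit_part]) (simp add: munit_mult)
  have "gen (munit I J) * gen (munit K M) - (if ?a \<and> ?b then - 1 else 1) * (gen (munit K M) * gen (munit I J)) - gen (sbracket (munit I J) (munit K M)) \<in> env_rels UNIV"
    unfolding env_rels_def
    by (rule UnI2, rule CollectI, intro exI[of _ ?a] exI[of _ ?b] exI[of _ "munit I J"] exI[of _ "munit K M"] conjI refl IntI UNIV_I munit_part)
  from Ann_rel[OF this, of h] have 1: "gen (munit I J) * (gen (munit K M) * h) - ?s * (gen (munit K M) * (gen (munit I J) * h))
      - gen (?P - (if ?a \<and> ?b then - ?Q else ?Q)) * h \<in> Ann"
    by (simp add: br unit_sign_def algebra_simps)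
  have P: "gen ?P * h - (if J = K then gen (munit I M) * h else 0) \<in> Ann"
    using Ann_gen_0[of h] annihilator_0[of lam] by simp
  have n1: "gen (- ?Q) * h + (if I = M then gen (munit K J) * h else 0) \<in> Ann"
    using Ann_gen_0[of h] Ann_gen_neg[of "munit K J" h] by auto
  have n2: "gen ?Q * h - (if I = M then gen (munit K J) * h else 0) \<in> Ann"
    using Ann_gen_0[of h] annihilator_0[of lam] by auto
  have "gen (if ?a \<and> ?b then - ?Q else ?Q) * h - ?s * (if I = M then gen (munit K J) * h else 0) \<in> Ann"
  proof (cases "?a \<and> ?b")
    case True
    then have s: "?s = - 1" by (simp add: unit_sign_def)
    show ?thesis unfolding if_P[OF True] s using n1 by simp
  next
    case False
    then have s: "?s = 1" by (auto simp: unit_sign_def)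
    show ?thesis unfolding if_not_P[OF False] s using n2 by simp
  qed
  from annihilator_add[OF 1 annihilator_add[OF Ann_gen_diff[of ?P "if ?a \<and> ?b then - ?Q else ?Q" h] annihilator_diff[OF P this]]]
  show ?thesis by (simp add: algebra_simps)
qed

definition lower_conf :: "'m conf \<Rightarrow> bool" where "lower_conf c \<longleftrightarrow> (\<forall>b a. fst c (b, a) \<noteq> 0 \<longrightarrow> a < b)"

text \<open>
  The span of the ordered monomials in the indices \<open>S\<close> modulo the annihilator.  Closure under the units of
  the block \<open>S\<close> is the spanning half of the Poincare-Birkhoff-Witt theorem for \<open>S\<close> an upper set of indices.
\<close>

inductive_set sp :: "'m list \<Rightarrow> (('m, 1) gl list \<Rightarrow>\<^sub>0 complex) set" for S where
  sp_j: "f \<in> Ann \<Longrightarrow> f \<in> sp S"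
| sp_w: "lower_conf c \<Longrightarrow> Poly_Mapping.single (word S c) k \<in> sp S"
| sp_add: "f \<in> sp S \<Longrightarrow> g \<in> sp S \<Longrightarrow> f + g \<in> sp S"

lemma sp_scalar: "f \<in> sp S \<Longrightarrow> free_scalar k * f \<in> sp S"
proof (induction rule: sp.induct)
  case (sp_w c k')
  then have "Poly_Mapping.single (word S c) (k * k') \<in> sp S" by (rule sp.sp_w)
  then show ?case by (simp add: free_scalar_def mult_single plus_list_def)
qed (auto intro: sp.intros annihilator_left simp: distrib_left)

lemma sp_neg: "f \<in> sp S \<Longrightarrow> - f \<in> sp S"
proof -
  have "free_scalar (- 1) * f = - f"
    using free_scalar_eq(2)[of "1" "- 1"] free_scalar_eq(1,4)
    by (metis add.right_inverse add_eq_0_iff mult_minus1)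
  then show "f \<in> sp S \<Longrightarrow> - f \<in> sp S" using sp_scalar[of f S "- 1"] by simp
qed

lemma sp_sign: "f \<in> sp S \<Longrightarrow> unit_sign I J K M * f \<in> sp S"
  using sp_neg by (simp add: unit_sign_def)

lemma sp_diff: "f \<in> sp S \<Longrightarrow> g \<in> sp S \<Longrightarrow> f - g \<in> sp S"
  using sp_add[OF _ sp_neg] by fastforce

lemma sp_0: "0 \<in> sp S"
  by (rule sp_j[OF annihilator_0])

lemma sp_eq: "f - g \<in> Ann \<Longrightarrow> g \<in> sp S \<Longrightarrow> f \<in> sp S"
  using sp_add[OF sp_j, of "f - g" g S] by simp

definition block :: "'m list \<Rightarrow> ('m + 1) set" where "block S = Inl ` set S \<union> range Inr"

lemma word_letters: "B \<in> set (word S c) \<Longrightarrow> \<exists>K M. B = munit K (Inl M) \<and> M \<in> set S \<and> K \<in> block S"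
proof (induction S)
  case (Cons a S)
  then show ?case by (auto simp: block_def split: if_splits)
qed simp

lemma upper_block: "K \<in> block S \<Longrightarrow> \<forall>c\<in>set S. a < c \<Longrightarrow> upper (Inl a) K \<and> K \<noteq> Inl a"
  by (auto simp: block_def)

lemma munit_borel: "upper I J \<Longrightarrow> munit I J \<in> borel_sub"
  unfolding borel_sub_eq by (auto simp: munit_nth split: if_splits)

text \<open>Moving E_(a,K) to the right through letters of \<open>S\<close> creates only units
  E_(a,M) with M again in the block, and all of these annihilate the highest weight vector. E_(a,a)
  commutes with the letters of \<open>S\<close> and reaches that vector unchanged.\<close>

lemma sp_kill:
  assumes a: "\<forall>c\<in>set S. a < c" and f: "f \<in> sp S"
  shows "\<forall>K\<in>block S. gen (munit (Inl a) K) * f \<in> Ann"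
    "gen (munit (Inl a) (Inl a)) * f - free_scalar (lam $ Inl a) * f \<in> Ann"
proof -
  have w: "(\<forall>K\<in>block S. gen (munit (Inl a) K) * Poly_Mapping.single w k \<in> Ann) \<and>
      gen (munit (Inl a) (Inl a)) * Poly_Mapping.single w k - free_scalar (lam $ Inl a) * Poly_Mapping.single w k \<in> Ann"
    if "\<forall>B\<in>set w. \<exists>K M. B = munit K (Inl M) \<and> M \<in> set S \<and> K \<in> block S" for w k
    using that
  proof (induction w)
    case Nil
    have "gen (munit (Inl a) K) * free_scalar k - free_scalar (if K = Inl a then lam $ Inl a else 0) * free_scalar k \<in> Ann" if "upper (Inl a) K" for K
      using annihilator_left[OF annihilator_borel[OF munit_borel[OF that], of lam], of "free_scalar k"]
      by (simp add: weight_at_munit right_diff_distrib free_scalar_central[of k] eq_commute)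
    note * = this
    have "gen (munit (Inl a) K) * free_scalar k \<in> Ann" if "K \<in> block S" for K
      using *[of K] upper_block[OF that a] by (simp add: free_scalar_eq)
    then show ?case using *[of "Inl a"] by (simp add: single_Nil)
  next
    case (Cons B w)
    then obtain K M where B: "B = munit K (Inl M)" "M \<in> set S" "K \<in> block S" by auto
    let ?w = "Poly_Mapping.single w k"
    have M: "Inl a \<noteq> Inl M" "Inl M \<in> block S" "K \<noteq> Inl a" using a B upper_block[OF B(3) a] by (auto simp: block_def)
    have kill: "gen (munit (Inl a) K') * ?w \<in> Ann" if "K' \<in> block S" for K' using Cons that by simp
    have "gen (munit (Inl a) K') * (gen B * ?w) \<in> Ann" if K': "K' \<in> block S" for K'
    proof -
      have "unit_sign (Inl a) K' K (Inl M) * (gen B * (gen (munit (Inl a) K') * ?w)) + (if K' = K then gen (munit (Inl a) (Inl M)) * ?w else 0) \<in> Ann"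
        by (rule annihilator_add[OF annihilator_left[OF annihilator_left[OF kill[OF K']]]]) (use kill[OF M(2)] annihilator_0[of lam] in simp)
      from annihilator_add[OF unit_swap[of "Inl a" K' K "Inl M" ?w] this] show ?thesis
        using M B by simp
    qed
    moreover have "gen (munit (Inl a) (Inl a)) * (gen B * ?w) - free_scalar (lam $ Inl a) * (gen B * ?w) \<in> Ann"
    proof -
      have "gen B * (gen (munit (Inl a) (Inl a)) * ?w - free_scalar (lam $ Inl a) * ?w) \<in> Ann"
        using Cons by (intro annihilator_left) auto
      moreover have "gen B * (free_scalar (lam $ Inl a) * ?w) = free_scalar (lam $ Inl a) * (gen B * ?w)"
        by (rule comm_left[OF free_scalar_central, symmetric])
      ultimately have "gen B * (gen (munit (Inl a) (Inl a)) * ?w) - free_scalar (lam $ Inl a) * (gen B * ?w) \<in> Ann"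
        by (simp add: right_diff_distrib)
      moreover have "gen (munit (Inl a) (Inl a)) * (gen B * ?w) - gen B * (gen (munit (Inl a) (Inl a)) * ?w) \<in> Ann"
        using unit_swap[of "Inl a" "Inl a" K "Inl M" ?w] M B by (simp add: unit_sign_def)
      ultimately show ?thesis by (blast intro: Ann_trans)
    qed
    ultimately show ?case by (simp add: single_Cons)
  qed
  show "\<forall>K\<in>block S. gen (munit (Inl a) K) * f \<in> Ann"
    using f by (induction rule: sp.induct) (use w word_letters in \<open>auto intro: annihilator_left annihilator_add simp: distrib_left\<close>)
  show "gen (munit (Inl a) (Inl a)) * f - free_scalar (lam $ Inl a) * f \<in> Ann"
    using f
  proof (induction rule: sp.induct)
    case (sp_add f g)
    from annihilator_add[OF sp_add.IH] show ?case by (simp add: algebra_simps)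
  next
    case (sp_j f)
    then show ?case by (intro annihilator_diff annihilator_left)
  qed (use w word_letters in auto)
qed

lemma pass_word:
  assumes "\<forall>B\<in>set u. \<forall>h. gen A * (gen B * h) - gen B * (gen A * h) \<in> Ann"
  shows "gen A * (Poly_Mapping.single u 1 * h) - Poly_Mapping.single u 1 * (gen A * h) \<in> Ann"
  using assms
proof (induction u)
  case Nil
  then show ?case by (simp add: single_Nil free_scalar_eq annihilator_0)
next
  case (Cons B u)
  let ?u = "Poly_Mapping.single u 1"
  have "gen A * (gen B * (?u * h)) - gen B * (gen A * (?u * h)) \<in> Ann" using Cons.prems by simp
  moreover have "gen B * (gen A * (?u * h) - ?u * (gen A * h)) \<in> Ann" using Cons by (intro annihilator_left) auto
  ultimately show ?case
    using annihilator_add by (fastforce simp: single_Cons mult.assoc right_diff_distrib)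
qed

lemma word_cong:
  "(\<And>k b. b \<in> set S \<Longrightarrow> fst c (k, b) = fst c' (k, b)) \<Longrightarrow> snd c \<inter> set S = snd c' \<inter> set S \<Longrightarrow> word S c = word S c'"
proof (induction S)
  case (Cons a S)
  have "a \<in> snd c \<longleftrightarrow> a \<in> snd c'" using Cons.prems(2) by auto
  moreover have "word S c = word S c'" using Cons by (intro Cons.IH) auto
  moreover have "map (\<lambda>k. replicate (fst c (k, a)) (munit (Inl k) (Inl a) :: ('m, 1) gl)) S = map (\<lambda>k. replicate (fst c' (k, a)) (munit (Inl k) (Inl a))) S"
    using Cons.prems(1)[of a] by simp
  ultimately show ?case by (simp only: word.simps)
qed simp

lemma sp_mono:
  assumes a: "a \<notin> set S" and f: "f \<in> sp S"
  shows "f \<in> sp (a # S)"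
  using f
proof (induction rule: sp.induct)
  case (sp_w c k)
  let ?c = "(\<lambda>(j, b). if b = a then 0 else fst c (j, b), snd c - {a})"
  have "lower_conf ?c" using sp_w by (auto simp: lower_conf_def split: if_splits)
  moreover have "word (a # S) ?c = word S c"
  proof -
    have "word S ?c = word S c" using a by (intro word_cong) auto
    moreover have "concat (map (\<lambda>k. []) S) = []" by (induction S) auto
    ultimately show ?thesis by simp
  qed
  ultimately show ?case using sp.sp_w[of ?c "a # S" k] by simp
qed (auto intro: sp.intros)

text \<open>The letters E_(d,a) commute with one another, so the new letter can be moved to its
  place in the row of \<open>a\<close>, raising one exponent.\<close>

lemma row_insert_even:
  assumes dist: "distinct (a # S)" and a: "\<forall>c\<in>set S. a < c" and c: "c \<in> set S" and f: "f \<in> sp (a # S)"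
  shows "gen (munit (Inl c) (Inl a)) * f \<in> sp (a # S)"
  using f
proof (induction rule: sp.induct)
  case (sp_w cc k)
  obtain S1 S2 where S: "S = S1 @ c # S2" using c by (meson split_list)
  let ?row = "\<lambda>T cc. concat (map (\<lambda>k. replicate (fst cc (k, a)) (munit (Inl k) (Inl a) :: ('m, 1) gl)) T)"
  let ?A = "munit (Inl c) (Inl a) :: ('m, 1) gl"
  let ?cc = "((fst cc)((c, a) := Suc (fst cc (c, a))), snd cc)"
  define tl where "tl = (if a \<in> snd cc then [munit (Inr 1) (Inl a)] else []) @ word S cc"
  have w: "word (a # S) cc = ?row S1 cc @ replicate (fst cc (c, a)) ?A @ ?row S2 cc @ tl"
    by (simp add: tl_def S)
  have "word S ?cc = word S cc" using dist by (intro word_cong) auto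
  moreover have "?row S1 ?cc = ?row S1 cc" "?row S2 ?cc = ?row S2 cc"
    using dist by (auto simp: S intro!: arg_cong[of _ _ concat])
  ultimately have w': "word (a # S) ?cc = ?row S1 cc @ ?A # replicate (fst cc (c, a)) ?A @ ?row S2 cc @ tl"
    by (simp add: tl_def S)
  have "\<forall>B\<in>set (?row S1 cc). \<forall>h. gen ?A * (gen B * h) - gen B * (gen ?A * h) \<in> Ann"
  proof (intro ballI allI)
    fix B h assume "B \<in> set (?row S1 cc)"
    then obtain d where d: "d \<in> set S1" "B = munit (Inl d) (Inl a)" by auto
    then have "a \<noteq> d" using dist S by auto
    with d show "gen ?A * (gen B * h) - gen B * (gen ?A * h) \<in> Ann"
      using unit_swap[of "Inl c" "Inl a" "Inl d" "Inl a" h] dist S by (auto simp: unit_sign_def)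
  qed
  from pass_word[OF this, of "Poly_Mapping.single (replicate (fst cc (c, a)) ?A @ ?row S2 cc @ tl) k"]
  have "gen ?A * Poly_Mapping.single (word (a # S) cc) k - Poly_Mapping.single (word (a # S) ?cc) k \<in> Ann"
    unfolding w w' by (simp add: single_append[of "?row S1 cc"] single_Cons)
  moreover have "lower_conf ?cc" using sp_w a c by (auto simp: lower_conf_def)
  ultimately show ?case by (blast intro: sp_eq sp.sp_w)
next
  case (sp_add f g)
  then show ?case by (auto simp: distrib_left intro: sp.sp_add)
qed (auto intro: sp.intros annihilator_left)

lemma row_insert_odd:
  assumes dist: "distinct (a # S)" and f: "f \<in> sp (a # S)"
  shows "gen (munit (Inr 1) (Inl a)) * f \<in> sp (a # S)"
  using f
proof (induction rule: sp.induct)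
  case (sp_w c k)
  let ?row = "concat (map (\<lambda>k. replicate (fst c (k, a)) (munit (Inl k) (Inl a) :: ('m, 1) gl)) S)"
  let ?Y = "munit (Inr 1) (Inl a) :: ('m, 1) gl"
  let ?t = "Poly_Mapping.single (word S c) k"
  have "\<forall>B\<in>set ?row. \<forall>h. gen ?Y * (gen B * h) - gen B * (gen ?Y * h) \<in> Ann"
  proof (intro ballI allI)
    fix B h assume "B \<in> set ?row"
    then obtain d where d: "d \<in> set S" "B = munit (Inl d) (Inl a)" by auto
    then have "a \<noteq> d" using dist by auto
    with d show "gen ?Y * (gen B * h) - gen B * (gen ?Y * h) \<in> Ann"
      using unit_swap[of "Inr 1" "Inl a" "Inl d" "Inl a" h] dist by (auto simp: unit_sign_def)
  qed
  note pass = pass_word[OF this]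
  show ?case
  proof (cases "a \<in> snd c")
    case True
    \<comment> \<open>The relation of the odd unit with itself only says that twice its square is
      zero; multiplying by 1/2 shows that a repeated letter gives zero.\<close>
    have "gen ?Y * (gen ?Y * ?t) + gen ?Y * (gen ?Y * ?t) \<in> Ann"
      using unit_swap[of "Inr 1" "Inl a" "Inr 1" "Inl a" ?t] by (simp add: unit_sign_def)
    from annihilator_left[OF this, of "free_scalar (1 / 2)"]
    have "free_scalar (1 / 2 + 1 / 2) * (gen ?Y * (gen ?Y * ?t)) \<in> Ann"
      unfolding free_scalar_eq(2) by (simp add: distrib_left distrib_right)
    then have "gen ?Y * (gen ?Y * ?t) \<in> Ann" by (simp add: free_scalar_eq)
    from annihilator_add[OF pass[of "gen ?Y * ?t"] annihilator_left[OF this, of "Poly_Mapping.single ?row 1"]]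
    have "gen ?Y * (Poly_Mapping.single ?row 1 * (gen ?Y * ?t)) \<in> Ann" by simp
    then show ?thesis using True by (intro sp_j) (simp add: single_append[of ?row] single_Cons)
  next
    case False
    let ?c = "(fst c, insert a (snd c))"
    have "word S ?c = word S c" using dist by (intro word_cong) auto
    then have "gen ?Y * Poly_Mapping.single (word (a # S) c) k - Poly_Mapping.single (word (a # S) ?c) k \<in> Ann"
      using pass[of ?t] False by (simp add: single_append[of ?row] single_Cons)
    moreover have "lower_conf ?c" using sp_w by (simp add: lower_conf_def)
    ultimately show ?thesis by (blast intro: sp_eq sp.sp_w)
  qed
next
  case (sp_add f g)
  then show ?case by (auto simp: distrib_left intro: sp.sp_add)
qed (auto intro: sp.intros annihilator_left)

lemma block_Cons: "block (a # S) = insert (Inl a) (block S)"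
  by (auto simp: block_def)

text \<open>Induction on the indices from the largest to the smallest. With none left, the only unit
  is E_(\<delta>,\<delta>), which lies in the Borel subalgebra.\<close>

lemma sp_closed:
  "sorted_wrt (<) S \<Longrightarrow> I \<in> block S \<Longrightarrow> J \<in> block S \<Longrightarrow> f \<in> sp S \<Longrightarrow> gen (munit I J) * f \<in> sp S"
proof (induction S arbitrary: I J f)
  case Nil
  then have IJ: "munit I J \<in> borel_sub" by (intro munit_borel) (auto simp: block_def)
  show ?case using Nil.prems(4)
  proof (induction rule: sp.induct)
    case (sp_w c k)
    have "gen (munit I J) * free_scalar k - free_scalar (weight_at lam (munit I J) * k) \<in> Ann"
      using annihilator_left[OF annihilator_borel[OF IJ, of lam], of "free_scalar k"]
      by (simp add: right_diff_distrib free_scalar_central[of k] free_scalar_eq)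
    moreover have "free_scalar (weight_at lam (munit I J) * k) \<in> sp []"
      using sp.sp_w[OF sp_w, of "[]"] by (simp add: single_Nil)
    ultimately show ?case by (auto simp: single_Nil intro: sp_eq)
  qed (auto intro: sp.intros annihilator_left simp: distrib_left)
next
  case (Cons a S)
  have s: "sorted_wrt (<) S" "\<forall>c\<in>set S. a < c" using Cons.prems(1) by auto
  have dist: "distinct (a # S)" using Cons.prems(1) by (metis strict_sorted_iff)
  have row: "gen (munit K (Inl a)) * f \<in> sp (a # S)" if "K \<in> block S" "f \<in> sp (a # S)" for K f
  proof (cases K)
    case (Inl c)
    then show ?thesis using that row_insert_even[OF dist s(2)] by (auto simp: block_def)
  next
    case (Inr b)
    then show ?thesis using that row_insert_odd[OF dist] num1_eq1[of b] by auto
  qed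
  \<comment> \<open>Induction on the prefix of letters E_(K,a), for all units of the enlarged block
    at once: commuting a unit past one letter yields units of the same block in front of a shorter
    prefix. With the prefix exhausted, the unit is inside \<open>S\<close>, or kills, or is E_(a,a),
    or is a new letter of the row.\<close>
  have main: "gen (munit I J) * (Poly_Mapping.single r 1 * g) \<in> sp (a # S)"
    if "I \<in> block (a # S)" "J \<in> block (a # S)" "\<forall>B\<in>set r. \<exists>K\<in>block S. B = munit K (Inl a)" "g \<in> sp S" for I J r g
    using that(1-3)
  proof (induction r arbitrary: I J)
    case Nil
    have g: "g \<in> sp (a # S)" using dist that(4) by (intro sp_mono) auto
    consider "I \<in> block S" "J \<in> block S" | "I = Inl a" "J \<in> block S" | "I = Inl a" "J = Inl a" | "I \<in> block S" "J = Inl a"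
      using Nil.prems by (auto simp: block_Cons)
    then have "gen (munit I J) * g \<in> sp (a # S)"
    proof cases
      case 1
      then show ?thesis using Cons.IH[OF s(1) _ _ that(4)] dist by (intro sp_mono) auto
    next
      case 2
      then show ?thesis using sp_kill(1)[OF s(2) that(4)] by (intro sp_j) auto
    next
      case 3
      then show ?thesis using sp_kill(2)[OF s(2) that(4)] sp_scalar[OF g] by (auto intro: sp_eq)
    next
      case 4
      then show ?thesis using row g by auto
    qed
    then show ?case by (simp add: single_Nil free_scalar_eq)
  next
    case (Cons B r)
    then obtain K where K: "K \<in> block S" "B = munit K (Inl a)" by auto
    let ?h = "Poly_Mapping.single r 1 * g"
    have ih: "gen (munit I J) * ?h \<in> sp (a # S)" if "I \<in> block (a # S)" "J \<in> block (a # S)" for I J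
      using Cons.IH[OF that] Cons.prems by auto
    have "unit_sign I J K (Inl a) * (gen B * (gen (munit I J) * ?h)) + (if J = K then gen (munit I (Inl a)) * ?h else 0)
      - unit_sign I J K (Inl a) * (if I = Inl a then gen (munit K J) * ?h else 0) \<in> sp (a # S)"
      unfolding K(2)
      using K Cons.prems by (intro sp_diff sp_add sp_sign row) (auto simp: sp_0 block_Cons intro!: ih)
    then show ?case
      using unit_swap[of I J K "Inl a" ?h] K by (auto simp: single_Cons mult.assoc intro: sp_eq)
  qed
  show ?case using Cons.prems(4)
  proof (induction rule: sp.induct)
    case (sp_w c k)
    let ?r = "concat (map (\<lambda>k. replicate (fst c (k, a)) (munit (Inl k) (Inl a) :: ('m, 1) gl)) S) @ (if a \<in> snd c then [munit (Inr 1) (Inl a)] else [])"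
    have "\<forall>B\<in>set ?r. \<exists>K\<in>block S. B = munit K (Inl a)" by (auto simp: block_def split: if_splits)
    from main[OF Cons.prems(2,3) this sp.sp_w[OF sp_w, of S k]] show ?case
      by (simp add: single_append[symmetric])
  next
    case (sp_add f g)
    then show ?case by (auto simp: distrib_left intro: sp.sp_add)
  qed (auto intro: sp.intros annihilator_left)
qed

section \<open>Ordered monomials as a basis of the module\<close>

definition indices :: "'m list" where "indices = sorted_list_of_set UNIV"

lemma indices: "sorted_wrt (<) indices" "set indices = UNIV" "distinct indices"
  by (simp_all add: indices_def)

abbreviation fock_rep :: "('m, 1) gl \<Rightarrow> 'm conf op" where "fock_rep \<equiv> mat_op (fock_unit indices)"

lemma Ann_gen_add: "gen (A + B) * h - (gen A * h + gen B * h) \<in> Ann"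
proof -
  have "gen (A + B) - gen A - gen B \<in> env_rels UNIV"
    unfolding env_rels_def by blast
  from Ann_rel[OF this, of h] show ?thesis by (simp add: algebra_simps)
qed

lemma Ann_gen_scale: "gen (scale_mat c A) * h - free_scalar c * (gen A * h) \<in> Ann"
proof -
  have "gen (scale_mat c A) - free_scalar c * gen A \<in> env_rels UNIV"
    unfolding env_rels_def by blast
  from Ann_rel[OF this, of h] show ?thesis by (simp add: algebra_simps)
qed

lemma block_indices: "block indices = UNIV"
proof -
  have "K \<in> block indices" for K by (cases K) (auto simp: block_def indices)
  then show ?thesis by blast
qed

lemma sp_gen:
  assumes "f \<in> sp indices"
  shows "gen A * f \<in> sp indices"
proof -
  have *: "gen (\<Sum>p\<in>F. scale_mat (A $ fst p $ snd p) (munit (fst p) (snd p))) * f \<in> sp indices" if "finite F" for F :: "(('m + 1) \<times> ('m + 1)) set"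
    using that
  proof (induction F rule: finite_induct)
    case empty
    then show ?case using Ann_gen_0 by (auto intro: sp_j)
  next
    case (insert p F)
    have "gen (scale_mat (A $ fst p $ snd p) (munit (fst p) (snd p))) * f \<in> sp indices"
      by (rule sp_eq[OF Ann_gen_scale sp_scalar]) (rule sp_closed[OF indices(1) _ _ assms], simp_all add: block_indices)
    then show ?case using insert by (auto intro: sp_eq[OF Ann_gen_add] sp_add)
  qed
  have A: "A = (\<Sum>p\<in>UNIV. scale_mat (A $ fst p $ snd p) (munit (fst p) (snd p)))"
  proof (rule mat_eqI)
    fix k l
    have "(\<Sum>p\<in>UNIV. scale_mat (A $ fst p $ snd p) (munit (fst p) (snd p))) $ k $ l = (\<Sum>p\<in>UNIV. if p = (k, l) then A $ k $ l else 0)"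
      unfolding mat_sum by (rule sum.cong) (auto simp: scale_mat_def munit_nth)
    then show "A $ k $ l = (\<Sum>p\<in>UNIV. scale_mat (A $ fst p $ snd p) (munit (fst p) (snd p))) $ k $ l" by simp
  qed
  show ?thesis by (subst A) (rule *[OF finite])
qed

lemma word_0: "word S (\<lambda>_. 0, {}) = []"
proof (induction S)
  case (Cons a S)
  have "concat (map (\<lambda>k. []) S) = []" for S :: "'m list" by (induction S) auto
  then show ?case using Cons by simp
qed simp

lemma sp_all: "f \<in> sp indices"
proof (induction f rule: poly_mapping_add_induct)
  case (single w k)
  show ?case
  proof (induction w)
    case Nil
    have "lower_conf (\<lambda>_. 0, {})" by (simp add: lower_conf_def)
    from sp_w[OF this, of indices k] show ?case by (simp add: word_0)
  qed (simp add: single_Cons sp_gen)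
qed (auto intro: sp_0 sp_add)

definition word_comb :: "('m conf \<Rightarrow>\<^sub>0 complex) \<Rightarrow> (('m, 1) gl list \<Rightarrow>\<^sub>0 complex)" where
  "word_comb g = (\<Sum>c\<in>Poly_Mapping.keys g. Poly_Mapping.single (word indices c) (Poly_Mapping.lookup g c))"

lemma word_comb_add: "word_comb (g + h) = word_comb g + word_comb h"
  unfolding word_comb_def by (rule setsum_keys_plus_distrib) (simp_all add: single_add)

lemma sp_word_comb: "f \<in> sp indices \<Longrightarrow> \<exists>g. (\<forall>c\<in>Poly_Mapping.keys g. lower_conf c) \<and> f - word_comb g \<in> Ann"
proof (induction rule: sp.induct)
  case (sp_j f)
  then show ?case by (intro exI[of _ 0]) (simp add: word_comb_def)
next
  case (sp_w c k)
  then show ?case by (intro exI[of _ "Poly_Mapping.single c k"]) (simp add: word_comb_def annihilator_0)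
next
  case (sp_add f f')
  then obtain g g' where g: "\<forall>c\<in>Poly_Mapping.keys g. lower_conf c" "f - word_comb g \<in> Ann"
    "\<forall>c\<in>Poly_Mapping.keys g'. lower_conf c" "f' - word_comb g' \<in> Ann" by blast
  have "\<forall>c\<in>Poly_Mapping.keys (g + g'). lower_conf c" using g keys_add[of g g'] by blast
  moreover have "f + f' - word_comb (g + g') \<in> Ann"
    using annihilator_add[OF g(2,4)] by (simp add: word_comb_add algebra_simps)
  ultimately show ?case by blast
qed

definition word_coeff :: "'m conf \<Rightarrow> complex" where
  "word_coeff c = (SOME q. q \<noteq> 0 \<and> ap (prod_list (map fock_rep (word indices c))) vac = scl q (dlt c))"

lemma word_coeff:
  assumes "lower_conf c"
  shows "word_coeff c \<noteq> 0" "ap (prod_list (map fock_rep (word indices c))) vac = scl (word_coeff c) (dlt c)"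
proof -
  have "restrict_conf indices c = c" by (cases c) (simp add: restrict_conf_def indices)
  then have "\<exists>q. q \<noteq> 0 \<and> ap (prod_list (map fock_rep (word indices c))) vac = scl q (dlt c)"
    using word_vec[of "[]" indices c] indices assms by (auto simp: lower_conf_def)
  then have "word_coeff c \<noteq> 0 \<and> ap (prod_list (map fock_rep (word indices c))) vac = scl (word_coeff c) (dlt c)"
    unfolding word_coeff_def by (rule someI_ex)
  then show "word_coeff c \<noteq> 0" "ap (prod_list (map fock_rep (word indices c))) vac = scl (word_coeff c) (dlt c)" by auto
qed

abbreviation vec_of :: "(('m, 1) gl list \<Rightarrow>\<^sub>0 complex) \<Rightarrow> 'm conf \<Rightarrow> complex" where
  "vec_of f \<equiv> ap (ev cst fock_rep f) vac"

lemma vec_of_word_comb: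
  assumes "\<forall>c\<in>Poly_Mapping.keys g. lower_conf c"
  shows "vec_of (word_comb g) = (\<lambda>c. Poly_Mapping.lookup g c * word_coeff c)"
proof -
  have ev_sum: "ev cst fock_rep (sum f X) = (\<Sum>c\<in>X. ev cst fock_rep (f c))" for f and X :: "'m conf set"
    by (induction X rule: infinite_finite_induct) (simp_all add: ccst.ev_simps)
  have "vec_of (word_comb g) = (\<Sum>c\<in>Poly_Mapping.keys g. scl (Poly_Mapping.lookup g c * word_coeff c) (dlt c))"
    unfolding word_comb_def ev_sum ap_sum
    by (rule sum.cong) (use assms word_coeff(2) in \<open>auto simp: ccst.ev_single ap_mult ap_cst_scl scl_scl\<close>)
  also have "\<dots> = (\<lambda>c. Poly_Mapping.lookup g c * word_coeff c)"
  proof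
    fix c
    have "(\<Sum>c'\<in>Poly_Mapping.keys g. scl (Poly_Mapping.lookup g c' * word_coeff c') (dlt c')) c
        = (\<Sum>c'\<in>Poly_Mapping.keys g. if c' = c then Poly_Mapping.lookup g c * word_coeff c else 0)"
      unfolding sum_fun_apply by (rule sum.cong) (auto simp: scl_def dlt_def)
    then show "(\<Sum>c'\<in>Poly_Mapping.keys g. scl (Poly_Mapping.lookup g c' * word_coeff c') (dlt c')) c = Poly_Mapping.lookup g c * word_coeff c"
      by (simp add: in_keys_iff)
  qed
  finally show ?thesis .
qed

lemma fock_rep_killed: "f \<in> env_rels UNIV \<Longrightarrow> ev cst fock_rep f = 0"
  by (rule fock_unit_rels[OF indices(3,2)])

lemma fock_rep_hw: "b \<in> borel_sub \<Longrightarrow> ap (fock_rep b) vac = scl (weight_at lam b) vac"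
  by (rule fock_unit_hw[OF indices(1,2)]) simp_all

lemma vec_of_annihilator: "f \<in> Ann \<Longrightarrow> vec_of f = 0"
  by (rule annihilator_universal[where lam = lam and r = fock_rep]) (erule fock_rep_killed, erule fock_rep_hw)

text \<open>Faithfulness of the Fock representation on the highest weight vector: modulo
  \<open>Ann\<close> every f is a combination of ordered monomials, and these have linearly
  independent images.\<close>

lemma annihilator_iff: "f \<in> Ann \<longleftrightarrow> vec_of f = 0"
proof
  assume "f \<in> Ann"
  then show "vec_of f = 0" by (rule vec_of_annihilator)
next
  assume f: "vec_of f = 0"
  obtain g where g: "\<forall>c\<in>Poly_Mapping.keys g. lower_conf c" "f - word_comb g \<in> Ann"
    using sp_word_comb[OF sp_all] by blast
  from vec_of_annihilator[OF g(2)] f have "vec_of (word_comb g) = 0"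
    by (simp only: ccst.ev_diff ap_diff diff_0 neg_equal_0_iff_equal)
  then have "Poly_Mapping.lookup g c * word_coeff c = 0" for c
    unfolding vec_of_word_comb[OF g(1)] by (metis zero_fun_apply)
  then have "g = 0" using word_coeff(1) g(1)
    by (metis in_keys_iff keys_eq_empty equals0I mult_eq_0_iff)
  then show "f \<in> Ann" using g(2) by (simp add: word_comb_def)
qed

lemma pres_fock_unit: "pres (fock_unit indices I J)"
  unfolding fock_unit_def unit_op_def
  using pres_xop[OF indices(1)] pres_yop[OF indices(1)] pres_hop
  by (auto simp: indices intro!: pres_diff pres_add pres_mult pres_0 split: sum.split)

lemma vec_of_fin: "vec_of f \<in> fock_space"
proof -
  have r: "pres (fock_rep A)" for A unfolding mat_op_def by (intro pres_sum pres_mult pres_cst pres_fock_unit)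
  have "pres (prod_list (map fock_rep w))" for w by (induction w) (auto intro: pres_1 pres_mult r)
  then have "pres (ev cst fock_rep f)" unfolding ev_def by (intro pres_sum pres_mult pres_cst)
  moreover have "vac \<in> fock_space" by (rule fock_spaceI[of "{(\<lambda>_. 0, {})}"]) (auto simp: dlt_def split: if_splits)
  ultimately show ?thesis unfolding pres_def by blast
qed

lemma vec_of_surj:
  assumes q: "q \<in> fock_space"
  shows "\<exists>f. vec_of f = q"
proof -
  have fin: "finite {c. q c / word_coeff c \<noteq> 0}"
    by (rule finite_subset[OF _ fock_space_finite[OF q]]) auto
  define g where "g = Abs_poly_mapping (\<lambda>c. q c / word_coeff c)"
  have l: "Poly_Mapping.lookup g c = q c / word_coeff c" for c
    unfolding g_def using fin by (simp add: Abs_poly_mapping_inverse)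
  have lower_conf: "lower_conf c" if "q c \<noteq> 0" for c
    using fock_space_lower[OF q, of "fst c" "snd c"] that by (auto simp: lower_conf_def)
  have "\<forall>c\<in>Poly_Mapping.keys g. lower_conf c" using lower_conf by (auto simp: in_keys_iff l)
  moreover have "q c / word_coeff c * word_coeff c = q c" for c using word_coeff(1)[OF lower_conf[of c]] by auto
  ultimately have "vec_of (word_comb g) = q" by (simp add: vec_of_word_comb l)
  then show ?thesis by blast
qed

text \<open>
  Equality of kernel and image of \<open>A\<close> on the Verma module, in terms of representatives.
\<close>

definition exact_at :: "('m, 1) gl \<Rightarrow> bool" where
  "exact_at A \<longleftrightarrow> (\<forall>f. gen A * f \<in> Ann \<longleftrightarrow> (\<exists>g. f - gen A * g \<in> Ann))"

lemma vec_of_gen: "vec_of (gen A * f) = ap (fock_rep A) (vec_of f)"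
  by (simp add: ccst.ev_simps ap_mult)

lemma exact_at_iff: "exact_at A \<longleftrightarrow> (\<forall>q\<in>fock_space. ap (fock_rep A) q = 0 \<longleftrightarrow> (\<exists>r\<in>fock_space. q = ap (fock_rep A) r))"
proof -
  have 1: "gen A * f \<in> Ann \<longleftrightarrow> ap (fock_rep A) (vec_of f) = 0" for f by (simp only: annihilator_iff vec_of_gen)
  have 2: "f - gen A * g \<in> Ann \<longleftrightarrow> vec_of f = ap (fock_rep A) (vec_of g)" for f g
    by (simp only: annihilator_iff ccst.ev_diff ap_diff vec_of_gen eq_iff_diff_eq_0[symmetric])
  show ?thesis
    unfolding exact_at_def 1 2
  proof (rule iffI; intro ballI allI)
    fix q :: "'m conf \<Rightarrow> complex"
    assume *: "\<forall>f. (ap (fock_rep A) (vec_of f) = 0) = (\<exists>g. vec_of f = ap (fock_rep A) (vec_of g))" and "q \<in> fock_space"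
    then obtain f where f: "vec_of f = q" using vec_of_surj by blast
    have "(\<exists>g. q = ap (fock_rep A) (vec_of g)) \<longleftrightarrow> (\<exists>r\<in>fock_space. q = ap (fock_rep A) r)"
      using vec_of_fin vec_of_surj by blast
    then show "(ap (fock_rep A) q = 0) = (\<exists>r\<in>fock_space. q = ap (fock_rep A) r)"
      using spec[OF *, of f] unfolding f by (rule trans[rotated])
  next
    fix f :: "('m, 1) gl list \<Rightarrow>\<^sub>0 complex"
    assume *: "\<forall>q\<in>fock_space. (ap (fock_rep A) q = 0) = (\<exists>r\<in>fock_space. q = ap (fock_rep A) r)"
    have "(\<exists>g. vec_of f = ap (fock_rep A) (vec_of g)) \<longleftrightarrow> (\<exists>r\<in>fock_space. vec_of f = ap (fock_rep A) r)"
      using vec_of_fin vec_of_surj by blast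
    then show "(ap (fock_rep A) (vec_of f) = 0) = (\<exists>g. vec_of f = ap (fock_rep A) (vec_of g))"
      using bspec[OF * vec_of_fin[of f]] by (simp only:)
  qed
qed

section \<open>From list positions to shifted weights\<close>

lemma indices_split:
  obtains R S where "indices = R @ i # S" "set S = {j. i < j}" "length S = card {j. i < j}"
proof -
  obtain R S where RS: "indices = R @ i # S" using indices(2) by (metis UNIV_I split_list)
  have s: "sorted_wrt (<) (R @ i # S)" using indices(1) RS by simp
  have "set S = {j. i < j}"
  proof (intro equalityI subsetI)
    fix j assume "j \<in> set S" then show "j \<in> {j. i < j}" using s by (simp add: sorted_wrt_append)
  next
    fix j assume j: "j \<in> {j. i < j}"
    have "j \<in> set (R @ i # S)" using indices(2) RS by simp
    then show "j \<in> set S" using s j by (auto simp: sorted_wrt_append dest: less_asym)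
  qed
  moreover have "distinct (R @ i # S)" using indices(3) unfolding RS .
  then have "length S = card (set S)" by (simp add: distinct_card)
  ultimately show ?thesis using RS that by simp
qed

definition shifted_weight :: "'m \<Rightarrow> complex" where
  "shifted_weight i = lam $ Inl i + lam $ Inr 1 + of_nat (card {j. i < j})"

lemma exact_at_unit: "exact_at (munit (Inl i) (Inr 1)) \<longleftrightarrow> (\<forall>p\<ge>i. shifted_weight p \<noteq> 0) \<or> shifted_weight i \<notin> \<nat>"
proof -
  obtain R S where RS: "indices = R @ i # S" "set S = {j. i < j}" "length S = card {j. i < j}" by (rule indices_split)
  have r: "fock_rep (munit (Inl i) (Inr 1)) = xop (R @ i # S) i"
    by (simp add: mat_op_munit fock_unit_def unit_op_def RS(1)[symmetric])
  have s: "sorted_wrt (<) (R @ i # S)" using indices(1) RS by simp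
  \<comment> \<open>The square of this operator vanishes, so the image always lies in the kernel and
    only the reverse inclusion is at stake.\<close>
  have "xop indices i * xop indices i = - (xop indices i * xop indices i)"
    using step_and_rels(1)[OF indices(3)] unfolding triple_rels_def indices(2) by blast
  then have sq: "xop (R @ i # S) i * xop (R @ i # S) i = 0" unfolding RS(1) by (rule op_two)
  have sq': "ap (xop (R @ i # S) i) (ap (xop (R @ i # S) i) r) = 0" for r
    unfolding ap_mult[symmetric] sq ap_0 ..
  have "exact_at (munit (Inl i) (Inr 1)) \<longleftrightarrow>
      (\<forall>f\<in>fock_space. ap (xop (R @ i # S) i) f = 0 \<longrightarrow> (\<exists>g\<in>fock_space. f = ap (xop (R @ i # S) i) g))"
    unfolding exact_at_iff r using sq' by metis
  also have "\<dots> \<longleftrightarrow> typical (i # S) \<or> shifted_weight i \<notin> \<nat>"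
    unfolding xop_exact_iff[OF s] shifted_weight_def RS(3) ..
  also have "typical (i # S) \<longleftrightarrow> (\<forall>p\<ge>i. shifted_weight p \<noteq> 0)"
  proof -
    have len: "length S2 = card {j. p < j}" if "i # S = S1 @ p # S2" for S1 p S2
    proof -
      have e: "indices = (R @ S1) @ p # S2" using RS(1) that by simp
      obtain R' S' where RS': "indices = R' @ p # S'" "length S' = card {j. p < j}" by (rule indices_split)
      have "distinct ((R @ S1) @ p # S2)" using indices(3) unfolding e .
      then have "p \<notin> set (R @ S1)" "p \<notin> set S2" by auto
      moreover have "(R @ S1) @ p # S2 = R' @ p # S'" using e RS'(1) by simp
      ultimately have "S2 = S'" using append_Cons_eq_iff[of p "R @ S1" S2 R' S'] by blast
      then show ?thesis using RS'(2) by simp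
    qed
    have ip: "(\<exists>S1 S2. i # S = S1 @ p # S2) \<longleftrightarrow> i \<le> p" for p
    proof -
      have "(\<exists>S1 S2. i # S = S1 @ p # S2) \<longleftrightarrow> p \<in> set (i # S)" by (rule in_set_conv_decomp[symmetric])
      also have "\<dots> \<longleftrightarrow> i \<le> p" unfolding list.set RS(2) le_less by blast
      finally show ?thesis .
    qed
    show ?thesis unfolding typical_iff
    proof (intro iffI allI impI)
      fix p assume *: "\<forall>S1 p S2. i # S = S1 @ p # S2 \<longrightarrow> lam $ Inl p + lam $ Inr 1 + of_nat (length S2) \<noteq> 0" and "i \<le> p"
      then obtain S1 S2 where e: "i # S = S1 @ p # S2" using ip by blast
      then show "shifted_weight p \<noteq> 0" using * len[OF e] unfolding shifted_weight_def by metis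
    next
      fix S1 p S2 assume *: "\<forall>p\<ge>i. shifted_weight p \<noteq> 0" and e: "i # S = S1 @ p # S2"
      then have "shifted_weight p \<noteq> 0" using ip by blast
      then show "lam $ Inl p + lam $ Inr 1 + of_nat (length S2) \<noteq> 0" unfolding shifted_weight_def len[OF e] .
    qed
  qed
  finally show ?thesis .
qed

end

section \<open>Conjugation by the Borel group\<close>

lemma gl_part_mult:
  assumes "A \<in> gl_part a" "B \<in> gl_part b"
  shows "A ** B \<in> gl_part (a \<noteq> b)"
  unfolding gl_part_def
proof (intro CollectI allI impI)
  fix k l assume "(A ** B) $ k $ l \<noteq> 0"
  then obtain j where "A $ k $ j * B $ j $ l \<noteq> 0"
    unfolding matrix_matrix_mult_def by (auto elim: sum.not_neutral_contains_not_neutral)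
  then have "(isl k \<noteq> isl j) = a" "(isl j \<noteq> isl l) = b" using assms by (auto simp: gl_part_def)
  then show "(isl k \<noteq> isl l) = (a \<noteq> b)" by auto
qed

lemma borel_group_inverse:
  fixes g :: "('m::{finite,linorder}, 1) gl"
  assumes g: "g \<in> borel_sub" "g \<in> gl_part False" and h: "h ** g = mat 1"
  shows "h \<in> borel_sub" "h \<in> gl_part False"
proof -
  have hg: "(\<Sum>j\<in>UNIV. h $ k $ j * g $ j $ l) = (if k = l then 1 else 0)" for k l
    using arg_cong[OF h, of "\<lambda>A. A $ k $ l"] by (simp add: matrix_matrix_mult_def mat_def)
  \<comment> \<open>Induction over the columns in the order \<open>upper\<close>. Once the columns
    above l are known to be triangular, only one term of the product remains in the entries on and
    below the diagonal of column l.\<close>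
  have main: "(\<forall>k. \<not> upper k l \<longrightarrow> h $ k $ l = 0) \<and> g $ l $ l \<noteq> 0" for l
  proof (induction "card {j. upper j l}" arbitrary: l rule: less_induct)
    case less
    have ih: "h $ k $ j = 0" if "upper j l" "j \<noteq> l" "\<not> upper k j" for k j
    proof -
      have "{i. upper i j} \<subset> {i. upper i l}"
        using that upper_trans upper_antisym upper_refl by blast
      then have "card {i. upper i j} < card {i. upper i l}" by (intro psubset_card_mono) auto
      from less[OF this] that(3) show ?thesis by blast
    qed
    have col: "(\<Sum>j\<in>UNIV. h $ k $ j * g $ j $ l) = h $ k $ l * g $ l $ l" if k: "k = l \<or> \<not> upper k l" for k
    proof -
      have "h $ k $ j * g $ j $ l = (if j = l then h $ k $ l * g $ l $ l else 0)" for j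
      proof (cases "j = l \<or> \<not> upper j l")
        case True
        then show ?thesis using g(1) unfolding borel_sub_eq by auto
      next
        case False
        then have "\<not> upper k j" using k upper_trans upper_antisym by blast
        then show ?thesis using ih False by auto
      qed
      then have "(\<Sum>j\<in>UNIV. h $ k $ j * g $ j $ l) = (\<Sum>j\<in>UNIV. if j = l then h $ k $ l * g $ l $ l else 0)"
        by (intro sum.cong) auto
      then show ?thesis by simp
    qed
    have gl: "h $ l $ l * g $ l $ l = 1" using col[of l] hg[of l l] by simp
    then have "g $ l $ l \<noteq> 0" by auto
    moreover have "h $ k $ l = 0" if "\<not> upper k l" for k
    proof -
      have "k \<noteq> l" using that upper_refl by auto
      then have "h $ k $ l * g $ l $ l = 0" using col[of k] hg[of k l] that by simp
      then show ?thesis using \<open>g $ l $ l \<noteq> 0\<close> by simp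
    qed
    ultimately show ?case by blast
  qed
  then show b: "h \<in> borel_sub" unfolding borel_sub_eq by blast
  have "h $ k $ l = 0" if neq: "isl k \<noteq> isl l" for k l
  proof (cases "upper k l")
    case True
    then obtain i c where kl: "k = Inl i" "l = Inr c" using neq by (cases k; cases l) auto
    have "h $ k $ j * g $ j $ l = (if j = l then h $ k $ l * g $ l $ l else 0)" for j
    proof (cases "j = l")
      case False
      then have "isl j" using kl num1_eq_True by (cases j) auto
      then have "g $ j $ l = 0" using g(2) kl unfolding gl_part_def by fastforce
      then show ?thesis using False by simp
    qed simp
    then have "(\<Sum>j\<in>UNIV. h $ k $ j * g $ j $ l) = (\<Sum>j\<in>UNIV. if j = l then h $ k $ l * g $ l $ l else 0)"
      by (intro sum.cong) auto
    then have "h $ k $ l * g $ l $ l = 0" using hg[of k l] kl by simp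
    then show ?thesis using main[of l] by simp
  next
    case False
    then show ?thesis using main by blast
  qed
  then show "h \<in> gl_part False" unfolding gl_part_def by blast
qed

lemma matrix_inv_props:
  assumes "invertible (g :: ('m::finite, 'n::finite) gl)"
  shows "g ** matrix_inv g = mat 1" "matrix_inv g ** g = mat 1"
proof -
  have "g ** matrix_inv g = mat 1 \<and> matrix_inv g ** g = mat 1"
    unfolding matrix_inv_def by (rule someI_ex) (use assms in \<open>simp add: invertible_def\<close>)
  then show "g ** matrix_inv g = mat 1" "matrix_inv g ** g = mat 1" by auto
qed

lemma matrix_scale_mult: "g ** scale_mat c A = scale_mat c (g ** A)" "scale_mat c A ** g = scale_mat c (A ** g)"
  by (simp_all add: scale_mat_def matrix_matrix_mult_def vec_eq_iff sum_distrib_left mult.assoc mult.left_commute)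

interpretation cfree: central_hom free_scalar
  by unfold_locales (rule free_scalar_eq free_scalar_central)+

lemma ev_free_gen: "ev free_scalar gen f = f"
proof (induction f rule: poly_mapping_add_induct)
  case (single w k)
  have "prod_list (map gen w) = Poly_Mapping.single w 1" for w :: "'a list"
    by (induction w) (simp_all add: single_Nil free_scalar_eq single_Cons)
  then show ?case by (simp add: cfree.ev_single single_scalar[symmetric])
qed (simp_all add: cfree.ev_simps)

context gl_verma
begin

text \<open>
  An element of the Borel group scales the highest weight vector, so the conjugation automorphism maps
  its annihilator onto itself; exactness is therefore constant along the orbit of a root vector.
\<close>

definition twist :: "(('m, 1) gl \<Rightarrow> ('m, 1) gl) \<Rightarrow> (('m, 1) gl list \<Rightarrow>\<^sub>0 complex) \<Rightarrow> (('m, 1) gl list \<Rightarrow>\<^sub>0 complex)" where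
  "twist t = ev free_scalar (\<lambda>A. gen (t A))"

lemma ev_twist: "ev cst r (twist t f) = ev cst (\<lambda>A. r (t A)) f"
proof (induction f rule: poly_mapping_add_induct)
  case (single w k)
  have "ev cst r (prod_list (map (\<lambda>A. gen (t A)) w)) = prod_list (map (\<lambda>A. r (t A)) w)"
    by (induction w) (simp_all add: ccst.ev_simps)
  then show ?case by (simp add: twist_def cfree.ev_single ccst.ev_simps ccst.ev_single)
qed (simp_all add: twist_def cfree.ev_simps ccst.ev_simps)

lemma twist_twist: "twist s (twist t f) = twist (\<lambda>A. s (t A)) f"
proof (induction f rule: poly_mapping_add_induct)
  case (single w k)
  have "twist s (prod_list (map (\<lambda>A. gen (t A)) w)) = prod_list (map (\<lambda>A. gen (s (t A))) w)"
    by (induction w) (simp_all add: twist_def cfree.ev_simps)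
  then show ?case by (simp add: twist_def cfree.ev_single cfree.ev_simps)
qed (simp_all add: twist_def cfree.ev_simps)

text \<open>Conjugation is moved from the module to the representation: \<open>fock_rep\<close>
  composed with it again satisfies the relations, and \<open>vac\<close> keeps its weight because
  conjugation by a triangular matrix preserves the diagonal of a triangular matrix. The universal
  property then applies to this second representation.\<close>

lemma annihilator_twist:
  assumes g: "g \<in> borel_sub" "g \<in> gl_part False" "h \<in> borel_sub" "h \<in> gl_part False"
    and gh: "g ** h = mat 1" "h ** g = mat 1" and f: "f \<in> Ann"
  shows "twist (\<lambda>A. g ** A ** h) f \<in> Ann"
proof -
  let ?t = "\<lambda>A. g ** A ** h"
  have tmult: "?t A ** ?t B = ?t (A ** B)" for A B
  proof -
    have "?t A ** ?t B = g ** A ** (h ** g) ** B ** h" by (simp only: matrix_mul_assoc)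
    then show ?thesis by (simp only: gh matrix_mul_rid matrix_mul_assoc)
  qed
  have tpart: "?t A \<in> gl_part a" if "A \<in> gl_part a" for A a
    using gl_part_mult[OF gl_part_mult[OF g(2) that] g(4)] by simp
  have lin: "?t (A + B) = ?t A + ?t B" "?t (A - B) = ?t A - ?t B" "?t (- B) = - ?t B" for A B
    by (simp_all add: matrix_matrix_mult_def vec_eq_iff distrib_left distrib_right sum.distrib sum_negf sum_subtractf left_diff_distrib right_diff_distrib)
  have bracket: "sbracket (?t A) (?t B) = ?t (sbracket A B)" if "A \<in> gl_part a" "B \<in> gl_part b" for A B a b
    unfolding sbracket_homog[OF tpart[OF that(1)] tpart[OF that(2)]] sbracket_homog[OF that] by (simp add: tmult lin)
  have rels: "ev cst (\<lambda>A. fock_rep (?t A)) r = 0" if "r \<in> env_rels UNIV" for r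
  proof (rule env_rels_killed[OF _ _ _ that])
    show "fock_rep (?t A) * fock_rep (?t B) - (if a \<and> b then - 1 else 1) * (fock_rep (?t B) * fock_rep (?t A)) = fock_rep (?t (sbracket A B))"
      if AB: "A \<in> gl_part a" "B \<in> gl_part b" for a b A B
      unfolding bracket[OF AB, symmetric]
      using step_and_rels(1)[OF indices(3)] unfolding fock_unit_def indices(2)
      by (intro mat_op_bracket unit_rels tpart AB)
  qed (simp_all add: lin mat_op_add matrix_scale_mult mat_op_scale)
  have hw: "ap (fock_rep (?t b)) vac = scl (weight_at lam b) vac" if b: "b \<in> borel_sub" for b
  proof -
    have tb: "?t b \<in> borel_sub" using b g by (intro borel_mult)
    have "?t b $ k $ k = b $ k $ k" for k
    proof -
      have "g $ k $ k * h $ k $ k = 1"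
        using borel_diag_mult[OF g(1,3), of k] by (simp add: gh mat_def)
      moreover have "?t b $ k $ k = g $ k $ k * b $ k $ k * h $ k $ k"
        using b g by (simp add: borel_diag_mult borel_mult)
      ultimately show ?thesis by (metis mult.assoc mult.commute mult.right_neutral)
    qed
    then have "weight_at lam (?t b) = weight_at lam b" by (simp add: weight_at_def)
    then show ?thesis using fock_rep_hw[OF tb] by simp
  qed
  have "ap (ev cst (\<lambda>A. fock_rep (?t A)) f) vac = 0"
    by (rule annihilator_universal[where lam = lam, OF rels hw f])
  then show ?thesis unfolding annihilator_iff ev_twist .
qed

lemma exact_at_twist:
  assumes g: "g \<in> borel_sub" "g \<in> gl_part False" "h \<in> borel_sub" "h \<in> gl_part False"
    and gh: "g ** h = mat 1" "h ** g = mat 1" and A: "exact_at A"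
  shows "exact_at (g ** A ** h)"
proof -
  let ?t = "twist (\<lambda>A. g ** A ** h)" and ?u = "twist (\<lambda>A. h ** A ** g)"
  have gen: "twist s (gen B * f) = gen (s B) * twist s f" "twist s (f - f') = twist s f - twist s f'" for s B f f'
    by (simp_all add: twist_def cfree.ev_simps)
  have inv: "h ** (g ** B ** h) ** g = B" "g ** (h ** B ** g) ** h = B" for B
  proof -
    have "h ** (g ** B ** h) ** g = (h ** g) ** B ** (h ** g)" "g ** (h ** B ** g) ** h = (g ** h) ** B ** (g ** h)"
      by (simp_all only: matrix_mul_assoc)
    then show "h ** (g ** B ** h) ** g = B" "g ** (h ** B ** g) ** h = B"
      by (simp_all only: gh matrix_mul_lid matrix_mul_rid)
  qed
  have ut: "?u (?t f) = f" "?t (?u f) = f" for f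
    unfolding twist_twist inv twist_def[of "\<lambda>A. A"] by (rule ev_free_gen)+
  have J: "?t f \<in> Ann \<longleftrightarrow> f \<in> Ann" "?u f \<in> Ann \<longleftrightarrow> f \<in> Ann" for f
    using annihilator_twist[OF g gh] annihilator_twist[OF g(3,4,1,2) gh(2,1)] ut by metis+
  show ?thesis
    unfolding exact_at_def
  proof
    fix f
    have "gen (g ** A ** h) * f \<in> Ann \<longleftrightarrow> gen A * ?u f \<in> Ann"
      using J(2)[of "gen (g ** A ** h) * f"] by (simp add: gen inv)
    also have "\<dots> \<longleftrightarrow> (\<exists>k. ?u f - gen A * k \<in> Ann)" using A unfolding exact_at_def by blast
    also have "\<dots> \<longleftrightarrow> (\<exists>k. f - gen (g ** A ** h) * ?t k \<in> Ann)"
    proof -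
      have "?u f - gen A * k \<in> Ann \<longleftrightarrow> f - gen (g ** A ** h) * ?t k \<in> Ann" for k
        using J(1)[of "?u f - gen A * k"] by (simp add: gen ut)
      then show ?thesis by simp
    qed
    also have "\<dots> \<longleftrightarrow> (\<exists>k. f - gen (g ** A ** h) * k \<in> Ann)" using ut(2) by metis
    finally show "gen (g ** A ** h) * f \<in> Ann \<longleftrightarrow> (\<exists>k. f - gen (g ** A ** h) * k \<in> Ann)" .
  qed
qed

lemma exact_at_scale_imp:
  assumes "c \<noteq> 0" "exact_at A"
  shows "exact_at (scale_mat c A)"
proof -
  have eq: "f - g \<in> Ann \<Longrightarrow> f \<in> Ann \<longleftrightarrow> g \<in> Ann" for f g
    using annihilator_add[of "f - g" lam g] annihilator_diff[of f lam "f - g"] by auto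
  have "gen (scale_mat c A) * f \<in> Ann \<longleftrightarrow> gen A * f \<in> Ann" for f
  proof -
    have "free_scalar c * (gen A * f) \<in> Ann \<longleftrightarrow> gen A * f \<in> Ann"
    proof
      assume "free_scalar c * (gen A * f) \<in> Ann"
      from annihilator_left[OF this, of "free_scalar (1 / c)"] assms(1) show "gen A * f \<in> Ann"
        by (simp add: mult.assoc[symmetric] free_scalar_eq(1,3)[symmetric] del: free_scalar_eq) (simp add: free_scalar_eq(1))
    qed (rule annihilator_left)
    then show ?thesis using eq[OF Ann_gen_scale[of c A f]] by simp
  qed
  moreover have "(\<exists>g. f - gen (scale_mat c A) * g \<in> Ann) \<longleftrightarrow> (\<exists>g. f - gen A * g \<in> Ann)" for f
  proof -
    have 1: "f - gen (scale_mat c A) * g \<in> Ann \<longleftrightarrow> f - gen A * (free_scalar c * g) \<in> Ann" for g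
    proof (rule eq)
      have "gen A * (free_scalar c * g) = free_scalar c * (gen A * g)"
        by (rule comm_left[OF free_scalar_central, symmetric])
      then show "f - gen (scale_mat c A) * g - (f - gen A * (free_scalar c * g)) \<in> Ann"
        using annihilator_neg[OF Ann_gen_scale[of c A g]] by simp
    qed
    have "free_scalar c * free_scalar (1 / c) = (1 :: ('m, 1) gl list \<Rightarrow>\<^sub>0 complex)"
      using assms(1) by (simp add: free_scalar_eq(1) flip: free_scalar_eq(3))
    then have 2: "free_scalar c * (free_scalar (1 / c) * g) = g" for g :: "('m, 1) gl list \<Rightarrow>\<^sub>0 complex"
      by (simp flip: mult.assoc)
    show ?thesis unfolding 1 using 2 by metis
  qed
  ultimately show ?thesis using assms(2) unfolding exact_at_def by simp
qed

lemma exact_at_scale: "c \<noteq> 0 \<Longrightarrow> exact_at (scale_mat c A) \<longleftrightarrow> exact_at A"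
proof
  assume c: "c \<noteq> 0" and "exact_at (scale_mat c A)"
  then have "exact_at (scale_mat (1 / c) (scale_mat c A))" by (auto dest: exact_at_scale_imp[of "1 / c" "scale_mat c A", rotated])
  moreover have "scale_mat (1 / c) (scale_mat c A) = A" using c by (simp add: scale_mat_def vec_eq_iff)
  ultimately show "exact_at A" by (simp only:)
qed (rule exact_at_scale_imp)

end

section \<open>The orbit of an odd root vector\<close>

lemma eps_nth: "eps i $ Inl j = (if j = i then 1 else 0)" "eps i $ Inr b = 0"
  and del_nth: "del b $ Inl j = 0" "del b $ Inr b' = (if b' = b then 1 else 0)"
  by (simp_all add: eps_def del_def axis_def)

lemma weight_form_odd: "weight_form \<alpha> (eps i - del b) = \<alpha> $ Inl i + \<alpha> $ Inr b"
  by (simp add: weight_form_def eps_nth del_nth mult_if sum_negf)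

lemma sum_even_pos_roots:
  fixes i :: "'m::{finite,linorder}" and b :: 1
  shows "(\<Sum>\<alpha>\<in>even_pos_roots. \<alpha> :: ('m, 1) weight) $ Inl i
      = of_nat (card {j. i < j}) - of_nat (card {j. j < i})"
    "(\<Sum>\<alpha>\<in>even_pos_roots. \<alpha> :: ('m, 1) weight) $ Inr b = 0"
proof -
  let ?P = "(SIGMA a:(UNIV :: 'm set). {b. a < b})"
  let ?r = "\<lambda>(a, b). eps a - eps b :: ('m, 1) weight"
  have e: "even_pos_roots = ?r ` ?P"
  proof -
    have "\<not> k < l" for k l :: 1 by (metis num1_eq1 less_irrefl)
    then have "{del k - del l | k l :: 1. k < l} = ({} :: ('m, 1) weight set)" by blast
    then show ?thesis unfolding even_pos_roots_def by auto
  qed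
  have inj: "inj_on ?r ?P"
  proof (rule inj_onI)
    fix p q assume "p \<in> ?P" "q \<in> ?P" "?r p = ?r q"
    then show "p = q"
      using axis_diff_inj[of "Inl (fst p) :: 'm + 1" "Inl (snd p)" "Inl (fst q)" "Inl (snd q)"]
      by (auto simp: eps_def)
  qed
  have s: "(\<Sum>\<alpha>\<in>even_pos_roots. \<alpha>) $ k = (\<Sum>a\<in>UNIV. \<Sum>b\<in>{b. a < b}. (eps a :: ('m, 1) weight) $ k - eps b $ k)" for k
  proof -
    have "(\<Sum>\<alpha>\<in>even_pos_roots. \<alpha>) $ k = (\<Sum>p\<in>?P. ?r p $ k)"
      unfolding e sum_component by (rule sum.reindex_cong[OF inj]) auto
    also have "\<dots> = (\<Sum>a\<in>UNIV. \<Sum>b\<in>{b. a < b}. (eps a :: ('m, 1) weight) $ k - eps b $ k)"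
      by (subst sum.Sigma) (auto intro!: sum.cong)
    finally show ?thesis .
  qed
  show "(\<Sum>\<alpha>\<in>even_pos_roots. \<alpha> :: ('m, 1) weight) $ Inr b = 0" unfolding s by (simp add: eps_nth)
  have "(\<Sum>a\<in>UNIV. \<Sum>b\<in>{b. a < b}. if i = a then 1 else 0) = (\<Sum>a\<in>UNIV. if a = i then of_nat (card {j. i < j}) else (0 :: complex))"
    by (rule sum.cong) auto
  moreover have "(\<Sum>a\<in>UNIV. \<Sum>b\<in>{b. a < b}. if i = b then 1 else 0) = (\<Sum>a\<in>UNIV. if a < i then 1 else (0 :: complex))"
    by (rule sum.cong) auto
  moreover have "(\<Sum>a\<in>UNIV. if a < i then 1 else (0 :: complex)) = of_nat (card {j. j < i})"
    by (simp add: sum.If_cases)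
  ultimately show "(\<Sum>\<alpha>\<in>even_pos_roots. \<alpha> :: ('m, 1) weight) $ Inl i
      = of_nat (card {j. i < j}) - of_nat (card {j. j < i})"
    unfolding s by (simp add: eps_nth sum_subtractf)
qed

lemma sum_odd_pos_roots:
  fixes i :: "'m::finite" and b :: 1
  shows "(\<Sum>\<alpha>\<in>odd_pos_roots. \<alpha> :: ('m, 1) weight) $ Inl i = 1"
    "(\<Sum>\<alpha>\<in>odd_pos_roots. \<alpha> :: ('m, 1) weight) $ Inr b = - of_nat CARD('m)"
proof -
  let ?r = "\<lambda>a. eps a - del 1 :: ('m, 1) weight"
  have e: "odd_pos_roots = range ?r"
  proof -
    have "del j = (del 1 :: ('m, 1) weight)" for j :: 1 by (metis num1_eq1)
    then show ?thesis unfolding odd_pos_roots_def by auto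
  qed
  have inj: "inj ?r"
    by (rule injI) (use axis_diff_inj[of "Inl _ :: 'm + 1" "Inr 1" "Inl _" "Inr 1"] in \<open>auto simp: eps_def del_def\<close>)
  have s: "(\<Sum>\<alpha>\<in>odd_pos_roots. \<alpha>) $ k = (\<Sum>a\<in>UNIV. ?r a $ k)" for k
    unfolding e sum_component by (rule sum.reindex_cong[OF inj]) auto
  show "(\<Sum>\<alpha>\<in>odd_pos_roots. \<alpha> :: ('m, 1) weight) $ Inl i = 1"
    unfolding s by (simp add: eps_nth del_nth)
  have "b = 1" by (metis num1_eq1)
  then show "(\<Sum>\<alpha>\<in>odd_pos_roots. \<alpha> :: ('m, 1) weight) $ Inr b = - of_nat CARD('m)"
    unfolding s by (simp add: eps_nth del_nth)
qed

context gl_verma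
begin

text \<open>The half sums contribute (#{j > i} - #{j < i} - 1 + m) / 2. Since m = #{j > i} + #{j <
  i} + 1, only #{j > i} survives, which is the length of the list behind \<open>i\<close>.\<close>

lemma form_rho: "weight_form (lam + rho) (eps i - del 1) = shifted_weight i"
proof -
  have "(UNIV :: 'm set) = {j. i < j} \<union> ({j. j < i} \<union> {i})" by auto
  then have "CARD('m) = card ({j. i < j} \<union> ({j. j < i} \<union> {i}))" by simp
  also have "\<dots> = card {j. i < j} + (card {j. j < i} + 1)"
    by (subst card_Un_disjoint, simp, simp, force, subst card_Un_disjoint) auto
  finally have m: "of_nat CARD('m) = of_nat (card {j. i < j}) + of_nat (card {j. j < i}) + (1 :: complex)" by simp
  show ?thesis
    unfolding weight_form_odd rho_def shifted_weight_def vector_add_component vector_minus_component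
      vector_smult_component sum_even_pos_roots sum_odd_pos_roots m
    by (simp add: field_simps)
qed

lemma iso_set: "{eps i - del 1 :: ('m, 1) weight} \<in> iso_sets"
proof -
  have "eps i - del 1 \<in> (odd_roots :: ('m, 1) weight set)"
    unfolding odd_roots_def odd_pos_roots_def by blast
  moreover have "weight_form (eps i - del 1) (eps i - del 1 :: ('m, 1) weight) = 0"
    unfolding weight_form_odd by (simp add: eps_nth del_nth)
  moreover have "(eps i - del 1 :: ('m, 1) weight) \<noteq> 0"
  proof
    assume "eps i - del 1 = (0 :: ('m, 1) weight)"
    from arg_cong[OF this, of "\<lambda>v. v $ Inl i"] show False by (simp add: eps_nth del_nth)
  qed
  ultimately show ?thesis
    unfolding iso_sets_def by (simp add: vec.dependent_single)
qed

lemma iso_set_iff: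
  "{eps i - del 1} \<in> verma_iso_sets lam \<longleftrightarrow> \<not> exact_at (munit (Inl i) (Inr 1))"
proof -
  let ?E = "munit (Inl i) (Inr 1) :: ('m, 1) gl"
  obtain c where c: "c \<noteq> 0" "root_vector (eps i - del 1 :: ('m, 1) weight) = scale_mat c ?E"
    by (rule root_vector_eq)
  have orbit: "adj_orbit {eps i - del 1} = {g ** scale_mat c ?E ** matrix_inv g | g. g \<in> borel_group}"
    unfolding adj_orbit_def by (simp add: c(2))
  have mem: "g ** scale_mat c ?E ** matrix_inv g \<in> assoc_variety (verma lam) (verma_act lam) \<longleftrightarrow> \<not> exact_at ?E"
    if g: "g \<in> borel_group" for g
  proof -
    let ?x = "scale_mat c ?E" and ?h = "matrix_inv g"
    have g': "g \<in> borel_sub" "g \<in> gl_part False" and gh: "g ** ?h = mat 1" "?h ** g = mat 1"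
      using g matrix_inv_props[of g] unfolding borel_group_def by auto
    note h = borel_group_inverse[OF g' gh(2)]
    let ?y = "g ** ?x ** ?h"
    have xp: "?x \<in> gl_part True" using munit_part[of "Inl i" "Inr 1"] by (auto simp: gl_part_def scale_mat_def)
    have yp: "?y \<in> gl_part True" using gl_part_mult[OF gl_part_mult[OF g'(2) xp] h(2)] by simp
    have "?y ** ?y = g ** ?x ** (?h ** g) ** ?x ** ?h" by (simp only: matrix_mul_assoc)
    also have "\<dots> = g ** (?x ** ?x) ** ?h" by (simp only: gh matrix_mul_rid matrix_mul_assoc)
    also have "?x ** ?x = 0" by (simp add: matrix_scale_mult munit_mult) (simp add: scale_mat_def vec_eq_iff)
    finally have "?y ** ?y = 0" by (simp add: matrix_matrix_mult_def vec_eq_iff)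
    then have "?y \<in> self_commuting" unfolding self_commuting_def using yp by (simp add: sbracket_homog[OF yp yp])
    then have "?y \<in> assoc_variety (verma lam) (verma_act lam) \<longleftrightarrow> \<not> exact_at ?y"
      unfolding assoc_variety_iff exact_at_def by blast
    also have "exact_at ?y \<longleftrightarrow> exact_at ?x"
    proof
      assume "exact_at ?y"
      from exact_at_twist[OF h g' gh(2,1) this] have "exact_at (?h ** ?y ** g)" .
      moreover have "?h ** ?y ** g = (?h ** g) ** ?x ** (?h ** g)" by (simp only: matrix_mul_assoc)
      ultimately show "exact_at ?x" by (simp only: gh matrix_mul_lid matrix_mul_rid)
    qed (rule exact_at_twist[OF g' h gh])
    also have "\<dots> \<longleftrightarrow> exact_at ?E" by (rule exact_at_scale[OF c(1)])
    finally show ?thesis .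
  qed
  \<comment> \<open>The orbit is nonempty; as membership is constant along it, inclusion of the
    whole orbit is decided at a single point.\<close>
  have "mat 1 \<in> (borel_group :: ('m, 1) gl set)"
  proof -
    have "invertible (mat 1 :: ('m, 1) gl)" unfolding invertible_def by (rule exI[of _ "mat 1"]) simp
    then show ?thesis
      unfolding borel_group_def borel_sub_eq gl_part_def by (auto simp: mat_def upper_refl)
  qed
  then show ?thesis
    unfolding verma_iso_sets_def using iso_set mem by (auto simp: orbit)
qed

end

theorem theorem5p17:
  fixes lam :: "('m::{finite,linorder}, 1) weight" and p i :: 'm
  assumes "atypical lam"
    and "weight_form (lam + rho) (eps p - del 1) = 0"
    and "\<forall>j>p. weight_form (lam + rho) (eps j - del 1) \<noteq> 0"
  shows "{eps i - del 1} \<in> verma_iso_sets lam \<longleftrightarrow>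
           i \<le> p \<and> weight_form (lam + rho) (eps i - del 1) \<in> \<nat>"
proof -
  interpret gl_verma lam .
  \<comment> \<open>\<open>p\<close> is the largest index at which the shifted weight vanishes, so a
    zero at or above \<open>i\<close> exists exactly when \<open>i\<close> does not exceed
    it.\<close>
  have "(\<exists>j\<ge>i. shifted_weight j = 0) \<longleftrightarrow> i \<le> p"
    using assms(2,3) unfolding form_rho by (metis leI le_less_trans order.trans not_le)
  then show ?thesis
    unfolding iso_set_iff exact_at_unit form_rho by blast
qed

end
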